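(* Let $(A,\sigma)$ be an Azumaya algebra with involution of the first kind over $K$. Then in $SW(K)$ (isometry classes of nondegenerate symmetric bilinear forms over $K$): $$\lambda^2(\langle1\rangle_\sigma)=\langle2\rangle T_\sigma^{-\varepsilon(\sigma)}.$$
   Context: $K$ is a field of characteristic $\ne2$; an Azumaya algebra with involution of the first kind over $K$ is an Azumaya $K$-algebra $A$ with a $K$-linear involution $\sigma$; $\varepsilon(\sigma)=1$ if $\sigma$ is orthogonal, $-1$ if symplectic. $\otimes=\otimes_K$. $\langle1\rangle_\sigma$ is the hermitian form $(x,y)\mapsto\sigma(x)y$ on the right $A$-module $A$. $\langle 2\rangle b$ is the form $2\cdot b$. $T_\sigma(x,y)=\mathrm{Trd}_A(\sigma(x)y)$ is the involution trace form on $A$; $T_\sigma^{+}=T_\sigma^{1}$ (resp. $T_\sigma^-=T_\sigma^{-1}$) is its restriction to the subspace $\{x\in A:\sigma(x)=x\}$ (resp. $\{x\in A:\sigma(x)=-x\}$). The Goldman element $g_A=\sum a_i\otimes b_i\in A\otimes A$ is characterized by $\sum a_ixb_i=\mathrm{Trd}_A(x)$ for all $x\in A$. Put $s_2=1-g_A\in A\otimes A$ and $\mathrm{Alt}^2(A)=s_2(A\otimes A)$, a right $A\otimes A$-module, with hermitian form over $(A\otimes A,\sigma\otimes\sigma)$ given by $\mathrm{Alt}^2(\langle1\rangle_\sigma)(s_2x,s_2y)=(\sigma\otimes\sigma)(s_2x)\,y$. $|A|_\sigma$ is the left $A\otimes A$-module $A$ with action $(a\otimes b)\cdot x=ax\sigma(b)$.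 $\lambda^2(\langle1\rangle_\sigma)\in SW(K)$ is the isometry class of the symmetric bilinear space $\mathrm{Alt}^2(A)\otimes_{A\otimes A}|A|_\sigma$ with form $(u\otimes v,u'\otimes v')\mapsto T_\sigma(v,\mathrm{Alt}^2(\langle1\rangle_\sigma)(u,u')\cdot v')$. *)

theory Defs
  imports
    "HOL-Algebra.Algebraic_Closure_Type"
    "HOL-Computational_Algebra.Group_Closure"
    "HOL-Library.Poly_Mapping"
    "HOL-Library.Set_Algebras"
    "Jordan_Normal_Form.Matrix"
begin

section \<open>Tensor products\<close>

text \<open>
  The tensor product of a right \<open>R\<close>-module \<open>M\<close> and a left \<open>R\<close>-module \<open>N\<close> is the free abelian
  group on \<open>M \<times> N\<close> modulo the usual relations.  Its elements are cosets, so the sum of two of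
  them is their sum \<open>U + W\<close> as sets, and its zero is the subgroup of relations itself.
  (On sets, \<open>-\<close> is complement resp. set difference; the opposite of a coset \<open>U\<close> is
  \<open>uminus ` U\<close>.)
\<close>

definition tensor_ker ::
  "'m::plus set \<Rightarrow> 'r set \<Rightarrow> ('m \<Rightarrow> 'r \<Rightarrow> 'm) \<Rightarrow> 'n::plus set \<Rightarrow> ('r \<Rightarrow> 'n \<Rightarrow> 'n) \<Rightarrow>
    ('m \<times> 'n \<Rightarrow>\<^sub>0 int) set" where
  "tensor_ker M R ract N lact = group_closure
    ({frag_of (x + x', y) - frag_of (x, y) - frag_of (x', y) | x x' y. x \<in> M \<and> x' \<in> M \<and> y \<in> N} \<union>
     {frag_of (x, y + y') - frag_of (x, y) - frag_of (x, y') | x y y'. x \<in> M \<and> y \<in> N \<and> y' \<in> N} \<union>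
     {frag_of (ract x r, y) - frag_of (x, lact r y) | x r y. x \<in> M \<and> r \<in> R \<and> y \<in> N})"

definition tensor_carrier ::
  "'m::plus set \<Rightarrow> 'r set \<Rightarrow> ('m \<Rightarrow> 'r \<Rightarrow> 'm) \<Rightarrow> 'n::plus set \<Rightarrow> ('r \<Rightarrow> 'n \<Rightarrow> 'n) \<Rightarrow>
    ('m \<times> 'n \<Rightarrow>\<^sub>0 int) set set" where
  "tensor_carrier M R ract N lact =
    {f +o tensor_ker M R ract N lact | f. Poly_Mapping.keys f \<subseteq> M \<times> N}"

text \<open>
  The additive map on a tensor product with \<open>m \<otimes> n \<mapsto> h (m, n)\<close>; meaningful when \<open>h\<close> is
  biadditive and balanced.
\<close>

definition tensor_lift :: "('b \<Rightarrow> 'c::ring_1) \<Rightarrow> ('b \<Rightarrow>\<^sub>0 int) set \<Rightarrow> 'c" where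
  "tensor_lift h U =
    the_elem ((\<lambda>f. \<Sum>p\<in>Poly_Mapping.keys f. of_int (Poly_Mapping.lookup f p) * h p) ` U)"

text \<open>Tensor products over a field \<open>'k\<close> of two vector spaces given by their scalar multiplications.\<close>

definition vtensor_ker ::
  "('k \<Rightarrow> 'a::plus \<Rightarrow> 'a) \<Rightarrow> ('k \<Rightarrow> 'b::plus \<Rightarrow> 'b) \<Rightarrow> ('a \<times> 'b \<Rightarrow>\<^sub>0 int) set" where
  "vtensor_ker sA sB = tensor_ker UNIV UNIV (\<lambda>a k. sA k a) UNIV sB"

definition vtensor ::
  "('k \<Rightarrow> 'a::plus \<Rightarrow> 'a) \<Rightarrow> ('k \<Rightarrow> 'b::plus \<Rightarrow> 'b) \<Rightarrow> ('a \<times> 'b \<Rightarrow>\<^sub>0 int) set set" where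
  "vtensor sA sB = tensor_carrier UNIV UNIV (\<lambda>a k. sA k a) UNIV sB"


section \<open>Azumaya algebras with involution of the first kind\<close>

definition k_algebra :: "('k::field \<Rightarrow> 'a::ring_1 \<Rightarrow> 'a) \<Rightarrow> bool" where
  "k_algebra s \<longleftrightarrow> vector_space s \<and>
    (\<forall>k a b. s k (a * b) = s k a * b) \<and> (\<forall>k a b. s k (a * b) = a * s k b)"

text \<open>The map \<open>\<Sum> a\<^sub>i \<otimes> b\<^sub>i \<mapsto> (x \<mapsto> \<Sum> a\<^sub>i x b\<^sub>i)\<close>.\<close>

definition sandwich :: "('a::ring_1 \<times> 'a \<Rightarrow>\<^sub>0 int) set \<Rightarrow> 'a \<Rightarrow> 'a" where
  "sandwich z x = tensor_lift (\<lambda>(a, b). a * x * b) z"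

text \<open>
  \<open>A\<close> is Azumaya over \<open>K\<close> if it is a faithful finitely generated projective \<open>K\<close>-module and
  the canonical map from \<open>A \<otimes> A\<^sup>o\<^sup>p\<close> to \<open>End\<^sub>K(A)\<close> is bijective.  Over a field the first
  condition says that \<open>A\<close> is nonzero (which holds for every type of class \<open>ring_1\<close>) and
  finite-dimensional.
\<close>

definition azumaya_algebra :: "('k::field \<Rightarrow> 'a::ring_1 \<Rightarrow> 'a) \<Rightarrow> bool" where
  "azumaya_algebra s \<longleftrightarrow> k_algebra s \<and>
    (\<exists>B. finite B \<and> Modules.module.span s B = UNIV) \<and>
    bij_betw sandwich (vtensor s s) {f. Vector_Spaces.linear s s f}"

definition involution_first_kind :: "('k::field \<Rightarrow> 'a::ring_1 \<Rightarrow> 'a) \<Rightarrow> ('a \<Rightarrow> 'a) \<Rightarrow> bool" where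
  "involution_first_kind s \<sigma> \<longleftrightarrow> Vector_Spaces.linear s s \<sigma> \<and>
    (\<forall>x y. \<sigma> (x * y) = \<sigma> y * \<sigma> x) \<and> (\<forall>x. \<sigma> (\<sigma> x) = x)"


section \<open>Reduced trace and type of an involution\<close>

text \<open>
  Let \<open>L\<close> be the algebraic closure of \<open>K\<close>.  An isomorphism of \<open>L\<close>-algebras
  \<open>A \<otimes> L \<cong> M\<^sub>n(L)\<close> is given by its restriction \<open>\<phi>\<close> to \<open>A\<close>: a homomorphism of
  \<open>K\<close>-algebras whose \<open>L\<close>-linear extension \<open>a \<otimes> l \<mapsto> l \<phi>(a)\<close> (written entrywise below)
  is bijective.
\<close>

definition splitting ::
  "('k::field \<Rightarrow> 'a::ring_1 \<Rightarrow> 'a) \<Rightarrow> nat \<Rightarrow> ('a \<Rightarrow> 'k alg_closure mat) \<Rightarrow> bool" where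
  "splitting s n \<phi> \<longleftrightarrow>
    (\<forall>x. \<phi> x \<in> carrier_mat n n) \<and>
    \<phi> 1 = 1\<^sub>m n \<and>
    (\<forall>x y. \<phi> (x * y) = \<phi> x * \<phi> y) \<and>
    (\<forall>x y. \<phi> (x + y) = \<phi> x + \<phi> y) \<and>
    (\<forall>k x. \<phi> (s k x) = to_ac k \<cdot>\<^sub>m \<phi> x) \<and>
    bij_betw (\<lambda>z. mat n n (\<lambda>(i, j). tensor_lift (\<lambda>(a, l). l * \<phi> a $$ (i, j)) z))
      (vtensor s (\<lambda>k l. to_ac k * l)) (carrier_mat n n)"

text \<open>The value does not depend on the splitting, and lies in \<open>K\<close>.\<close>

definition Trd :: "('k::field \<Rightarrow> 'a::ring_1 \<Rightarrow> 'a) \<Rightarrow> 'a \<Rightarrow> 'k" where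
  "Trd s x = (THE c. \<exists>n \<phi>. splitting s n \<phi> \<and> to_ac c = (\<Sum>i<n. \<phi> x $$ (i, i)))"

text \<open>
  After a splitting, \<open>\<sigma>\<close> is adjoint to the nondegenerate bilinear form
  \<open>(u, v) \<mapsto> u\<^sup>T G v\<close> on \<open>L\<^sup>n\<close>.  As both sides are \<open>L\<close>-linear, it is enough to
  state the adjunction on \<open>A\<close>.
\<close>

definition adjoint_to ::
  "('k::field \<Rightarrow> 'a::ring_1 \<Rightarrow> 'a) \<Rightarrow> ('a \<Rightarrow> 'a) \<Rightarrow> nat \<Rightarrow> ('a \<Rightarrow> 'k alg_closure mat) \<Rightarrow>
    'k alg_closure mat \<Rightarrow> bool" where
  "adjoint_to s \<sigma> n \<phi> G \<longleftrightarrow> splitting s n \<phi> \<and> G \<in> carrier_mat n n \<and> invertible_mat G \<and>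
    (\<forall>x. transpose_mat (\<phi> x) * G = G * \<phi> (\<sigma> x))"

definition orthogonal_involution :: "('k::field \<Rightarrow> 'a::ring_1 \<Rightarrow> 'a) \<Rightarrow> ('a \<Rightarrow> 'a) \<Rightarrow> bool" where
  "orthogonal_involution s \<sigma> \<longleftrightarrow>
    (\<exists>n \<phi> G. adjoint_to s \<sigma> n \<phi> G \<and> transpose_mat G = G)"

definition symplectic_involution :: "('k::field \<Rightarrow> 'a::ring_1 \<Rightarrow> 'a) \<Rightarrow> ('a \<Rightarrow> 'a) \<Rightarrow> bool" where
  "symplectic_involution s \<sigma> \<longleftrightarrow>
    (\<exists>n \<phi> G. adjoint_to s \<sigma> n \<phi> G \<and> transpose_mat G = - G \<and> (\<forall>i<n. G $$ (i, i) = 0))"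

definition involution_sign :: "('k::field \<Rightarrow> 'a::ring_1 \<Rightarrow> 'a) \<Rightarrow> ('a \<Rightarrow> 'a) \<Rightarrow> int" where
  "involution_sign s \<sigma> = (THE e. (orthogonal_involution s \<sigma> \<and> e = 1) \<or>
    (symplectic_involution s \<sigma> \<and> e = -1))"


section \<open>Symmetric bilinear spaces\<close>

text \<open>The fields \<open>mult\<close> and \<open>one\<close> of the underlying module record are irrelevant.\<close>

record ('k, 'v) bilinear_space = "('k, 'v) module" +
  form :: "'v \<Rightarrow> 'v \<Rightarrow> 'k"

definition nondeg_symmetric_space :: "('k::field, 'v) bilinear_space \<Rightarrow> bool" where
  "nondeg_symmetric_space V \<longleftrightarrow>
    Module.module (ring_of_type_algebra :: 'k ring) V \<and>
    (\<exists>B. finite B \<and> B \<subseteq> carrier V \<and>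
      (\<forall>H. submodule H (ring_of_type_algebra :: 'k ring) V \<and> B \<subseteq> H \<longrightarrow> H = carrier V)) \<and>
    (\<forall>x\<in>carrier V. \<forall>y\<in>carrier V. \<forall>z\<in>carrier V.
      form V (x \<oplus>\<^bsub>V\<^esub> y) z = form V x z + form V y z) \<and>
    (\<forall>k. \<forall>x\<in>carrier V. \<forall>y\<in>carrier V. form V (k \<odot>\<^bsub>V\<^esub> x) y = k * form V x y) \<and>
    (\<forall>x\<in>carrier V. \<forall>y\<in>carrier V. form V x y = form V y x) \<and>
    (\<forall>x\<in>carrier V. (\<forall>y\<in>carrier V. form V x y = 0) \<longrightarrow> x = \<zero>\<^bsub>V\<^esub>)"

definition isometric ::
  "('k::field, 'v) bilinear_space \<Rightarrow> ('k, 'w) bilinear_space \<Rightarrow> bool" where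
  "isometric V W \<longleftrightarrow> (\<exists>f. bij_betw f (carrier V) (carrier W) \<and>
    (\<forall>x\<in>carrier V. \<forall>y\<in>carrier V. f (x \<oplus>\<^bsub>V\<^esub> y) = f x \<oplus>\<^bsub>W\<^esub> f y) \<and>
    (\<forall>k. \<forall>x\<in>carrier V. f (k \<odot>\<^bsub>V\<^esub> x) = k \<odot>\<^bsub>W\<^esub> f x) \<and>
    (\<forall>x\<in>carrier V. \<forall>y\<in>carrier V. form W (f x) (f y) = form V x y))"

text \<open>\<open>V\<close> and \<open>W\<close> define elements of \<open>SW(K)\<close>, and these are equal.\<close>

definition SW_eq :: "('k::field, 'v) bilinear_space \<Rightarrow> ('k, 'w) bilinear_space \<Rightarrow> bool" where
  "SW_eq V W \<longleftrightarrow> nondeg_symmetric_space V \<and> nondeg_symmetric_space W \<and> isometric V W"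

definition scale_form :: "'k::field \<Rightarrow> ('k, 'v) bilinear_space \<Rightarrow> ('k, 'v) bilinear_space" where
  "scale_form c V = V\<lparr>form := \<lambda>x y. c * form V x y\<rparr>"


section \<open>Involution trace forms\<close>

definition trace_form ::
  "('k::field \<Rightarrow> 'a::ring_1 \<Rightarrow> 'a) \<Rightarrow> ('a \<Rightarrow> 'a) \<Rightarrow> 'a \<Rightarrow> 'a \<Rightarrow> 'k" where
  "trace_form s \<sigma> x y = Trd s (\<sigma> x * y)"

text \<open>\<open>T\<^sub>\<sigma>\<^sup>\<epsilon>\<close>, used for \<open>\<epsilon> \<in> {1, -1}\<close>.\<close>

definition trace_form_part ::
  "('k::field \<Rightarrow> 'a::ring_1 \<Rightarrow> 'a) \<Rightarrow> ('a \<Rightarrow> 'a) \<Rightarrow> int \<Rightarrow> ('k, 'a) bilinear_space" where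
  "trace_form_part s \<sigma> e =
    \<lparr>carrier = {x. \<sigma> x = of_int e * x}, monoid.mult = undefined, one = undefined,
     ring.zero = 0, add = (+), module.smult = s, form = trace_form s \<sigma>\<rparr>"


section \<open>The exterior square of the rank one hermitian form\<close>

definition aa_mult :: "('k::field \<Rightarrow> 'a::ring_1 \<Rightarrow> 'a) \<Rightarrow>
    ('a \<times> 'a \<Rightarrow>\<^sub>0 int) set \<Rightarrow> ('a \<times> 'a \<Rightarrow>\<^sub>0 int) set \<Rightarrow> ('a \<times> 'a \<Rightarrow>\<^sub>0 int) set" where
  "aa_mult s U W = (\<Union>x\<in>U. \<Union>y\<in>W.
    frag_extend (\<lambda>(a, b). frag_extend (\<lambda>(c, d). frag_of (a * c, b * d)) y) x +o vtensor_ker s s)"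

definition aa_one :: "('k::field \<Rightarrow> 'a::ring_1 \<Rightarrow> 'a) \<Rightarrow> ('a \<times> 'a \<Rightarrow>\<^sub>0 int) set" where
  "aa_one s = frag_of (1, 1) +o vtensor_ker s s"

text \<open>The involution \<open>\<sigma> \<otimes> \<sigma>\<close> of \<open>A \<otimes> A\<close>.\<close>

definition aa_inv :: "('k::field \<Rightarrow> 'a::ring_1 \<Rightarrow> 'a) \<Rightarrow> ('a \<Rightarrow> 'a) \<Rightarrow>
    ('a \<times> 'a \<Rightarrow>\<^sub>0 int) set \<Rightarrow> ('a \<times> 'a \<Rightarrow>\<^sub>0 int) set" where
  "aa_inv s \<sigma> U = (\<Union>x\<in>U. frag_extend (\<lambda>(a, b). frag_of (\<sigma> a, \<sigma> b)) x +o vtensor_ker s s)"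

definition goldman :: "('k::field \<Rightarrow> 'a::ring_1 \<Rightarrow> 'a) \<Rightarrow> ('a \<times> 'a \<Rightarrow>\<^sub>0 int) set" where
  "goldman s = (THE g. g \<in> vtensor s s \<and> (\<forall>x. sandwich g x = s (Trd s x) 1))"

definition s2 :: "('k::field \<Rightarrow> 'a::ring_1 \<Rightarrow> 'a) \<Rightarrow> ('a \<times> 'a \<Rightarrow>\<^sub>0 int) set" where
  "s2 s = aa_one s + uminus ` goldman s"

definition Alt2 :: "('k::field \<Rightarrow> 'a::ring_1 \<Rightarrow> 'a) \<Rightarrow> ('a \<times> 'a \<Rightarrow>\<^sub>0 int) set set" where
  "Alt2 s = aa_mult s (s2 s) ` vtensor s s"

text \<open>\<open>(u, s\<^sub>2 y) \<mapsto> (\<sigma> \<otimes> \<sigma>)(u) y\<close>\<close>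

definition Alt2_form :: "('k::field \<Rightarrow> 'a::ring_1 \<Rightarrow> 'a) \<Rightarrow> ('a \<Rightarrow> 'a) \<Rightarrow>
    ('a \<times> 'a \<Rightarrow>\<^sub>0 int) set \<Rightarrow> ('a \<times> 'a \<Rightarrow>\<^sub>0 int) set \<Rightarrow> ('a \<times> 'a \<Rightarrow>\<^sub>0 int) set" where
  "Alt2_form s \<sigma> u u' =
    (THE z. \<exists>y\<in>vtensor s s. u' = aa_mult s (s2 s) y \<and> z = aa_mult s (aa_inv s \<sigma> u) y)"

text \<open>The action of \<open>A \<otimes> A\<close> on \<open>|A|\<^sub>\<sigma>\<close>.\<close>

definition twisted_action :: "('a::ring_1 \<Rightarrow> 'a) \<Rightarrow> ('a \<times> 'a \<Rightarrow>\<^sub>0 int) set \<Rightarrow> 'a \<Rightarrow> 'a" where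
  "twisted_action \<sigma> z x = tensor_lift (\<lambda>(a, b). a * x * \<sigma> b) z"

definition lambda2_ker :: "('k::field \<Rightarrow> 'a::ring_1 \<Rightarrow> 'a) \<Rightarrow> ('a \<Rightarrow> 'a) \<Rightarrow>
    (('a \<times> 'a \<Rightarrow>\<^sub>0 int) set \<times> 'a \<Rightarrow>\<^sub>0 int) set" where
  "lambda2_ker s \<sigma> = tensor_ker (Alt2 s) (vtensor s s) (aa_mult s) UNIV (twisted_action \<sigma>)"

definition lambda2 :: "('k::field \<Rightarrow> 'a::ring_1 \<Rightarrow> 'a) \<Rightarrow> ('a \<Rightarrow> 'a) \<Rightarrow>
    ('k, (('a \<times> 'a \<Rightarrow>\<^sub>0 int) set \<times> 'a \<Rightarrow>\<^sub>0 int) set) bilinear_space" where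
  "lambda2 s \<sigma> =
    \<lparr>carrier = tensor_carrier (Alt2 s) (vtensor s s) (aa_mult s) UNIV (twisted_action \<sigma>),
     monoid.mult = undefined, one = undefined,
     ring.zero = lambda2_ker s \<sigma>, add = (+),
     module.smult = (\<lambda>k U. \<Union>x\<in>U. frag_extend (\<lambda>(u, v). frag_of (u, s k v)) x +o lambda2_ker s \<sigma>),
     form = (\<lambda>U W. tensor_lift (\<lambda>(u, v). tensor_lift (\<lambda>(u', v').
       trace_form s \<sigma> v (twisted_action \<sigma> (Alt2_form s \<sigma> u u') v')) W) U)\<rparr>"

end

theory Submission
  imports Defs "HOL-Library.Function_Algebras" "Jordan_Normal_Form.Char_Poly"
begin

text \<open>
  The Azumaya property identifies \<open>A \<otimes> A\<close> with \<open>End\<^sub>K(A)\<close> via \<open>\<Sum> a \<otimes> b \<mapsto> (x \<mapsto> \<Sum> a x b)\<close>, so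
  identities between tensors can be tested on sandwiches.  There is a nonzero linear form \<open>\<tau>\<close> with
  \<open>\<tau> (x y) = \<tau> (y x)\<close>; let \<open>g = \<Sum> a \<otimes> b\<close> be the tensor with \<open>\<Sum> a x b = \<tau> x\<close>.  Then
  \<open>(x \<otimes> y) g = g (y \<otimes> x)\<close>, and Schur's lemma shows that in an irreducible representation over the
  algebraic closure \<open>g\<close> is a multiple \<open>t\<close> of the interchange of the tensor factors.  This single fact yields
  Burnside's theorem (the representation is a splitting), the Skolem--Noether theorem and
  \<open>\<tau> = t Trd\<close>.  On \<open>|A|\<^sub>\<sigma>\<close> the element \<open>g\<close> acts as \<open>c \<sigma>\<close> with \<open>c \<in> K\<close>, and comparing with a
  form \<open>G\<close> to which \<open>\<sigma>\<close> is adjoint gives \<open>t G = c G\<^sup>T\<close>.  Hence \<open>t = \<plusminus>c\<close>, the reduced trace takes values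
  in \<open>K\<close>, and the Goldman element acts on \<open>|A|\<^sub>\<sigma>\<close> as \<open>\<epsilon>(\<sigma>) \<sigma>\<close>.

  Every element of \<open>Alt\<^sup>2(A) \<otimes> |A|\<^sub>\<sigma>\<close> is of the form \<open>s\<^sub>2 \<otimes> v\<close>, and it vanishes iff
  \<open>s\<^sub>2 v = v - \<epsilon> \<sigma>(v) = 0\<close>, since then \<open>v = (1 + g) (v / 2)\<close> and \<open>s\<^sub>2 (1 + g) = 1 - g\<^sup>2 = 0\<close>.  The isometry is
  \<open>s\<^sub>2 \<otimes> v \<mapsto> (v - \<epsilon> \<sigma>(v)) / 2\<close>.
\<close>


section \<open>Tensor products as quotients of free abelian groups\<close>

text \<open>\<open>Trd\<close> and \<open>involution_sign\<close> are definite descriptions over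
  splittings, whereas the hypothesis on \<open>A\<close> speaks only of sandwiches. The existence of
  a splitting, the independence of its choice and the fact that traces lie in \<open>K\<close> must
  all be drawn from the bijectivity of the sandwich map. The Goldman element is not yet available
  for this, being defined through \<open>Trd\<close>; an arbitrary cyclic form \<tau> takes its
  place, and the same results are applied a second time with \<tau> = \<open>Trd\<close>, where t =
  1. Schur's lemma requires the algebraic closure; the way back to \<open>K\<close> is provided by
  the involution, since c comes from a central element of \<open>A\<close>.

  The factor 2 has the following origin. The form of \<open>lambda2\<close> at the classes of v and
  w is T(alt v, w) with alt v = v - \<epsilon> \<sigma>(v). As alt v is an eigenvector of \<sigma>
  for -\<epsilon>, T(alt v, alt w) = 2 T(alt v, w), so halving alt turns T(alt v, w) into twice the
  trace form. Characteristic different from 2 provides the division by 2 and keeps the two signs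
  apart.\<close>

definition frag_eval :: "('b \<Rightarrow> 'c::ring_1) \<Rightarrow> ('b \<Rightarrow>\<^sub>0 int) \<Rightarrow> 'c" where
  "frag_eval h f = (\<Sum>p\<in>Poly_Mapping.keys f. of_int (Poly_Mapping.lookup f p) * h p)"

lemma frag_eval_superset:
  assumes "finite S" "Poly_Mapping.keys f \<subseteq> S"
  shows "frag_eval h f = (\<Sum>p\<in>S. of_int (Poly_Mapping.lookup f p) * h p)"
  unfolding frag_eval_def
  by (rule sum.mono_neutral_left) (use assms in \<open>auto simp: in_keys_iff\<close>)

lemma frag_eval_0 [simp]: "frag_eval h 0 = 0"
  by (simp add: frag_eval_def)

lemma frag_eval_of [simp]: "frag_eval h (frag_of p) = h p"
  by (simp add: frag_eval_def)

lemma frag_eval_add: "frag_eval h (f + g) = frag_eval h f + frag_eval h g"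
proof -
  let ?S = "Poly_Mapping.keys f \<union> Poly_Mapping.keys g"
  have "Poly_Mapping.keys (f + g) \<subseteq> ?S" by (rule keys_add)
  then show ?thesis
    by (simp add: frag_eval_superset[of ?S] lookup_add distrib_right sum.distrib)
qed

lemma frag_eval_minus: "frag_eval h (- f) = - frag_eval h f"
  by (simp add: frag_eval_def sum_negf)

lemma frag_eval_diff: "frag_eval h (f - g) = frag_eval h f - frag_eval h g"
  using frag_eval_add[of h f "- g"] by (simp add: frag_eval_minus)

lemma frag_eval_additive:
  assumes "\<And>x y. m (x + y) = m x + m y"
  shows "m (frag_eval h f) = frag_eval (\<lambda>p. m (h p)) f"
proof -
  have 0: "m 0 = 0" using assms[of 0 0] by simp
  have m: "m (- x) = - m x" for x
    using assms[of x "- x"] 0 by (simp add: eq_neg_iff_add_eq_0 add.commute)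
  have d: "m (x - y) = m x - m y" for x y
    using assms[of x "- y"] m by simp
  show ?thesis
    by (rule frag_induction[where S = UNIV and c = f]) (auto simp: 0 d frag_eval_diff)
qed

lemma frag_eval_extend: "frag_eval h (frag_extend k f) = frag_eval (\<lambda>p. frag_eval h (k p)) f"
  by (rule frag_induction[where S = UNIV and c = f])
    (auto simp: frag_eval_diff frag_extend_diff)

lemma frag_eval_cong:
  "(\<And>p. p \<in> Poly_Mapping.keys f \<Longrightarrow> h p = h' p) \<Longrightarrow> frag_eval h f = frag_eval h' f"
  by (simp add: frag_eval_def)

lemma frag_eval_distrib: "frag_eval (\<lambda>p. h p + h' p) f = frag_eval h f + frag_eval h' f"
  by (simp add: frag_eval_def distrib_left sum.distrib)

lemma frag_eval_sum:
  "frag_eval (\<lambda>p. \<Sum>i\<in>I. h i p) f = (\<Sum>i\<in>I. frag_eval (h i) f)"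
  unfolding frag_eval_def sum_distrib_left by (rule sum.swap)

lemma frag_eval_mult_left: "frag_eval (\<lambda>p. c * h p) f = c * frag_eval h f"
  by (rule frag_eval_additive[symmetric]) (simp add: distrib_left)

lemma frag_eval_mult_right: "frag_eval (\<lambda>p. h p * c) f = frag_eval h f * c"
  by (rule frag_eval_additive[symmetric, of "\<lambda>x. x * c"]) (simp add: distrib_right)

lemma frag_eval_swap:
  "frag_eval (\<lambda>p. frag_eval (\<lambda>q. h p q) g) f = frag_eval (\<lambda>q. frag_eval (\<lambda>p. h p q) f) g"
proof (rule frag_induction[where S = UNIV and c = f])
  show "frag_eval (\<lambda>p. frag_eval (h p) g) 0 = frag_eval (\<lambda>q. frag_eval (\<lambda>p. h p q) 0) g"
    by (simp add: frag_eval_def)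
  show "frag_eval (\<lambda>p. frag_eval (h p) g) (a - b) =
      frag_eval (\<lambda>q. frag_eval (\<lambda>p. h p q) (a - b)) g"
    if "frag_eval (\<lambda>p. frag_eval (h p) g) a = frag_eval (\<lambda>q. frag_eval (\<lambda>p. h p q) a) g"
      "frag_eval (\<lambda>p. frag_eval (h p) g) b = frag_eval (\<lambda>q. frag_eval (\<lambda>p. h p q) b) g" for a b
    using that by (simp add: frag_eval_diff) (simp add: frag_eval_def right_diff_distrib sum_subtractf)
qed auto


section \<open>Cosets of subgroups and maps between quotients\<close>

lemma coset_eq_iff:
  fixes f g :: "'b::ab_group_add"
  shows "f +o group_closure S = g +o group_closure S \<longleftrightarrow> f - g \<in> group_closure S"
proof
  assume "f +o group_closure S = g +o group_closure S"
  moreover have "f \<in> f +o group_closure S"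
    using set_plus_intro2[of 0 "group_closure S" f] by simp
  ultimately show "f - g \<in> group_closure S" by (simp add: set_plus_imp_minus)
next
  have sub: "x +o group_closure S \<subseteq> y +o group_closure S" if "x - y \<in> group_closure S" for x y
  proof
    fix z assume "z \<in> x +o group_closure S"
    then have "(z - x) + (x - y) \<in> group_closure S"
      using that by (intro group_closure_add) (auto dest: set_plus_imp_minus)
    then show "z \<in> y +o group_closure S" by (simp add: set_minus_imp_plus)
  qed
  assume *: "f - g \<in> group_closure S"
  then have "g - f \<in> group_closure S"
    using group_closure_minus_iff[of "f - g" S] by simp
  with * show "f +o group_closure S = g +o group_closure S"
    using sub by blast
qed

lemma group_closure_plus_self:
  "group_closure S + group_closure S = (group_closure S :: 'b::ab_group_add set)"
proof
  show "group_closure S + group_closure S \<subseteq> group_closure S"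
    by (auto elim!: set_plus_elim intro: group_closure_add)
  show "group_closure S \<subseteq> group_closure S + group_closure S"
    by (rule set_zero_plus2) simp
qed

lemma coset_plus_coset:
  fixes f g :: "'b::ab_group_add"
  shows "(f +o group_closure S) + (g +o group_closure S) = (f + g) +o group_closure S"
  by (simp add: set_plus_rearrange group_closure_plus_self)

lemma coset_uminus:
  fixes f :: "'b::ab_group_add"
  shows "uminus ` (f +o group_closure S) = (- f) +o group_closure S"
proof
  show "uminus ` (f +o group_closure S) \<subseteq> (- f) +o group_closure S"
    by (auto simp: elt_set_plus_def intro!: bexI[of _ "- x" for x])
  show "(- f) +o group_closure S \<subseteq> uminus ` (f +o group_closure S)"
  proof
    fix x assume "x \<in> (- f) +o group_closure S"
    then obtain b where "b \<in> group_closure S" "x = - f + b" by (auto simp: elt_set_plus_def)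
    then have "x = - (f + - b)" "f + - b \<in> f +o group_closure S" by (auto simp: elt_set_plus_def)
    then show "x \<in> uminus ` (f +o group_closure S)" by blast
  qed
qed

text \<open>The operations on tensor products are unions over all representatives. An additive map
  that respects the relations sends all representatives into one coset, so the union collapses to
  that coset.\<close>

lemma UN_coset:
  fixes k :: "'b::ab_group_add \<Rightarrow> 'c::ab_group_add"
  assumes add: "\<And>x y. k (x + y) = k x + k y"
    and "\<And>x. x \<in> group_closure S \<Longrightarrow> k x \<in> group_closure T"
  shows "(\<Union>x\<in>f +o group_closure S. k x +o group_closure T) = k f +o group_closure T"
proof -
  have "k x +o group_closure T = k f +o group_closure T" if "x \<in> f +o group_closure S" for x
  proof -
    from that have "x - f \<in> group_closure S" by (rule set_plus_imp_minus)
    then have "k (x - f) \<in> group_closure T" by fact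
    moreover have "k x = k (x - f) + k f" by (metis add diff_add_cancel)
    ultimately show ?thesis by (simp add: coset_eq_iff)
  qed
  moreover have "f \<in> f +o group_closure S"
    using set_plus_intro2[of 0 "group_closure S" f] by simp
  ultimately show ?thesis by blast
qed

lemma UN_coset2:
  fixes k :: "'b::ab_group_add \<Rightarrow> 'b' ::ab_group_add \<Rightarrow> 'c::ab_group_add"
  assumes "\<And>x y z. k (x + y) z = k x z + k y z" "\<And>x y z. k z (x + y) = k z x + k z y"
    and "\<And>x y. x \<in> group_closure S \<Longrightarrow> k x y \<in> group_closure T"
    and "\<And>x y. y \<in> group_closure S' \<Longrightarrow> k x y \<in> group_closure T"
  shows "(\<Union>x\<in>f +o group_closure S. \<Union>y\<in>g +o group_closure S'. k x y +o group_closure T) =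
    k f g +o group_closure T"
  using UN_coset[of "k x" S' T for x] UN_coset[of "\<lambda>x. k x g" S T] assms by simp

lemma tensor_lift_coset:
  assumes "\<And>x. x \<in> group_closure S \<Longrightarrow> frag_eval h x = 0"
  shows "tensor_lift h (f +o group_closure S) = frag_eval h f"
proof -
  have "frag_eval h ` (f +o group_closure S) = {frag_eval h f}"
  proof -
    have "frag_eval h x = frag_eval h f" if "x \<in> f +o group_closure S" for x
      using assms[OF set_plus_imp_minus[OF that]] by (simp add: frag_eval_diff)
    moreover have "f \<in> f +o group_closure S"
      using set_plus_intro2[of 0 "group_closure S" f] by simp
    ultimately show ?thesis by blast
  qed
  then show ?thesis
    unfolding tensor_lift_def frag_eval_def[abs_def] by simp
qed

lemma group_closure_map:
  assumes "x \<in> group_closure S" "\<And>x y. k (x - y) = k x - k y"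
    and "\<And>x. x \<in> S \<Longrightarrow> k x \<in> group_closure T"
  shows "k x \<in> group_closure T"
  using assms(1)
proof induction
  case (base s)
  have "k 0 = 0" using assms(2)[of 0 0] by simp
  with base show ?case using assms(3) by auto
qed (auto simp: assms(2) intro: group_closure.diff)

lemma group_closure_vanish:
  assumes "x \<in> group_closure S" "\<And>x y. k (x - y) = k x - (k y :: 'c::ab_group_add)"
    and "\<And>x. x \<in> S \<Longrightarrow> k x = 0"
  shows "k x = 0"
  using group_closure_map[of x S k "{}"] assms by simp

lemma tensor_ker_vanish:
  assumes "f \<in> tensor_ker M R ract N lact"
    and "\<And>x x' y. x \<in> M \<Longrightarrow> x' \<in> M \<Longrightarrow> y \<in> N \<Longrightarrow> h (x + x', y) = h (x, y) + h (x', y)"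
    and "\<And>x y y'. x \<in> M \<Longrightarrow> y \<in> N \<Longrightarrow> y' \<in> N \<Longrightarrow> h (x, y + y') = h (x, y) + h (x, y')"
    and "\<And>x r y. x \<in> M \<Longrightarrow> r \<in> R \<Longrightarrow> y \<in> N \<Longrightarrow> h (ract x r, y) = h (x, lact r y)"
  shows "frag_eval h f = 0"
  using assms(1) unfolding tensor_ker_def
  by (rule group_closure_vanish) (auto simp: frag_eval_diff assms(2-4))

lemma tensor_ker_rules:
  shows "x \<in> M \<Longrightarrow> x' \<in> M \<Longrightarrow> y \<in> N \<Longrightarrow>
      frag_of (x + x', y) - frag_of (x, y) - frag_of (x', y) \<in> tensor_ker M R ract N lact"
    and "x \<in> M \<Longrightarrow> y \<in> N \<Longrightarrow> y' \<in> N \<Longrightarrow>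
      frag_of (x, y + y') - frag_of (x, y) - frag_of (x, y') \<in> tensor_ker M R ract N lact"
    and "x \<in> M \<Longrightarrow> r \<in> R \<Longrightarrow> y \<in> N \<Longrightarrow>
      frag_of (ract x r, y) - frag_of (x, lact r y) \<in> tensor_ker M R ract N lact"
  unfolding tensor_ker_def by (rule group_closure.base, blast)+

lemma tensor_ker_add:
  "f \<in> tensor_ker M R ract N lact \<Longrightarrow> g \<in> tensor_ker M R ract N lact \<Longrightarrow>
    f + g \<in> tensor_ker M R ract N lact"
  unfolding tensor_ker_def by (rule group_closure_add)

lemma tensor_ker_diff:
  "f \<in> tensor_ker M R ract N lact \<Longrightarrow> g \<in> tensor_ker M R ract N lact \<Longrightarrow>
    f - g \<in> tensor_ker M R ract N lact"
  unfolding tensor_ker_def by (rule group_closure.diff)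

lemma tensor_ker_0: "0 \<in> tensor_ker M R ract N lact"
  unfolding tensor_ker_def by simp

lemma tensor_coset_eq_iff:
  "f +o tensor_ker M R ract N lact = g +o tensor_ker M R ract N lact \<longleftrightarrow>
    f - g \<in> tensor_ker M R ract N lact"
  unfolding tensor_ker_def by (rule coset_eq_iff)

lemma tensor_coset_plus:
  "(f +o tensor_ker M R ract N lact) + (g +o tensor_ker M R ract N lact) =
    (f + g) +o tensor_ker M R ract N lact"
  unfolding tensor_ker_def by (rule coset_plus_coset)

lemma tensor_coset_uminus:
  "uminus ` (f +o tensor_ker M R ract N lact) = (- f) +o tensor_ker M R ract N lact"
  unfolding tensor_ker_def by (rule coset_uminus)

lemma tensor_lift_tensor_coset:
  assumes "\<And>x. x \<in> tensor_ker M R ract N lact \<Longrightarrow> frag_eval h x = 0"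
  shows "tensor_lift h (f +o tensor_ker M R ract N lact) = frag_eval h f"
  using assms unfolding tensor_ker_def by (rule tensor_lift_coset)


section \<open>Azumaya algebras\<close>

text \<open>These are the maps on pairs that factor through the tensor product over
  \<open>K\<close>. The codomain is left open because it is \<open>A\<close> for sandwiches and for
  the twisted action, but the algebraic closure for matrix coefficients.\<close>

definition balanced :: "('k \<Rightarrow> 'a::plus \<Rightarrow> 'a) \<Rightarrow> ('a \<times> 'a \<Rightarrow> 'c::plus) \<Rightarrow> bool" where
  "balanced s h \<longleftrightarrow> (\<forall>a a' b. h (a + a', b) = h (a, b) + h (a', b)) \<and>
    (\<forall>a b b'. h (a, b + b') = h (a, b) + h (a, b')) \<and>
    (\<forall>k a b. h (s k a, b) = h (a, s k b))"

abbreviation sandwich_frag :: "('a::ring_1 \<times> 'a \<Rightarrow>\<^sub>0 int) \<Rightarrow> 'a \<Rightarrow> 'a" where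
  "sandwich_frag f x \<equiv> frag_eval (\<lambda>(a, b). a * x * b) f"

lemma balanced_vanish:
  assumes "balanced s h" "f \<in> vtensor_ker s s"
  shows "frag_eval h f = 0"
  using assms(2) unfolding vtensor_ker_def
  by (rule tensor_ker_vanish) (use assms(1) in \<open>auto simp: balanced_def\<close>)

lemma tensor_lift_vtensor:
  assumes "balanced s h"
  shows "tensor_lift h (f +o vtensor_ker s s) = frag_eval h f"
  unfolding vtensor_ker_def
  by (rule tensor_lift_tensor_coset) (use balanced_vanish[OF assms] in \<open>simp add: vtensor_ker_def\<close>)

lemma vtensor_eq_range: "vtensor s s' = range (\<lambda>f. f +o vtensor_ker s s')"
  by (auto simp: vtensor_def vtensor_ker_def tensor_carrier_def)

lemma vtensor_coset_eq_iff:
  "f +o vtensor_ker s s' = g +o vtensor_ker s s' \<longleftrightarrow> f - g \<in> vtensor_ker s s'"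
  unfolding vtensor_ker_def by (rule tensor_coset_eq_iff)

text \<open>The two additivity relations are exchanged, and the balancing relation goes to its
  negative. Applied twice, this shows that the flip of a nonzero tensor is nonzero.\<close>

lemma vtensor_ker_flip:
  assumes "f \<in> vtensor_ker s s"
  shows "frag_extend (\<lambda>(a, b). frag_of (b, a)) f \<in> vtensor_ker s s"
  using assms unfolding vtensor_ker_def tensor_ker_def
proof (rule group_closure_map)
  fix x
  assume "x \<in> {frag_of (x + x', y) - frag_of (x, y) - frag_of (x', y) |x x' y.
            x \<in> UNIV \<and> x' \<in> UNIV \<and> y \<in> UNIV} \<union>
           {frag_of (x, y + y') - frag_of (x, y) - frag_of (x, y') |x y y'.
            x \<in> UNIV \<and> y \<in> UNIV \<and> y' \<in> UNIV} \<union>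
           {frag_of (s r x, y) - frag_of (x, s r y) |x r y. x \<in> UNIV \<and> r \<in> UNIV \<and> y \<in> UNIV}"
    (is "_ \<in> ?S")
  moreover have ker: "group_closure ?S = tensor_ker UNIV UNIV (\<lambda>a k. s k a) UNIV s"
    by (simp add: tensor_ker_def)
  ultimately consider a b c where "x = frag_of (a + b, c) - frag_of (a, c) - frag_of (b, c)"
    | a b c where "x = frag_of (c, a + b) - frag_of (c, a) - frag_of (c, b)"
    | k a b where "x = frag_of (s k a, b) - frag_of (a, s k b)"
    by blast
  then have "frag_extend (\<lambda>(a, b). frag_of (b, a)) x \<in> tensor_ker UNIV UNIV (\<lambda>a k. s k a) UNIV s"
  proof cases
    case 1
    then show ?thesis
      using tensor_ker_rules(2)[of c UNIV a UNIV b UNIV "\<lambda>a k. s k a" s]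
      by (simp add: frag_extend_diff)
  next
    case 2
    then show ?thesis
      using tensor_ker_rules(1)[of a UNIV b c UNIV UNIV "\<lambda>a k. s k a" s]
      by (simp add: frag_extend_diff)
  next
    case 3
    then show ?thesis
      using tensor_ker_diff[OF tensor_ker_0
          tensor_ker_rules(3)[of b UNIV k UNIV a UNIV "\<lambda>a k. s k a" s]]
      by (simp add: frag_extend_diff)
  qed
  then show "frag_extend (\<lambda>(a, b). frag_of (b, a)) x \<in> group_closure ?S"
    by (simp only: ker)
qed (simp add: frag_extend_diff)

locale azumaya =
  fixes s :: "'k::field \<Rightarrow> 'a::ring_1 \<Rightarrow> 'a"
  assumes azumaya: "azumaya_algebra s"
begin

sublocale vector_space s
  using azumaya by (simp add: azumaya_algebra_def k_algebra_def)

lemma scale_mult_left: "s k a * b = s k (a * b)"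
  and scale_mult_right: "a * s k b = s k (a * b)"
  using azumaya unfolding azumaya_algebra_def k_algebra_def by metis+

lemmas scale_mult = scale_mult_left scale_mult_right

lemma linearI: "(\<And>x y. f (x + y) = f x + f y) \<Longrightarrow> (\<And>k x. f (s k x) = s k (f x)) \<Longrightarrow>
    Vector_Spaces.linear s s f"
  by unfold_locales auto

lemma balanced_sandwich: "balanced s (\<lambda>(a, b). a * x * b)"
  by (simp add: balanced_def algebra_simps scale_mult)

lemma sandwich_coset: "sandwich (f +o vtensor_ker s s) x = sandwich_frag f x"
  unfolding sandwich_def by (rule tensor_lift_vtensor) (rule balanced_sandwich)

lemma vtensor_ker_iff: "f \<in> vtensor_ker s s \<longleftrightarrow> (\<forall>x. sandwich_frag f x = 0)"
proof
  show "f \<in> vtensor_ker s s \<Longrightarrow> \<forall>x. sandwich_frag f x = 0"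
    using balanced_vanish balanced_sandwich by blast
  assume "\<forall>x. sandwich_frag f x = 0"
  then have "sandwich (f +o vtensor_ker s s) = sandwich (0 +o vtensor_ker s s)"
    unfolding sandwich_coset[abs_def] fun_eq_iff by simp
  moreover have "inj_on sandwich (vtensor s s)"
    using azumaya by (auto simp: azumaya_algebra_def bij_betw_def)
  ultimately have "f +o vtensor_ker s s = 0 +o vtensor_ker s s"
    using inj_onD[of sandwich "vtensor s s" "f +o vtensor_ker s s" "0 +o vtensor_ker s s"]
    unfolding vtensor_eq_range by blast
  then show "f \<in> vtensor_ker s s"
    using vtensor_coset_eq_iff[of f s s 0] by simp
qed

lemma sandwich_surj:
  assumes "\<And>x y. f (x + y) = f x + f y" "\<And>k x. f (s k x) = s k (f x)"
  shows "\<exists>g. \<forall>x. sandwich_frag g x = f x"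
proof -
  have "f \<in> sandwich ` vtensor s s"
    using azumaya linearI[of f] assms by (auto simp: azumaya_algebra_def bij_betw_def)
  then obtain g where "f = sandwich (g +o vtensor_ker s s)"
    unfolding vtensor_eq_range by auto
  then show ?thesis using sandwich_coset by metis
qed

text \<open>Equal sandwiches mean equal tensors, by injectivity of the sandwich map. An identity
  checked on sandwiches thereby becomes one for matrix coefficients, for flipped sandwiches or for
  the twisted action.\<close>

lemma balanced_transfer:
  assumes "balanced s h" "\<And>x. sandwich_frag f x = sandwich_frag g x"
  shows "frag_eval h f = frag_eval h g"
  using balanced_vanish[OF assms(1), of "f - g"] assms(2)
  by (simp add: vtensor_ker_iff frag_eval_diff)

lemma functional_exists:
  assumes "x \<noteq> 0"
  obtains \<theta> :: "'a \<Rightarrow> 'k" where "\<And>x y. \<theta> (x + y) = \<theta> x + \<theta> y" "\<And>k x. \<theta> (s k x) = k * \<theta> x"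
    "\<theta> x = 1"
proof -
  interpret p: vector_space_pair s "(*) :: 'k \<Rightarrow> 'k \<Rightarrow> 'k"
    by unfold_locales (auto simp: algebra_simps)
  have "independent {x}" using assms by simp
  from p.linear_independent_extend[OF this, of "\<lambda>_. 1"]
  obtain g where "Vector_Spaces.linear s (*) g" "g x = 1" by auto
  then show ?thesis
    using that[of g] p.linear_add p.linear_scale by blast
qed

text \<open>A central element can be pulled out of every sandwich. For the sandwich x \<mapsto>
  \<theta>(x) 1 with \<theta>(1) = 1, evaluated at c, this gives \<theta>(c) 1 = c.\<close>

lemma central_imp_scalar:
  assumes "\<And>x. c * x = x * c"
  obtains k where "c = s k 1"
proof -
  obtain \<theta> :: "'a \<Rightarrow> 'k" where \<theta>: "\<And>x y. \<theta> (x + y) = \<theta> x + \<theta> y"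
    "\<And>k x. \<theta> (s k x) = k * \<theta> x" "\<theta> 1 = 1"
    by (rule functional_exists[of 1]) auto
  obtain g where g: "\<And>x. sandwich_frag g x = s (\<theta> x) 1"
    using sandwich_surj[of "\<lambda>x. s (\<theta> x) 1"] by (auto simp: \<theta> scale_left_distrib)
  have "sandwich_frag g (c * 1) = c * sandwich_frag g 1"
    unfolding frag_eval_mult_left[symmetric]
  proof (rule frag_eval_cong)
    fix p assume "p \<in> Poly_Mapping.keys g"
    show "(case p of (a, b) \<Rightarrow> a * (c * 1) * b) = c * (case p of (a, b) \<Rightarrow> a * 1 * b)"
      using assms[of "fst p"] by (simp add: case_prod_unfold mult.assoc[symmetric])
  qed
  then have "c = s (\<theta> c) 1" unfolding g by (simp add: \<theta>(3))
  then show ?thesis by (rule that)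
qed

text \<open>
  The sandwich \<open>\<Sum> a x b = \<theta> x\<close> of a linear form commutes with \<open>A\<close>; interchanging the tensor
  factors turns this into invariance under cyclic permutation.
\<close>

lemma trace_functional_exists:
  obtains \<tau> :: "'a \<Rightarrow> 'k" and z where "\<And>x y. \<tau> (x + y) = \<tau> x + \<tau> y" "\<And>k x. \<tau> (s k x) = k * \<tau> x"
    "\<And>x y. \<tau> (x * y) = \<tau> (y * x)" "\<tau> z \<noteq> 0"
proof -
  obtain \<theta> :: "'a \<Rightarrow> 'k" where \<theta>: "\<And>x y. \<theta> (x + y) = \<theta> x + \<theta> y"
    "\<And>k x. \<theta> (s k x) = k * \<theta> x" "\<theta> 1 = 1"
    by (rule functional_exists[of 1]) auto
  obtain g where g: "\<And>x. sandwich_frag g x = s (\<theta> x) 1"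
    using sandwich_surj[of "\<lambda>x. s (\<theta> x) 1"] by (auto simp: \<theta> scale_left_distrib)
  define fl where "fl = frag_extend (\<lambda>(a, b). frag_of (b :: 'a, a :: 'a))"
  define F where "F = (\<lambda>y. frag_eval (\<lambda>(a, b). b * y * a) g)"
  have F: "F y = sandwich_frag (fl g) y" for y
    unfolding F_def fl_def frag_eval_extend by (rule frag_eval_cong) auto
  have flfl: "fl (fl f) = f" for f
    unfolding fl_def by (rule frag_induction[where S = UNIV and c = f]) (auto simp: frag_extend_diff)
  \<comment> \<open>Multiplying \<open>g\<close> by \<open>x\<close> from the left in the first
    factor or from the right in the second gives the same sandwich \<theta>(u) x. The tensors
    therefore agree, and the balanced map b y a takes the values F(y x) and F(x y) on them.\<close>
  have cyc: "F (y * x) = F (x * y)" for x y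
  proof -
    have "frag_eval (\<lambda>(a, b). b * y * a) (frag_extend (\<lambda>(a, b). frag_of (x * a, b)) g) =
      frag_eval (\<lambda>(a, b). b * y * a) (frag_extend (\<lambda>(a, b). frag_of (a, b * x)) g)"
    proof (rule balanced_transfer)
      show "balanced s (\<lambda>(a, b). b * y * a)"
        by (simp add: balanced_def algebra_simps scale_mult)
      fix u
      have "sandwich_frag (frag_extend (\<lambda>(a, b). frag_of (x * a, b)) g) u = x * sandwich_frag g u"
        unfolding frag_eval_extend frag_eval_mult_left[symmetric]
        by (rule frag_eval_cong) (auto simp: mult.assoc)
      moreover have "sandwich_frag (frag_extend (\<lambda>(a, b). frag_of (a, b * x)) g) u =
          sandwich_frag g u * x"
        unfolding frag_eval_extend frag_eval_mult_right[symmetric]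
        by (rule frag_eval_cong) (auto simp: mult.assoc)
      ultimately show "sandwich_frag (frag_extend (\<lambda>(a, b). frag_of (x * a, b)) g) u =
        sandwich_frag (frag_extend (\<lambda>(a, b). frag_of (a, b * x)) g) u"
        by (simp add: g scale_mult)
    qed
    then show ?thesis
      by (simp add: frag_eval_extend case_prod_unfold F_def mult.assoc)
  qed
  \<comment> \<open>\<open>F\<close> is the sandwich of the flipped tensor. If it vanished, flipping
    back would make \<open>g\<close> zero, although its sandwich at 1 is \<theta>(1) 1 = 1.\<close>
  have "\<exists>z. F z \<noteq> 0"
  proof (rule ccontr)
    assume "\<not> ?thesis"
    then have "fl g \<in> vtensor_ker s s" by (simp add: vtensor_ker_iff F)
    then have "fl (fl g) \<in> vtensor_ker s s" unfolding fl_def by (rule vtensor_ker_flip)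
    then have "sandwich_frag g 1 = 0" unfolding flfl vtensor_ker_iff by blast
    then show False unfolding g by (simp add: \<theta>)
  qed
  then obtain z where z: "F z \<noteq> 0" by auto
  \<comment> \<open>\<open>F\<close> still takes values in \<open>A\<close>; composing with a linear
    form that is 1 at F(z) gives a scalar-valued cyclic form.\<close>
  obtain \<chi> :: "'a \<Rightarrow> 'k" where \<chi>: "\<And>x y. \<chi> (x + y) = \<chi> x + \<chi> y"
    "\<And>k x. \<chi> (s k x) = k * \<chi> x" "\<chi> (F z) = 1"
    by (rule functional_exists[OF z]) blast
  have "F (x + y) = F x + F y" for x y
    unfolding F_def frag_eval_distrib[symmetric] by (rule frag_eval_cong) (auto simp: algebra_simps)
  moreover have "F (s k x) = s k (F x)" for k x
    unfolding F_def
    by (subst frag_eval_additive[of "s k"])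
      (auto simp: scale_right_distrib scale_mult case_prod_unfold)
  ultimately show ?thesis
    using \<chi> z by (intro that[of "\<lambda>x. \<chi> (F x)" z]) (auto simp: cyc)
qed

end


section \<open>Irreducible matrix representations\<close>

lemma (in vector_space) finite_basis_enum:
  assumes "finite D" "V \<subseteq> span D" "subspace V"
  shows "\<exists>n (b :: nat \<Rightarrow> 'b). inj_on b {..<n} \<and> independent (b ` {..<n}) \<and> span (b ` {..<n}) = V"
proof -
  obtain B where B: "B \<subseteq> V" "independent B" "V \<subseteq> span B" using basis_exists by metis
  have "finite B" using independent_span_bound[OF assms(1) B(2)] B(1) assms(2) by auto
  then obtain b where b: "bij_betw b {0..<card B} B" using ex_bij_betw_nat_finite by blast
  show ?thesis
    by (rule exI[of _ "card B"], rule exI[of _ b])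
      (use b B span_subspace[OF B(1,3) assms(3)] in \<open>auto simp: bij_betw_def atLeast0LessThan\<close>)
qed

context azumaya
begin

lemma coordinates_exist:
  obtains m e and co :: "nat \<Rightarrow> 'a \<Rightarrow> 'k" where "\<And>x. (\<Sum>i<m. s (co i x) (e i)) = x"
    "\<And>i x y. co i (x + y) = co i x + co i y" "\<And>i k x. co i (s k x) = k * co i x"
    "\<And>i j. i < m \<Longrightarrow> j < m \<Longrightarrow> co i (e j) = (if i = j then 1 else 0)"
proof -
  obtain D where "finite D" "span D = UNIV"
    using azumaya by (auto simp: azumaya_algebra_def)
  then obtain m :: nat and e where e: "inj_on e {..<m}" "independent (e ` {..<m})" "span (e ` {..<m}) = UNIV"
    using finite_basis_enum[of D UNIV] subspace_UNIV by blast
  let ?B = "e ` {..<m}"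
  show ?thesis
  proof (rule that[of "\<lambda>i x. representation ?B x (e i)" e m])
    fix x
    have "(\<Sum>v\<in>?B. s (representation ?B x v) v) = x"
      by (rule sum_representation_eq) (use e in auto)
    then show "(\<Sum>i<m. s (representation ?B x (e i)) (e i)) = x"
      using e(1) by (simp add: sum.reindex)
  qed (use e in \<open>auto simp: representation_add representation_scale representation_basis inj_on_eq_iff\<close>)
qed

end

text \<open>Irreducibility is encoded by what Schur's lemma gives over an algebraically closed
  field: only scalar matrices commute with the image. It is in this form that it is used, and it can
  also be verified directly for a splitting.\<close>

definition irrep :: "('k::field \<Rightarrow> 'a::ring_1 \<Rightarrow> 'a) \<Rightarrow> nat \<Rightarrow> ('a \<Rightarrow> 'k alg_closure mat) \<Rightarrow> bool" where
  "irrep s n \<phi> \<longleftrightarrow> n > 0 \<and>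
    (\<forall>x. \<phi> x \<in> carrier_mat n n) \<and> \<phi> 1 = 1\<^sub>m n \<and> (\<forall>x y. \<phi> (x * y) = \<phi> x * \<phi> y) \<and>
    (\<forall>x y. \<phi> (x + y) = \<phi> x + \<phi> y) \<and> (\<forall>k x. \<phi> (s k x) = to_ac k \<cdot>\<^sub>m \<phi> x) \<and>
    (\<forall>C\<in>carrier_mat n n. (\<forall>x. C * \<phi> x = \<phi> x * C) \<longrightarrow> (\<exists>t. C = t \<cdot>\<^sub>m 1\<^sub>m n))"

lemma mult_mat_index:
  "A \<in> carrier_mat l m \<Longrightarrow> B \<in> carrier_mat m n \<Longrightarrow> i < l \<Longrightarrow> j < n \<Longrightarrow>
    (A * B) $$ (i, j) = (\<Sum>k<m. A $$ (i, k) * B $$ (k, j))"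
  by (simp add: scalar_prod_def atLeast0LessThan)

lemma mult_mat_vec_index:
  "A \<in> carrier_mat l m \<Longrightarrow> v \<in> carrier_vec m \<Longrightarrow> i < l \<Longrightarrow>
    (A *\<^sub>v v) $ i = (\<Sum>k<m. A $$ (i, k) * v $ k)"
  by (simp add: scalar_prod_def atLeast0LessThan)

context azumaya
begin

text \<open>
  A minimal nonzero submodule of \<open>Hom\<^sub>K(A, L)\<close>, on which \<open>A\<close> acts by \<open>(x f)(y) = f (y x)\<close>, is
  irreducible.  By Schur's lemma over the algebraically closed \<open>L\<close>, only scalars commute with
  this action.
\<close>

lemma irrep_exists: "\<exists>n \<phi>. irrep s n \<phi>"
proof -
  define sc :: "'k alg_closure \<Rightarrow> ('a \<Rightarrow> 'k alg_closure) \<Rightarrow> 'a \<Rightarrow> 'k alg_closure"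
    where "sc = (\<lambda>c f y. c * f y)"
  interpret F: vector_space sc
    by unfold_locales (auto simp: sc_def fun_eq_iff algebra_simps)
  define H where "H = {f :: 'a \<Rightarrow> 'k alg_closure. (\<forall>x y. f (x + y) = f x + f y) \<and>
    (\<forall>k x. f (s k x) = to_ac k * f x)}"
  define act where "act = (\<lambda>x (f :: 'a \<Rightarrow> 'k alg_closure) y. f (y * x))"
  define sub where "sub = (\<lambda>U. F.subspace U \<and> U \<subseteq> H \<and> (\<forall>x. \<forall>f\<in>U. act x f \<in> U) \<and> U \<noteq> {0})"
  have sum_sc: "(\<Sum>i\<in>I. sc (c i) (b i)) y = (\<Sum>i\<in>I. c i * b i y)" for I and c b y
    by (induction I rule: infinite_finite_induct) (auto simp: sc_def)
  obtain m e and co :: "nat \<Rightarrow> 'a \<Rightarrow> 'k" where e: "\<And>x. (\<Sum>i<m. s (co i x) (e i)) = x"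
    "\<And>i x y. co i (x + y) = co i x + co i y" "\<And>i k x. co i (s k x) = k * co i x"
    by (rule coordinates_exist) blast
  define D where "D = (\<lambda>i x. to_ac (co i x)) ` {..<m}"
  have HD: "H \<subseteq> F.span D"
  proof
    fix f assume f: "f \<in> H"
    have f0: "f 0 = 0" using f by (auto simp: H_def) (metis add_cancel_right_right)
    have fs: "f (\<Sum>i\<in>I. g i) = (\<Sum>i\<in>I. f (g i))" for I :: "nat set" and g
      by (induction I rule: infinite_finite_induct) (use f f0 in \<open>auto simp: H_def\<close>)
    have "f x = (\<Sum>i<m. sc (f (e i)) (\<lambda>x. to_ac (co i x))) x" for x
    proof -
      have "f x = f (\<Sum>i<m. s (co i x) (e i))" by (simp add: e(1))
      also have "\<dots> = (\<Sum>i<m. f (e i) * to_ac (co i x))"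
        unfolding fs by (rule sum.cong) (use f in \<open>auto simp: H_def mult.commute\<close>)
      finally show ?thesis by (simp add: sum_sc)
    qed
    then have "f = (\<Sum>i<m. sc (f (e i)) (\<lambda>x. to_ac (co i x)))" by blast
    also have "\<dots> \<in> F.span D"
      by (intro F.span_sum F.span_scale F.span_base) (auto simp: D_def)
    finally show "f \<in> F.span D" .
  qed
  have finD: "finite D" by (simp add: D_def)
  \<comment> \<open>The dimensions of nonzero submodules; a submodule of least dimension is
    minimal.\<close>
  define P where "P = (\<lambda>n. \<exists>U (b :: nat \<Rightarrow> _). sub U \<and> inj_on b {..<n} \<and>
    F.independent (b ` {..<n}) \<and> F.span (b ` {..<n}) = U)"
  have P: "\<exists>n. P n" if U: "sub U" for U
  proof -
    have "U \<subseteq> F.span D" "F.subspace U" using U HD by (auto simp: sub_def)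
    from F.finite_basis_enum[OF finD this] U show ?thesis unfolding P_def by metis
  qed
  have "sub H"
  proof -
    have "F.subspace H"
      by (rule F.subspaceI) (auto simp: H_def sc_def algebra_simps)
    moreover have "act x f \<in> H" if "f \<in> H" for x f
      using that by (simp add: H_def act_def distrib_right scale_mult)
    moreover obtain \<theta> :: "'a \<Rightarrow> 'k" where \<theta>: "\<And>x y. \<theta> (x + y) = \<theta> x + \<theta> y"
      "\<And>k x. \<theta> (s k x) = k * \<theta> x" "\<theta> 1 = 1"
      by (rule functional_exists[of 1]) auto
    have "(\<lambda>x. to_ac (\<theta> x)) \<in> H" by (simp add: H_def \<theta>)
    moreover have "(\<lambda>x. to_ac (\<theta> x)) \<noteq> 0"
      by (metis \<theta>(3) to_ac_1 zero_fun_apply zero_neq_one)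
    ultimately show ?thesis unfolding sub_def by blast
  qed
  then have "\<exists>n. P n" by (rule P)
  define n where "n = (LEAST n. P n)"
  have "P n" unfolding n_def using \<open>\<exists>n. P n\<close> by (rule LeastI_ex)
  then obtain U b where U: "sub U" "inj_on b {..<n}" "F.independent (b ` {..<n})"
    "F.span (b ` {..<n}) = U" unfolding P_def by auto
  \<comment> \<open>A vector of \<open>U\<close> outside \<open>U'\<close> enlarges a basis of
    \<open>U'\<close> to n' + 1 independent vectors in \<open>U\<close>, so n' + 1 \<le> n, against
    the choice of \<open>n\<close> as least dimension.\<close>
  have minimal: "U' = U" if U': "sub U'" "U' \<subseteq> U" for U'
  proof (rule ccontr)
    assume "U' \<noteq> U"
    then obtain v where v: "v \<in> U" "v \<notin> U'" using U' by auto
    have "U' \<subseteq> F.span D" "F.subspace U'" using U' HD by (auto simp: sub_def)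
    then obtain n' :: nat and b' where b': "inj_on b' {..<n'}" "F.independent (b' ` {..<n'})"
      "F.span (b' ` {..<n'}) = U'"
      using F.finite_basis_enum[OF finD] by metis
    have "P n'" using U' b' unfolding P_def by blast
    then have "n \<le> n'" unfolding n_def by (rule Least_le)
    have "F.independent (insert v (b' ` {..<n'}))"
      by (rule F.independent_insertI) (simp_all only: b' v not_False_eq_True)
    moreover have "insert v (b' ` {..<n'}) \<subseteq> F.span (b ` {..<n})"
      using v(1) U'(2) F.span_superset[of "b' ` {..<n'}"] unfolding b'(3) U(4) by blast
    ultimately have "card (insert v (b' ` {..<n'})) \<le> card (b ` {..<n})"
      using F.independent_span_bound[of "b ` {..<n}" "insert v (b' ` {..<n'})"] by simp
    moreover have "v \<notin> b' ` {..<n'}"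
      using v(2) F.span_superset[of "b' ` {..<n'}"] unfolding b'(3) by blast
    ultimately have "Suc n' \<le> n"
      using card_image[OF U(2)] card_image[OF b'(1)] by simp
    with \<open>n \<le> n'\<close> show False by simp
  qed
  have coord: "\<exists>c. \<forall>y. f y = (\<Sum>i<n. c i * b i y)" if "f \<in> U" for f
  proof -
    have "f \<in> F.span (b ` {..<n})" using that U by simp
    then obtain u where "f = (\<Sum>v\<in>b ` {..<n}. sc (u v) v)"
      by (subst (asm) F.span_finite) auto
    then have "f = (\<Sum>i<n. sc (u (b i)) (b i))"
      using U(2) by (simp add: sum.reindex)
    then have "f y = (\<Sum>i<n. u (b i) * b i y)" for y by (simp add: sum_sc)
    then show ?thesis by (intro exI[of _ "\<lambda>i. u (b i)"]) blast
  qed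
  have in_U: "(\<lambda>y. \<Sum>i<n. c i * b i y) \<in> U" for c
  proof -
    have "(\<lambda>y. \<Sum>i<n. c i * b i y) = (\<Sum>i<n. sc (c i) (b i))" by (auto simp: sum_sc)
    also have "\<dots> \<in> F.span (b ` {..<n})"
      by (intro F.span_sum F.span_scale F.span_base) auto
    finally show ?thesis using U by simp
  qed
  have uniq: "c i = d i" if "\<And>y. (\<Sum>i<n. c i * b i y) = (\<Sum>i<n. d i * b i y)" "i < n" for c d i
  proof -
    define u where "u = (\<lambda>v. c (the_inv_into {..<n} b v) - d (the_inv_into {..<n} b v))"
    have u: "u (b i) = c i - d i" if "i < n" for i
      unfolding u_def using that by (simp add: the_inv_into_f_f[OF U(2)])
    have "(\<Sum>v\<in>b ` {..<n}. sc (u v) v) = (\<Sum>i<n. sc (c i - d i) (b i))"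
      using U(2) by (simp add: sum.reindex u)
    also have "\<dots> = 0"
      by (rule ext) (use that(1) in \<open>simp add: sum_sc left_diff_distrib sum_subtractf\<close>)
    finally have "u (b i) = 0"
      using F.independentD[OF U(3) _ order_refl, of u "b i"] that(2) by blast
    then show ?thesis using u that by simp
  qed
  have b_U: "b i \<in> U" if "i < n" for i
    using that F.span_superset[of "b ` {..<n}"] unfolding U(4) by blast
  have n0: "n > 0"
  proof (rule ccontr)
    assume "\<not> n > 0"
    then have "U = {0}" using U(4) by simp
    with U show False by (simp add: sub_def)
  qed
  have "\<forall>x j. \<exists>c. j < n \<longrightarrow> (\<forall>y. b j (y * x) = (\<Sum>i<n. c i * b i y))"
  proof (intro allI)
    fix x j
    show "\<exists>c. j < n \<longrightarrow> (\<forall>y. b j (y * x) = (\<Sum>i<n. c i * b i y))"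
    proof (cases "j < n")
      case True
      then have "act x (b j) \<in> U" using b_U U(1) by (simp add: sub_def)
      then show ?thesis using coord[of "act x (b j)"] by (simp add: act_def)
    qed simp
  qed
  then obtain M where M: "\<And>x j y. j < n \<Longrightarrow> b j (y * x) = (\<Sum>i<n. M x j i * b i y)"
    by metis
  \<comment> \<open>Column \<open>j\<close> holds the coordinates of \<open>x\<close> acting on
    \<open>b j\<close>. The action by right translation of the argument is a left action, so
    products go to matrix products in the same order.\<close>
  define \<phi> where "\<phi> = (\<lambda>x. mat n n (\<lambda>(i, j). M x j i))"
  have \<phi>: "\<phi> x \<in> carrier_mat n n" for x by (simp add: \<phi>_def)
  have act_lin: "(\<Sum>j<n. v $ j * b j (y * x)) = (\<Sum>i<n. (\<phi> x *\<^sub>v v) $ i * b i y)"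
    if v: "v \<in> carrier_vec n" for v x y
  proof -
    have "(\<Sum>j<n. v $ j * b j (y * x)) = (\<Sum>j<n. \<Sum>i<n. v $ j * (M x j i * b i y))"
      by (simp add: M sum_distrib_left)
    also have "\<dots> = (\<Sum>i<n. \<Sum>j<n. v $ j * (M x j i * b i y))" by (rule sum.swap)
    also have "\<dots> = (\<Sum>i<n. (\<phi> x *\<^sub>v v) $ i * b i y)"
    proof (rule sum.cong[OF refl])
      fix i assume i: "i \<in> {..<n}"
      then have "(\<phi> x *\<^sub>v v) $ i = (\<Sum>j<n. M x j i * v $ j)"
        using mult_mat_vec_index[OF \<phi> v, of i x] by (simp only: lessThan_iff) (simp add: \<phi>_def)
      then show "(\<Sum>j<n. v $ j * (M x j i * b i y)) = (\<phi> x *\<^sub>v v) $ i * b i y"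
        by (simp add: sum_distrib_left sum_distrib_right algebra_simps)
    qed
    finally show ?thesis .
  qed
  have H_add: "b j (x + y) = b j x + b j y" and H_scale: "b j (s k x) = to_ac k * b j x"
    if "j < n" for j k x y
    using b_U[OF that] U(1) by (auto simp: sub_def H_def)
  have mult: "\<phi> (x * x') = \<phi> x * \<phi> x'" for x x'
  proof (rule eq_matI)
    fix i j assume "i < dim_row (\<phi> x * \<phi> x')" "j < dim_col (\<phi> x * \<phi> x')"
    then have ij: "i < n" "j < n" by (auto simp: \<phi>_def)
    have "M (x * x') j i = (\<phi> x * \<phi> x') $$ (i, j)"
    proof (rule uniq[OF _ ij(1)])
      fix y
      have "(\<Sum>i<n. M (x * x') j i * b i y) = b j (y * x * x')"
        using M[OF ij(2)] by (simp add: mult.assoc)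
      also have "\<dots> = (\<Sum>k<n. col (\<phi> x') j $ k * b k (y * x))"
        using ij by (simp add: M \<phi>_def)
      also have "\<dots> = (\<Sum>i<n. (\<phi> x *\<^sub>v col (\<phi> x') j) $ i * b i y)"
        by (rule act_lin) (simp add: \<phi>_def carrier_vecI)
      also have "\<dots> = (\<Sum>i<n. (\<phi> x * \<phi> x') $$ (i, j) * b i y)"
        using ij by (intro sum.cong) (auto simp: \<phi>_def)
      finally show "(\<Sum>i<n. M (x * x') j i * b i y) = (\<Sum>i<n. (\<phi> x * \<phi> x') $$ (i, j) * b i y)" .
    qed
    then show "\<phi> (x * x') $$ (i, j) = (\<phi> x * \<phi> x') $$ (i, j)" using ij by (simp add: \<phi>_def)
  qed (auto simp: \<phi>_def)
  have one: "\<phi> 1 = 1\<^sub>m n"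
  proof (rule eq_matI)
    fix i j assume "i < dim_row (1\<^sub>m n :: 'k alg_closure mat)" "j < dim_col (1\<^sub>m n :: 'k alg_closure mat)"
    then have ij: "i < n" "j < n" by auto
    have "M 1 j i = (if i = j then 1 else 0)"
    proof (rule uniq[OF _ ij(1)])
      fix y
      show "(\<Sum>i<n. M 1 j i * b i y) = (\<Sum>i<n. (if i = j then 1 else 0) * b i y)"
        using M[OF ij(2), of y 1] ij by (simp add: if_distrib[of "\<lambda>c. c * _"] sum.delta cong: if_cong)
    qed
    then show "\<phi> 1 $$ (i, j) = 1\<^sub>m n $$ (i, j)" using ij by (simp add: \<phi>_def)
  qed (auto simp: \<phi>_def)
  have add: "\<phi> (x + x') = \<phi> x + \<phi> x'" for x x'
  proof (rule eq_matI)
    fix i j assume "i < dim_row (\<phi> x + \<phi> x')" "j < dim_col (\<phi> x + \<phi> x')"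
    then have ij: "i < n" "j < n" by (auto simp: \<phi>_def)
    have "M (x + x') j i = M x j i + M x' j i"
      by (rule uniq[OF _ ij(1)])
        (simp add: distrib_right sum.distrib M[OF ij(2), symmetric] distrib_left H_add[OF ij(2)])
    then show "\<phi> (x + x') $$ (i, j) = (\<phi> x + \<phi> x') $$ (i, j)" using ij by (simp add: \<phi>_def)
  qed (auto simp: \<phi>_def)
  have smult: "\<phi> (s k x) = to_ac k \<cdot>\<^sub>m \<phi> x" for k x
  proof (rule eq_matI)
    fix i j assume "i < dim_row (to_ac k \<cdot>\<^sub>m \<phi> x)" "j < dim_col (to_ac k \<cdot>\<^sub>m \<phi> x)"
    then have ij: "i < n" "j < n" by (auto simp: \<phi>_def)
    have "M (s k x) j i = to_ac k * M x j i"
      by (rule uniq[OF _ ij(1)])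
        (simp add: mult.assoc sum_distrib_left[symmetric] M[OF ij(2), symmetric] scale_mult
          H_scale[OF ij(2)])
    then show "\<phi> (s k x) $$ (i, j) = (to_ac k \<cdot>\<^sub>m \<phi> x) $$ (i, j)" using ij by (simp add: \<phi>_def)
  qed (auto simp: \<phi>_def)
  have schur: "\<exists>t. C = t \<cdot>\<^sub>m 1\<^sub>m n"
    if C: "C \<in> carrier_mat n n" and comm: "\<And>x. C * \<phi> x = \<phi> x * C" for C
  proof -
    have "degree (char_poly C) > 0" using degree_monic_char_poly[OF C] n0 by simp
    then obtain t where "poly (char_poly C) t = 0" using alg_closed_imp_poly_has_root by blast
    then have "eigenvalue C t" by (simp add: eigenvalue_root_char_poly[OF C])
    then obtain v where v: "v \<in> carrier_vec n" "v \<noteq> 0\<^sub>v n" "C *\<^sub>v v = t \<cdot>\<^sub>v v"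
      using C by (auto simp: eigenvalue_def eigenvector_def)
    define lin where "lin = (\<lambda>(v :: 'k alg_closure vec) y. \<Sum>i<n. v $ i * b i y)"
    \<comment> \<open>The eigenspace of \<open>C\<close> for an eigenvalue \<open>t\<close>. Since
      \<open>C\<close> commutes with the representation, the functions with coordinate vector in
      \<open>E\<close> form a nonzero submodule of \<open>U\<close>, which is all of
      \<open>U\<close> by minimality.\<close>
    define E where "E = {v \<in> carrier_vec n. C *\<^sub>v v = t \<cdot>\<^sub>v v}"
    define U' where "U' = lin ` E"
    have "sub U'"
    proof -
      have "F.subspace U'"
      proof (rule F.subspaceI)
        have "lin (0\<^sub>v n) = 0" by (auto simp: lin_def)
        moreover have "0\<^sub>v n \<in> E" using C by (auto simp: E_def)
        ultimately show "0 \<in> U'" unfolding U'_def by (metis imageI)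
        fix f g assume "f \<in> U'" "g \<in> U'"
        then obtain u w where uw: "u \<in> E" "w \<in> E" "f = lin u" "g = lin w" by (auto simp: U'_def)
        have "u + w \<in> E" using uw C
          by (auto simp: E_def mult_add_distrib_mat_vec[OF C] smult_add_distrib_vec[of _ n])
        moreover have "f + g = lin (u + w)"
          using uw by (auto simp: lin_def E_def fun_eq_iff algebra_simps sum.distrib)
        ultimately show "f + g \<in> U'" by (simp add: U'_def)
      next
        fix c f assume "f \<in> U'"
        then obtain u where u: "u \<in> E" "f = lin u" by (auto simp: U'_def)
        have "c \<cdot>\<^sub>v u \<in> E" using u C
          by (auto simp: E_def mult_mat_vec[OF C] smult_smult_assoc mult.commute)
        moreover have "sc c f = lin (c \<cdot>\<^sub>v u)"
          using u by (auto simp: lin_def sc_def E_def fun_eq_iff sum_distrib_left algebra_simps)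
        ultimately show "sc c f \<in> U'" by (simp add: U'_def)
      qed
      moreover have "U' \<subseteq> H" using in_U U(1) by (auto simp: U'_def lin_def sub_def)
      moreover have "act x f \<in> U'" if fU: "f \<in> U'" for x f
      proof -
        obtain u where u: "u \<in> E" "f = lin u" using fU by (auto simp: U'_def)
        have un: "u \<in> carrier_vec n" "C *\<^sub>v u = t \<cdot>\<^sub>v u" using u by (auto simp: E_def)
        have "C *\<^sub>v (\<phi> x *\<^sub>v u) = \<phi> x *\<^sub>v (C *\<^sub>v u)"
          using assoc_mult_mat_vec[OF C \<phi> un(1), of x] assoc_mult_mat_vec[OF \<phi> C un(1), of x]
          by (simp add: comm)
        also have "\<dots> = t \<cdot>\<^sub>v (\<phi> x *\<^sub>v u)" using un by (simp add: mult_mat_vec[OF \<phi>])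
        finally have "\<phi> x *\<^sub>v u \<in> E" using \<phi>[of x] un by (simp add: E_def)
        moreover have "act x f = lin (\<phi> x *\<^sub>v u)"
          using u act_lin[OF un(1)] by (simp add: act_def lin_def)
        ultimately show ?thesis by (simp add: U'_def)
      qed
      moreover have "U' \<noteq> {0}"
      proof
        assume "U' = {0}"
        moreover have "v \<in> E" using v by (simp add: E_def)
        ultimately have "lin v = 0" by (auto simp: U'_def)
        then have "v $ i = 0" if "i < n" for i
          using uniq[of "\<lambda>i. v $ i" "\<lambda>i. 0" i] that by (auto simp: lin_def fun_eq_iff)
        then have "v = 0\<^sub>v n" using v(1) by (intro eq_vecI) auto
        with v show False by simp
      qed
      ultimately show ?thesis by (simp add: sub_def)
    qed
    moreover have "U' \<subseteq> U" using in_U by (auto simp: U'_def lin_def)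
    ultimately have "U' = U" by (rule minimal)
    have "C = t \<cdot>\<^sub>m 1\<^sub>m n"
    proof (rule eq_matI)
      fix i j assume "i < dim_row (t \<cdot>\<^sub>m 1\<^sub>m n)" "j < dim_col (t \<cdot>\<^sub>m 1\<^sub>m n)"
      then have ij: "i < n" "j < n" by auto
      obtain u where u: "u \<in> E" "b j = lin u" using b_U[OF ij(2)] \<open>U' = U\<close> by (auto simp: U'_def)
      have "(if k = j then 1 else 0) = u $ k" if "k < n" for k
      proof (rule uniq[OF _ that])
        show "(\<Sum>i<n. (if i = j then 1 else 0) * b i y) = (\<Sum>i<n. u $ i * b i y)" for y
          using u(2) ij(2)
          by (auto simp: lin_def fun_eq_iff if_distrib[of "\<lambda>c. c * _"] cong: if_cong)
      qed
      then have "u = unit_vec n j"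
        using u(1) ij by (intro eq_vecI) (auto simp: E_def unit_vec_def)
      then have "C *\<^sub>v unit_vec n j = t \<cdot>\<^sub>v unit_vec n j" using u by (simp add: E_def)
      then have "(C *\<^sub>v unit_vec n j) $ i = (t \<cdot>\<^sub>v unit_vec n j) $ i" by simp
      then show "C $$ (i, j) = (t \<cdot>\<^sub>m 1\<^sub>m n) $$ (i, j)"
        using C ij by (auto simp: scalar_prod_right_unit)
    qed (use C in auto)
    then show ?thesis by blast
  qed
  show ?thesis
    unfolding irrep_def using n0 \<phi> one mult add smult schur by blast
qed

end


section \<open>The Goldman element in matrix representations\<close>

context
  fixes s :: "'k::field \<Rightarrow> 'a::ring_1 \<Rightarrow> 'a" and n \<phi>
  assumes irrep: "irrep s n \<phi>"
begin

lemma irrep_pos: "n > 0"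
  and irrep_carrier: "\<phi> x \<in> carrier_mat n n"
  and irrep_one: "\<phi> 1 = 1\<^sub>m n"
  and irrep_mult: "\<phi> (x * y) = \<phi> x * \<phi> y"
  and irrep_add: "\<phi> (x + y) = \<phi> x + \<phi> y"
  and irrep_scale: "\<phi> (s k x) = to_ac k \<cdot>\<^sub>m \<phi> x"
  using irrep by (auto simp: irrep_def)

lemma irrep_schur:
  "C \<in> carrier_mat n n \<Longrightarrow> (\<And>x. C * \<phi> x = \<phi> x * C) \<Longrightarrow> \<exists>t. C = t \<cdot>\<^sub>m 1\<^sub>m n"
  using irrep unfolding irrep_def by blast

lemma irrep_dim [simp]: "dim_row (\<phi> x) = n" "dim_col (\<phi> x) = n"
  using irrep_carrier[of x] by auto

context
  fixes i j
  assumes ij: "i < n" "j < n"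
begin

lemma irrep_mult_index: "\<phi> (x * y) $$ (i, j) = (\<Sum>k<n. \<phi> x $$ (i, k) * \<phi> y $$ (k, j))"
  unfolding irrep_mult by (rule mult_mat_index[OF irrep_carrier irrep_carrier ij])

lemma irrep_add_index: "\<phi> (x + y) $$ (i, j) = \<phi> x $$ (i, j) + \<phi> y $$ (i, j)"
  using ij by (simp add: irrep_add)

lemma irrep_scale_index: "\<phi> (s k x) $$ (i, j) = to_ac k * \<phi> x $$ (i, j)"
  using ij by (simp add: irrep_scale)

lemma irrep_one_index: "\<phi> 1 $$ (i, j) = (if i = j then 1 else 0)"
  using ij by (simp add: irrep_one)

lemma irrep_frag_eval_index: "\<phi> (frag_eval h f) $$ (i, j) = frag_eval (\<lambda>p. \<phi> (h p) $$ (i, j)) f"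
  by (rule frag_eval_additive[of "\<lambda>x. \<phi> x $$ (i, j)"]) (rule irrep_add_index)

end

end

definition mtrace :: "'c::comm_monoid_add mat \<Rightarrow> 'c" where
  "mtrace A = (\<Sum>i<dim_row A. A $$ (i, i))"

lemma mtrace_mult_comm:
  fixes A B :: "'c::comm_semiring_0 mat"
  assumes "A \<in> carrier_mat m n" "B \<in> carrier_mat n m"
  shows "mtrace (A * B) = mtrace (B * A)"
proof -
  have "mtrace (A * B) = (\<Sum>i<m. \<Sum>k<n. A $$ (i, k) * B $$ (k, i))"
    unfolding mtrace_def using assms by (intro sum.cong mult_mat_index) auto
  also have "\<dots> = (\<Sum>k<n. \<Sum>i<m. B $$ (k, i) * A $$ (i, k))"
    by (subst sum.swap) (simp add: mult.commute)
  also have "\<dots> = mtrace (B * A)"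
    unfolding mtrace_def using assms by (intro sum.cong mult_mat_index[symmetric]) auto
  finally show ?thesis .
qed

text \<open>The coordinates of the image of \<open>g\<close> under \<phi> \<otimes> \<psi>, with
  respect to the products of the matrix units at (p, q) and (r, u). Two representations are allowed
  so that they can be compared through \<open>g\<close>.\<close>

definition coeff_tensor ::
  "('a::ring_1 \<times> 'a \<Rightarrow>\<^sub>0 int) \<Rightarrow> ('a \<Rightarrow> 'l::comm_ring_1 mat) \<Rightarrow> ('a \<Rightarrow> 'l mat) \<Rightarrow>
    nat \<Rightarrow> nat \<Rightarrow> nat \<Rightarrow> nat \<Rightarrow> 'l" where
  "coeff_tensor g \<phi> \<psi> p q r u = frag_eval (\<lambda>(a, b). \<phi> a $$ (p, q) * \<psi> b $$ (r, u)) g"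

text \<open>The form \<tau> is kept arbitrary because the locale is used twice: with the cyclic form
  constructed above, to show that \<open>Trd\<close> is well defined, and then with
  \<open>Trd\<close> itself.\<close>

locale azumaya_trace = azumaya s for s :: "'k::field \<Rightarrow> 'a::ring_1 \<Rightarrow> 'a" +
  fixes \<tau> :: "'a \<Rightarrow> 'k" and g
  assumes trace_cyclic: "\<And>x y. \<tau> (x * y) = \<tau> (y * x)"
    and trace_nonzero: "\<exists>z. \<tau> z \<noteq> 0"
    and sandwich_trace: "\<And>x. sandwich_frag g x = s (\<tau> x) 1"
begin

text \<open>Scalars are central: both tensors have the sandwich y \<mapsto> \<tau>(y) x.\<close>

lemma intertwine_outer:
  assumes "balanced s h"
  shows "frag_eval (\<lambda>(a, b). h (x * a, b)) g = frag_eval (\<lambda>(a, b). h (a, b * x)) g"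
proof -
  have "frag_eval h (frag_extend (\<lambda>(a, b). frag_of (x * a, b)) g) =
      frag_eval h (frag_extend (\<lambda>(a, b). frag_of (a, b * x)) g)"
  proof (rule balanced_transfer[OF assms])
    fix y
    have "sandwich_frag (frag_extend (\<lambda>(a, b). frag_of (x * a, b)) g) y = x * sandwich_frag g y"
      unfolding frag_eval_extend frag_eval_mult_left[symmetric]
      by (rule frag_eval_cong) (auto simp: mult.assoc)
    moreover have "sandwich_frag (frag_extend (\<lambda>(a, b). frag_of (a, b * x)) g) y =
        sandwich_frag g y * x"
      unfolding frag_eval_extend frag_eval_mult_right[symmetric]
      by (rule frag_eval_cong) (auto simp: mult.assoc)
    ultimately show "sandwich_frag (frag_extend (\<lambda>(a, b). frag_of (x * a, b)) g) y =
      sandwich_frag (frag_extend (\<lambda>(a, b). frag_of (a, b * x)) g) y"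
      by (simp add: sandwich_trace scale_mult)
  qed
  then show ?thesis by (simp add: frag_eval_extend case_prod_unfold)
qed

text \<open>Here the cyclicity of \<tau> is what counts: the sandwiches at y are \<tau>(x y) 1 and
  \<tau>(y x) 1.\<close>

lemma intertwine_inner:
  assumes "balanced s h"
  shows "frag_eval (\<lambda>(a, b). h (a * x, b)) g = frag_eval (\<lambda>(a, b). h (a, x * b)) g"
proof -
  have "frag_eval h (frag_extend (\<lambda>(a, b). frag_of (a * x, b)) g) =
      frag_eval h (frag_extend (\<lambda>(a, b). frag_of (a, x * b)) g)"
  proof (rule balanced_transfer[OF assms])
    fix y
    have "sandwich_frag (frag_extend (\<lambda>(a, b). frag_of (a * x, b)) g) y = sandwich_frag g (x * y)"
      unfolding frag_eval_extend by (rule frag_eval_cong) (auto simp: mult.assoc)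
    moreover have "sandwich_frag (frag_extend (\<lambda>(a, b). frag_of (a, x * b)) g) y =
        sandwich_frag g (y * x)"
      unfolding frag_eval_extend by (rule frag_eval_cong) (auto simp: mult.assoc)
    ultimately show "sandwich_frag (frag_extend (\<lambda>(a, b). frag_of (a * x, b)) g) y =
      sandwich_frag (frag_extend (\<lambda>(a, b). frag_of (a, x * b)) g) y"
      by (simp add: sandwich_trace trace_cyclic[of x])
  qed
  then show ?thesis by (simp add: frag_eval_extend case_prod_unfold)
qed

lemma balanced_coeff:
  assumes "irrep s n \<phi>" "irrep s m \<psi>" "p < n" "q < n" "r < m" "u < m"
  shows "balanced s (\<lambda>(a, b). \<phi> a $$ (p, q) * \<psi> b $$ (r, u))"
  using assms
  by (simp add: balanced_def irrep_add_index[of s] irrep_scale_index[of s] algebra_simps)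

text \<open>This is \<open>intertwine_outer\<close> in coordinates. With the inner indices
  \<open>q\<close>, \<open>r\<close> fixed, the matrix C with entries indexed by (p, u) satisfies
  \<phi>(x) C = C \<psi>(x).\<close>

lemma coeff_tensor_outer:
  assumes "irrep s n \<phi>" "irrep s m \<psi>" "p < n" "q < n" "r < m" "u < m"
  shows "(\<Sum>k<n. \<phi> x $$ (p, k) * coeff_tensor g \<phi> \<psi> k q r u) =
    (\<Sum>k<m. coeff_tensor g \<phi> \<psi> p q r k * \<psi> x $$ (k, u))"
proof -
  have "(\<Sum>k<n. \<phi> x $$ (p, k) * coeff_tensor g \<phi> \<psi> k q r u) =
      frag_eval (\<lambda>(a, b). \<phi> (x * a) $$ (p, q) * \<psi> b $$ (r, u)) g"
    unfolding coeff_tensor_def frag_eval_mult_left[symmetric] frag_eval_sum[symmetric]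
    by (rule frag_eval_cong)
      (auto simp: irrep_mult_index[OF assms(1,3,4)] sum_distrib_right mult.assoc)
  also have "\<dots> = frag_eval (\<lambda>(a, b). \<phi> a $$ (p, q) * \<psi> (b * x) $$ (r, u)) g"
    using intertwine_outer[OF balanced_coeff[OF assms], of x] by simp
  also have "\<dots> = (\<Sum>k<m. coeff_tensor g \<phi> \<psi> p q r k * \<psi> x $$ (k, u))"
    unfolding coeff_tensor_def frag_eval_mult_right[symmetric] frag_eval_sum[symmetric]
    by (rule frag_eval_cong)
      (auto simp: irrep_mult_index[OF assms(2,5,6)] sum_distrib_left mult.assoc)
  finally show ?thesis .
qed

text \<open>This is \<open>intertwine_inner\<close> in coordinates. With the outer indices
  \<open>p\<close>, \<open>u\<close> fixed, the matrix C indexed by (r, q) intertwines in the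
  opposite direction, C \<phi>(x) = \<psi>(x) C.\<close>

lemma coeff_tensor_inner:
  assumes "irrep s n \<phi>" "irrep s m \<psi>" "p < n" "q < n" "r < m" "u < m"
  shows "(\<Sum>k<n. coeff_tensor g \<phi> \<psi> p k r u * \<phi> x $$ (k, q)) =
    (\<Sum>k<m. \<psi> x $$ (r, k) * coeff_tensor g \<phi> \<psi> p q k u)"
proof -
  have "(\<Sum>k<n. coeff_tensor g \<phi> \<psi> p k r u * \<phi> x $$ (k, q)) =
      frag_eval (\<lambda>(a, b). \<phi> (a * x) $$ (p, q) * \<psi> b $$ (r, u)) g"
    unfolding coeff_tensor_def frag_eval_mult_right[symmetric] frag_eval_sum[symmetric]
    by (rule frag_eval_cong)
      (auto simp: irrep_mult_index[OF assms(1,3,4)] sum_distrib_left sum_distrib_right mult_ac)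
  also have "\<dots> = frag_eval (\<lambda>(a, b). \<phi> a $$ (p, q) * \<psi> (x * b) $$ (r, u)) g"
    using intertwine_inner[OF balanced_coeff[OF assms], of x] by simp
  also have "\<dots> = (\<Sum>k<m. \<psi> x $$ (r, k) * coeff_tensor g \<phi> \<psi> p q k u)"
    unfolding coeff_tensor_def frag_eval_mult_left[symmetric] frag_eval_sum[symmetric]
    by (rule frag_eval_cong)
      (auto simp: irrep_mult_index[OF assms(2,5,6)] sum_distrib_left mult_ac)
  finally show ?thesis .
qed

text \<open>
  By Schur's lemma, applied separately to the outer and to the inner indices, \<open>g\<close> becomes a
  multiple of the Goldman element \<open>\<Sum> E\<^sub>p\<^sub>q \<otimes> E\<^sub>q\<^sub>p\<close> of the matrix algebra.
\<close>

lemma coeff_tensor_self: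
  assumes \<phi>: "irrep s n \<phi>"
  obtains t where "\<And>p q r u. p < n \<Longrightarrow> q < n \<Longrightarrow> r < n \<Longrightarrow> u < n \<Longrightarrow>
      coeff_tensor g \<phi> \<phi> p q r u = (if p = u \<and> q = r then t else 0)"
    and "\<And>x. to_ac (\<tau> x) = t * mtrace (\<phi> x)" and "t \<noteq> 0"
proof -
  note n0 = irrep_pos[OF \<phi>] and car = irrep_carrier[OF \<phi>]
  let ?c = "coeff_tensor g \<phi> \<phi>"
  have outer: "?c p q r u = (if p = u then ?c 0 q r 0 else 0)" if "p < n" "q < n" "r < n" "u < n" for p q r u
  proof -
    let ?C = "mat n n (\<lambda>(p, u). ?c p q r u)"
    have "\<exists>t. ?C = t \<cdot>\<^sub>m 1\<^sub>m n"
    proof (rule irrep_schur[OF \<phi>])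
      fix x
      show "?C * \<phi> x = \<phi> x * ?C"
      proof (rule eq_matI)
        fix i j assume "i < dim_row (\<phi> x * ?C)" "j < dim_col (\<phi> x * ?C)"
        then have ij: "i < n" "j < n" using car[of x] by auto
        then have "(?C * \<phi> x) $$ (i, j) = (\<Sum>k<n. ?c i q r k * \<phi> x $$ (k, j))"
          using mult_mat_index[of ?C n n "\<phi> x" n i j] car[of x] by simp
        also have "\<dots> = (\<Sum>k<n. \<phi> x $$ (i, k) * ?c k q r j)"
          using coeff_tensor_outer[OF \<phi> \<phi>] ij that by simp
        also have "\<dots> = (\<phi> x * ?C) $$ (i, j)"
          using mult_mat_index[of "\<phi> x" n n ?C n i j] car[of x] ij by simp
        finally show "(?C * \<phi> x) $$ (i, j) = (\<phi> x * ?C) $$ (i, j)" .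
      qed (use car[of x] in auto)
    qed simp
    then obtain t where t: "?C = t \<cdot>\<^sub>m 1\<^sub>m n" by blast
    have "?C $$ (i, j) = (if i = j then t else 0)" if "i < n" "j < n" for i j
      unfolding t using that by simp
    from this[of p u] this[of 0 0] show ?thesis using that n0 by simp
  qed
  have inner: "?c p q r u = (if q = r then ?c p 0 0 u else 0)" if "p < n" "q < n" "r < n" "u < n" for p q r u
  proof -
    let ?C = "mat n n (\<lambda>(r, q). ?c p q r u)"
    have "\<exists>t. ?C = t \<cdot>\<^sub>m 1\<^sub>m n"
    proof (rule irrep_schur[OF \<phi>])
      fix x
      show "?C * \<phi> x = \<phi> x * ?C"
      proof (rule eq_matI)
        fix i j assume "i < dim_row (\<phi> x * ?C)" "j < dim_col (\<phi> x * ?C)"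
        then have ij: "i < n" "j < n" using car[of x] by auto
        then have "(?C * \<phi> x) $$ (i, j) = (\<Sum>k<n. ?c p k i u * \<phi> x $$ (k, j))"
          using mult_mat_index[of ?C n n "\<phi> x" n i j] car[of x] by simp
        also have "\<dots> = (\<Sum>k<n. \<phi> x $$ (i, k) * ?c p j k u)"
          using coeff_tensor_inner[OF \<phi> \<phi>] ij that by simp
        also have "\<dots> = (\<phi> x * ?C) $$ (i, j)"
          using mult_mat_index[of "\<phi> x" n n ?C n i j] car[of x] ij by simp
        finally show "(?C * \<phi> x) $$ (i, j) = (\<phi> x * ?C) $$ (i, j)" .
      qed (use car[of x] in auto)
    qed simp
    then obtain t where t: "?C = t \<cdot>\<^sub>m 1\<^sub>m n" by blast
    have "?C $$ (i, j) = (if i = j then t else 0)" if "i < n" "j < n" for i j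
      unfolding t using that by simp
    from this[of r q] this[of 0 0] show ?thesis using that n0 by auto
  qed
  define t where "t = ?c 0 0 0 0"
  have c: "?c p q r u = (if p = u \<and> q = r then t else 0)" if "p < n" "q < n" "r < n" "u < n" for p q r u
    using outer[of p q r u] inner[of 0 q r 0] that n0 unfolding t_def by auto
  \<comment> \<open>The entry at (0, 0) of the sum of \<phi>(a) \<phi>(x) \<phi>(b), which is
    \<tau>(x) times the identity. Inserting the coefficients of \<open>g\<close> leaves t times the
    diagonal sum.\<close>
  have tr: "to_ac (\<tau> x) = t * mtrace (\<phi> x)" for x
  proof -
    have "to_ac (\<tau> x) = \<phi> (sandwich_frag g x) $$ (0, 0)"
      using n0 by (simp add: sandwich_trace irrep_scale_index[OF \<phi>] irrep_one_index[OF \<phi>])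
    also have "\<dots> = frag_eval (\<lambda>(a, b). \<phi> (a * x * b) $$ (0, 0)) g"
      using n0 by (simp add: irrep_frag_eval_index[OF \<phi>] case_prod_unfold)
    also have "\<dots> = frag_eval (\<lambda>(a, b). \<Sum>q<n. \<Sum>r<n. \<phi> a $$ (0, q) * \<phi> b $$ (r, 0) * \<phi> x $$ (q, r)) g"
      by (rule frag_eval_cong)
        (use n0 in \<open>auto simp: irrep_mult_index[OF \<phi>] sum_distrib_left sum_distrib_right mult_ac\<close>)
    also have "\<dots> = (\<Sum>q<n. \<Sum>r<n. ?c 0 q r 0 * \<phi> x $$ (q, r))"
      by (simp add: coeff_tensor_def frag_eval_mult_right[symmetric] frag_eval_sum[symmetric]
          case_prod_unfold)
    also have "\<dots> = (\<Sum>q<n. \<Sum>r<n. if q = r then t * \<phi> x $$ (q, r) else 0)"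
      using n0 by (intro sum.cong) (auto simp: c)
    also have "\<dots> = t * mtrace (\<phi> x)"
      by (simp add: mtrace_def irrep_dim[OF \<phi>] sum_distrib_left)
    finally show ?thesis .
  qed
  have "t \<noteq> 0"
  proof
    assume "t = 0"
    then have "\<tau> z = 0" for z using tr[of z] by simp
    then show False using trace_nonzero by blast
  qed
  with c tr show ?thesis by (rule that)
qed

text \<open>The sum of \<phi>(a) at (0, 0) times \<tau>(b) is evaluated twice, with \<tau> expressed
  by the trace of \<psi> and by the trace of \<phi>. The second evaluation gives t * t, which is
  nonzero, so some diagonal term of the first is nonzero.\<close>

lemma coeff_tensor_nonzero:
  assumes \<phi>: "irrep s n \<phi>" and \<psi>: "irrep s m \<psi>"
  obtains r where "r < m" "coeff_tensor g \<phi> \<psi> 0 0 r r \<noteq> 0"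
proof -
  obtain t where t: "\<And>p q r u. p < n \<Longrightarrow> q < n \<Longrightarrow> r < n \<Longrightarrow> u < n \<Longrightarrow>
      coeff_tensor g \<phi> \<phi> p q r u = (if p = u \<and> q = r then t else 0)"
    "\<And>x. to_ac (\<tau> x) = t * mtrace (\<phi> x)" "t \<noteq> 0"
    by (rule coeff_tensor_self[OF \<phi>]) blast
  obtain t' where t': "\<And>x. to_ac (\<tau> x) = t' * mtrace (\<psi> x)" "t' \<noteq> 0"
    by (rule coeff_tensor_self[OF \<psi>]) blast
  have "t' * (\<Sum>r<m. coeff_tensor g \<phi> \<psi> 0 0 r r) = frag_eval (\<lambda>(a, b). \<phi> a $$ (0, 0) * to_ac (\<tau> b)) g"
    unfolding coeff_tensor_def frag_eval_mult_left[symmetric] frag_eval_sum[symmetric]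
    by (rule frag_eval_cong)
      (auto simp: t'(1) mtrace_def irrep_dim[OF \<psi>] sum_distrib_left mult_ac)
  also have "\<dots> = t * (\<Sum>r<n. coeff_tensor g \<phi> \<phi> 0 0 r r)"
    unfolding coeff_tensor_def frag_eval_mult_left[symmetric] frag_eval_sum[symmetric]
    by (rule frag_eval_cong)
      (auto simp: t(2) mtrace_def irrep_dim[OF \<phi>] sum_distrib_left mult_ac)
  also have "(\<Sum>r<n. coeff_tensor g \<phi> \<phi> 0 0 r r) = (\<Sum>r<n. if r = 0 then t else 0)"
    using irrep_pos[OF \<phi>] by (intro sum.cong) (auto simp: t(1))
  also have "\<dots> = t" using irrep_pos[OF \<phi>] by simp
  finally have "(\<Sum>r<m. coeff_tensor g \<phi> \<psi> 0 0 r r) \<noteq> 0" using t(3) t'(2) by auto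
  then obtain r where "r \<in> {..<m}" "coeff_tensor g \<phi> \<psi> 0 0 r r \<noteq> 0"
    by (rule sum.not_neutral_contains_not_neutral)
  then show ?thesis using that by simp
qed

text \<open>The Skolem--Noether theorem, with the intertwiners read off from the coefficients of \<open>g\<close>.\<close>

lemma skolem_noether:
  assumes \<phi>: "irrep s n \<phi>" and \<psi>: "irrep s m \<psi>"
  obtains P Q c where "P \<in> carrier_mat m n" "Q \<in> carrier_mat n m" "c \<noteq> 0"
    "\<And>x. \<phi> x * Q = Q * \<psi> x" "\<And>x. \<psi> x * P = P * \<phi> x" "P * Q = c \<cdot>\<^sub>m 1\<^sub>m m" "Q * P = c \<cdot>\<^sub>m 1\<^sub>m n"
proof -
  note c\<phi> = irrep_carrier[OF \<phi>] and c\<psi> = irrep_carrier[OF \<psi>]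
  obtain t where t: "\<And>p q r u. p < m \<Longrightarrow> q < m \<Longrightarrow> r < m \<Longrightarrow> u < m \<Longrightarrow>
      coeff_tensor g \<psi> \<psi> p q r u = (if p = u \<and> q = r then t else 0)" "t \<noteq> 0"
    by (rule coeff_tensor_self[OF \<psi>]) blast
  obtain r where r: "r < m" "coeff_tensor g \<phi> \<psi> 0 0 r r \<noteq> 0"
    by (rule coeff_tensor_nonzero[OF \<phi> \<psi>])
  \<comment> \<open>The inner indices are frozen where a coefficient is nonzero; by
    \<open>coeff_tensor_outer\<close> the outer indices then form an intertwiner. \<open>P\<close>
    arises in the same way with the representations exchanged.\<close>
  define Q where "Q = mat n m (\<lambda>(p, u). coeff_tensor g \<phi> \<psi> p 0 r u)"
  define P where "P = mat m n (\<lambda>(p, u). coeff_tensor g \<psi> \<phi> p r 0 u)"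
  have Q: "Q \<in> carrier_mat n m" and P: "P \<in> carrier_mat m n" by (auto simp: Q_def P_def)
  have n0: "0 < n" by (rule irrep_pos[OF \<phi>])
  have \<phi>Q: "\<phi> x * Q = Q * \<psi> x" for x
  proof (rule eq_matI)
    fix i j assume "i < dim_row (Q * \<psi> x)" "j < dim_col (Q * \<psi> x)"
    then have ij: "i < n" "j < m" using Q c\<psi>[of x] by auto
    show "(\<phi> x * Q) $$ (i, j) = (Q * \<psi> x) $$ (i, j)"
      using coeff_tensor_outer[OF \<phi> \<psi> ij(1) n0 r(1) ij(2), of x] ij
      unfolding mult_mat_index[OF c\<phi> Q ij] mult_mat_index[OF Q c\<psi> ij] by (simp add: Q_def)
  qed (use Q c\<phi>[of x] c\<psi>[of x] in auto)
  have \<psi>P: "\<psi> x * P = P * \<phi> x" for x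
  proof (rule eq_matI)
    fix i j assume "i < dim_row (P * \<phi> x)" "j < dim_col (P * \<phi> x)"
    then have ij: "i < m" "j < n" using P c\<phi>[of x] by auto
    show "(\<psi> x * P) $$ (i, j) = (P * \<phi> x) $$ (i, j)"
      using coeff_tensor_outer[OF \<psi> \<phi> ij(1) r(1) n0 ij(2), of x] ij
      unfolding mult_mat_index[OF c\<psi> P ij] mult_mat_index[OF P c\<phi> ij] by (simp add: P_def)
  qed (use P c\<phi>[of x] c\<psi>[of x] in auto)
  define c where "c = t * Q $$ (0, r)"
  have c0: "c \<noteq> 0" using t(2) r n0 by (simp add: c_def Q_def)
  have PQ: "P * Q = c \<cdot>\<^sub>m 1\<^sub>m m"
  proof (rule eq_matI)
    fix i j assume "i < dim_row (c \<cdot>\<^sub>m 1\<^sub>m m)" "j < dim_col (c \<cdot>\<^sub>m 1\<^sub>m m)"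
    then have ij: "i < m" "j < m" by auto
    have "(P * Q) $$ (i, j) = (\<Sum>u<n. coeff_tensor g \<psi> \<phi> i r 0 u * Q $$ (u, j))"
      unfolding mult_mat_index[OF P Q ij] using ij by (simp add: P_def)
    also have "\<dots> = frag_eval (\<lambda>(a, b). \<psi> a $$ (i, r) * (\<phi> b * Q) $$ (0, j)) g"
      unfolding coeff_tensor_def frag_eval_mult_right[symmetric] frag_eval_sum[symmetric]
      by (rule frag_eval_cong)
        (auto simp: mult_mat_index[OF c\<phi> Q n0 ij(2)] sum_distrib_left mult_ac)
    \<comment> \<open>Moving \<phi>(b) past \<open>Q\<close> turns it into \<psi>(b), so that only
      coefficients of \<open>g\<close> for \<psi> with itself remain. Those with k = r survive,
      which explains the value of \<open>c\<close>.\<close>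
    also have "\<dots> = (\<Sum>k<m. Q $$ (0, k) * coeff_tensor g \<psi> \<psi> i r k j)"
      unfolding \<phi>Q coeff_tensor_def frag_eval_mult_left[symmetric] frag_eval_sum[symmetric]
      by (rule frag_eval_cong)
        (auto simp: mult_mat_index[OF Q c\<psi> n0 ij(2)] sum_distrib_left mult_ac)
    also have "\<dots> = (\<Sum>k<m. if k = r then Q $$ (0, r) * (if i = j then t else 0) else 0)"
      using ij r(1) by (intro sum.cong) (auto simp: t)
    also have "\<dots> = (c \<cdot>\<^sub>m 1\<^sub>m m) $$ (i, j)"
      using ij r(1) by (simp add: c_def mult.commute)
    finally show "(P * Q) $$ (i, j) = (c \<cdot>\<^sub>m 1\<^sub>m m) $$ (i, j)" .
  qed (use P Q in auto)
  have "\<exists>d. Q * P = d \<cdot>\<^sub>m 1\<^sub>m n"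
  proof (rule irrep_schur[OF \<phi>])
    fix x
    have "Q * P * \<phi> x = Q * (\<psi> x * P)"
      using assoc_mult_mat[OF Q P c\<phi>, of x] by (simp add: \<psi>P)
    also have "\<dots> = \<phi> x * Q * P"
      using assoc_mult_mat[OF Q c\<psi> P, of x] by (simp add: \<phi>Q)
    also have "\<dots> = \<phi> x * (Q * P)" by (rule assoc_mult_mat[OF c\<phi> Q P])
    finally show "Q * P * \<phi> x = \<phi> x * (Q * P)" .
  qed (use P Q in auto)
  then obtain d where d: "Q * P = d \<cdot>\<^sub>m 1\<^sub>m n" by blast
  \<comment> \<open>Both scalars multiply \<open>Q\<close> to the same matrix, and the entry of
    \<open>Q\<close> at (0, r) is nonzero.\<close>
  have "d \<cdot>\<^sub>m Q = Q * P * Q" unfolding d mult_smult_assoc_mat[OF one_carrier_mat Q] left_mult_one_mat[OF Q] ..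
  also have "\<dots> = Q * (P * Q)" by (rule assoc_mult_mat[OF Q P Q])
  also have "\<dots> = c \<cdot>\<^sub>m Q" unfolding PQ mult_smult_distrib[OF Q one_carrier_mat] right_mult_one_mat[OF Q] ..
  finally have "(d \<cdot>\<^sub>m Q) $$ (0, r) = (c \<cdot>\<^sub>m Q) $$ (0, r)" by simp
  then have "d = c" using n0 r by (simp add: Q_def)
  with d have QP: "Q * P = c \<cdot>\<^sub>m 1\<^sub>m n" by simp
  show ?thesis by (rule that[OF P Q c0 \<phi>Q \<psi>P PQ QP])
qed

text \<open>Cyclicity of the trace moves \<open>P\<close> in \<phi>(x) Q P to the front, where P
  \<phi>(x) Q = P Q \<psi>(x). As Q P and P Q are the same nonzero scalar, no prior comparison of
  the sizes \<open>n\<close> and \<open>m\<close> is involved.\<close>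

lemma mtrace_irrep_unique:
  assumes \<phi>: "irrep s n \<phi>" and \<psi>: "irrep s m \<psi>"
  shows "mtrace (\<phi> x) = mtrace (\<psi> x)"
proof -
  obtain P Q c where PQ: "P \<in> carrier_mat m n" "Q \<in> carrier_mat n m" "c \<noteq> 0"
    "\<And>x. \<phi> x * Q = Q * \<psi> x" "\<And>x. \<psi> x * P = P * \<phi> x" "P * Q = c \<cdot>\<^sub>m 1\<^sub>m m" "Q * P = c \<cdot>\<^sub>m 1\<^sub>m n"
    by (rule skolem_noether[OF \<phi> \<psi>]) blast
  note c\<phi> = irrep_carrier[OF \<phi>, of x] and c\<psi> = irrep_carrier[OF \<psi>, of x]
  have smult: "mtrace (c \<cdot>\<^sub>m A) = c * mtrace A" if "A \<in> carrier_mat l l" for A :: "'k alg_closure mat" and l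
    using that by (simp add: mtrace_def sum_distrib_left)
  have "c * mtrace (\<phi> x) = mtrace (\<phi> x * (Q * P))"
    unfolding PQ mult_smult_distrib[OF c\<phi> one_carrier_mat] right_mult_one_mat[OF c\<phi>] smult[OF c\<phi>] ..
  also have "\<dots> = mtrace ((\<phi> x * Q) * P)" using assoc_mult_mat[OF c\<phi> PQ(2,1)] by simp
  also have "\<dots> = mtrace (P * (\<phi> x * Q))" using PQ(1,2) c\<phi> by (intro mtrace_mult_comm) auto
  also have "\<dots> = mtrace (P * Q * \<psi> x)" unfolding PQ(4) using assoc_mult_mat[OF PQ(1,2) c\<psi>] by simp
  also have "\<dots> = c * mtrace (\<psi> x)"
    unfolding PQ mult_smult_assoc_mat[OF one_carrier_mat c\<psi>] left_mult_one_mat[OF c\<psi>] smult[OF c\<psi>] ..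
  finally show ?thesis using PQ(3) by simp
qed

end


section \<open>Irreducible representations are splittings\<close>

lemma frag_eval_of_sum: "frag_eval h (\<Sum>i\<in>I. f i) = (\<Sum>i\<in>I. frag_eval h (f i))"
  by (induction I rule: infinite_finite_induct) (simp_all add: frag_eval_add)

abbreviation ac_scale :: "'k::field \<Rightarrow> 'k alg_closure \<Rightarrow> 'k alg_closure" where
  "ac_scale k l \<equiv> to_ac k * l"

lemma vtensor_ker_rules:
  shows vtensor_ker_add1: "frag_of (x + x', y) - frag_of (x, y) - frag_of (x', y) \<in> vtensor_ker s s'"
    and vtensor_ker_add2: "frag_of (x, y + y') - frag_of (x, y) - frag_of (x, y') \<in> vtensor_ker s s'"
    and vtensor_ker_scale: "frag_of (s k x, y) - frag_of (x, s' k y) \<in> vtensor_ker s s'"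
    and vtensor_ker_0: "0 \<in> vtensor_ker s s'"
    and vtensor_ker_add: "f \<in> vtensor_ker s s' \<Longrightarrow> g \<in> vtensor_ker s s' \<Longrightarrow> f + g \<in> vtensor_ker s s'"
    and vtensor_ker_diff: "f \<in> vtensor_ker s s' \<Longrightarrow> g \<in> vtensor_ker s s' \<Longrightarrow> f - g \<in> vtensor_ker s s'"
  unfolding vtensor_ker_def
  using tensor_ker_rules(1)[of x UNIV x' y UNIV UNIV "\<lambda>a k. s k a" s']
    tensor_ker_rules(2)[of x UNIV y UNIV y' UNIV "\<lambda>a k. s k a" s']
    tensor_ker_rules(3)[of x UNIV k UNIV y UNIV "\<lambda>a k. s k a" s']
  by (auto intro: tensor_ker_0 tensor_ker_add tensor_ker_diff)

lemma vtensor_ker_sum: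
  "(\<And>i. i \<in> I \<Longrightarrow> f i \<in> vtensor_ker s s') \<Longrightarrow> (\<Sum>i\<in>I. f i) \<in> vtensor_ker s s'"
  by (induction I rule: infinite_finite_induct) (auto intro: vtensor_ker_0 vtensor_ker_add)

lemma vtensor_ker_zero1:
  shows "frag_of (0 :: 'a::ab_group_add, y) \<in> vtensor_ker s s'"
  using vtensor_ker_diff[OF vtensor_ker_0 vtensor_ker_add1[of 0 0 y s s']] by simp

lemma vtensor_ker_zero2:
  shows "frag_of (x, 0 :: 'a::ab_group_add) \<in> vtensor_ker s s'"
  using vtensor_ker_diff[OF vtensor_ker_0 vtensor_ker_add2[of x 0 0 s s']] by simp

lemma vtensor_ker_diff2:
  fixes x :: "'a::ab_group_add" and y :: "'b::ab_group_add"
  shows "frag_of (x, y) - frag_of (x, y') - frag_of (x, y - y') \<in> vtensor_ker s s'"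
  using vtensor_ker_add2[of x "y - y'" y' s s'] by (simp add: algebra_simps)

lemma vtensor_ker_sum1:
  fixes f :: "'i \<Rightarrow> 'a::ab_group_add" and y :: "'b::ab_group_add"
  assumes "finite I"
  shows "frag_of (\<Sum>i\<in>I. f i, y) - (\<Sum>i\<in>I. frag_of (f i, y)) \<in> vtensor_ker s s'"
  using assms
proof (induction I rule: finite_induct)
  case empty
  show ?case using vtensor_ker_zero1 by simp
next
  case (insert i I)
  have "(frag_of (f i + sum f I, y) - frag_of (f i, y) - frag_of (sum f I, y)) +
      (frag_of (sum f I, y) - (\<Sum>i\<in>I. frag_of (f i, y))) \<in> vtensor_ker s s'"
    by (intro vtensor_ker_add vtensor_ker_add1 insert.IH)
  then show ?case using insert.hyps by (simp add: algebra_simps)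
qed

text \<open>The scalar extension occurring in \<open>splitting\<close>, computed on
  representatives.\<close>

definition extend_scalars ::
  "nat \<Rightarrow> ('a::ring_1 \<Rightarrow> 'k::field alg_closure mat) \<Rightarrow> ('a \<times> 'k alg_closure \<Rightarrow>\<^sub>0 int) \<Rightarrow> 'k alg_closure mat" where
  "extend_scalars n \<phi> f = mat n n (\<lambda>(i, j). frag_eval (\<lambda>(a, l). l * \<phi> a $$ (i, j)) f)"

lemma extend_scalars_coset:
  assumes "\<And>x. \<phi> x \<in> carrier_mat n n" "\<And>x y. \<phi> (x + y) = \<phi> x + \<phi> y"
    "\<And>k x. \<phi> (s k x) = to_ac k \<cdot>\<^sub>m \<phi> x"
  shows "f \<in> vtensor_ker s ac_scale \<Longrightarrow> extend_scalars n \<phi> f = 0\<^sub>m n n"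
    and "mat n n (\<lambda>(i, j). tensor_lift (\<lambda>(a, l). l * \<phi> a $$ (i, j)) (f +o vtensor_ker s ac_scale)) =
      extend_scalars n \<phi> f"
proof -
  have dim: "dim_row (\<phi> x) = n" "dim_col (\<phi> x) = n" for x using assms(1)[of x] by auto
  have vanish: "frag_eval (\<lambda>(a, l). l * \<phi> a $$ (i, j)) f = 0"
    if "f \<in> vtensor_ker s ac_scale" "i < n" "j < n" for f i j
    using that(1) unfolding vtensor_ker_def
    by (rule tensor_ker_vanish) (use that in \<open>auto simp: assms(2,3) dim algebra_simps\<close>)
  show "f \<in> vtensor_ker s ac_scale \<Longrightarrow> extend_scalars n \<phi> f = 0\<^sub>m n n"
    by (rule eq_matI) (auto simp: extend_scalars_def vanish)
  show "mat n n (\<lambda>(i, j). tensor_lift (\<lambda>(a, l). l * \<phi> a $$ (i, j)) (f +o vtensor_ker s ac_scale)) =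
      extend_scalars n \<phi> f"
  proof (rule eq_matI)
    fix i j assume "i < dim_row (extend_scalars n \<phi> f)" "j < dim_col (extend_scalars n \<phi> f)"
    then have ij: "i < n" "j < n" by (auto simp: extend_scalars_def)
    have "tensor_lift (\<lambda>(a, l). l * \<phi> a $$ (i, j)) (f +o vtensor_ker s ac_scale) =
        frag_eval (\<lambda>(a, l). l * \<phi> a $$ (i, j)) f"
      unfolding vtensor_ker_def
      by (rule tensor_lift_tensor_coset) (rule vanish[OF _ ij], simp add: vtensor_ker_def)
    then show "mat n n (\<lambda>(i, j). tensor_lift (\<lambda>(a, l). l * \<phi> a $$ (i, j)) (f +o vtensor_ker s ac_scale)) $$ (i, j) =
        extend_scalars n \<phi> f $$ (i, j)"
      using ij by (simp add: extend_scalars_def)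
  qed (auto simp: extend_scalars_def)
qed

context azumaya
begin

text \<open>Modulo the relations, \<open>d\<close> is a sum of e_j \<otimes> l_j, so the matrices
  \<phi>(e_j) must be shown to be independent over the algebraic closure. Each coordinate function
  of \<open>A\<close> is a sandwich up to the factor 1, and \<phi> carries that sandwich to an
  operation on matrices which extracts the coefficient l_k from a linear relation.\<close>

lemma extend_scalars_inj:
  assumes \<phi>: "irrep s n \<phi>" and 0: "extend_scalars n \<phi> d = 0\<^sub>m n n"
  shows "d \<in> vtensor_ker s ac_scale"
proof -
  obtain m e and co :: "nat \<Rightarrow> 'a \<Rightarrow> 'k" where e: "\<And>x. (\<Sum>i<m. s (co i x) (e i)) = x"
    "\<And>i x y. co i (x + y) = co i x + co i y" "\<And>i k x. co i (s k x) = k * co i x"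
    "\<And>i j. i < m \<Longrightarrow> j < m \<Longrightarrow> co i (e j) = (if i = j then 1 else 0)"
    by (rule coordinates_exist) blast
  define ev where "ev = (\<lambda>j. frag_eval (\<lambda>(a, l). to_ac (co j a) * l))"
  have normal: "d - (\<Sum>j<m. frag_of (e j, ev j d)) \<in> vtensor_ker s ac_scale" for d
  proof (rule frag_induction[where S = UNIV and c = d])
    show "0 - (\<Sum>j<m. frag_of (e j, ev j 0)) \<in> vtensor_ker s ac_scale"
      by (intro vtensor_ker_diff vtensor_ker_0 vtensor_ker_sum) (simp add: ev_def vtensor_ker_zero2)
  next
    fix p :: "'a \<times> 'k alg_closure"
    obtain a l where p: "p = (a, l)" by fastforce
    have "(frag_of (\<Sum>j<m. s (co j a) (e j), l) - (\<Sum>j<m. frag_of (s (co j a) (e j), l))) +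
        (\<Sum>j<m. frag_of (s (co j a) (e j), l) - frag_of (e j, to_ac (co j a) * l)) \<in> vtensor_ker s ac_scale"
      by (intro vtensor_ker_add vtensor_ker_sum1 vtensor_ker_sum vtensor_ker_scale) simp
    then show "frag_of p - (\<Sum>j<m. frag_of (e j, ev j (frag_of p))) \<in> vtensor_ker s ac_scale"
      by (simp add: p ev_def e(1) sum_subtractf)
  next
    fix d d' :: "'a \<times> 'k alg_closure \<Rightarrow>\<^sub>0 int"
    assume d: "d - (\<Sum>j<m. frag_of (e j, ev j d)) \<in> vtensor_ker s ac_scale"
      and d': "d' - (\<Sum>j<m. frag_of (e j, ev j d')) \<in> vtensor_ker s ac_scale"
    have "(d - (\<Sum>j<m. frag_of (e j, ev j d))) - (d' - (\<Sum>j<m. frag_of (e j, ev j d'))) +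
        (\<Sum>j<m. frag_of (e j, ev j d) - frag_of (e j, ev j d') - frag_of (e j, ev j d - ev j d'))
        \<in> vtensor_ker s ac_scale"
      by (intro vtensor_ker_add vtensor_ker_diff d d' vtensor_ker_sum vtensor_ker_diff2)
    then show "d - d' - (\<Sum>j<m. frag_of (e j, ev j (d - d'))) \<in> vtensor_ker s ac_scale"
      by (simp add: ev_def frag_eval_diff sum_subtractf)
  qed simp
  have lin: "(\<Sum>j<m. ev j d * \<phi> (e j) $$ (p, q)) = 0" if pq: "p < n" "q < n" for p q
  proof -
    have "frag_eval (\<lambda>(a, l). l * \<phi> a $$ (p, q)) (d - (\<Sum>j<m. frag_of (e j, ev j d))) = 0"
      using normal[of d] unfolding vtensor_ker_def
      by (rule tensor_ker_vanish)
        (use pq in \<open>auto simp: irrep_add_index[OF \<phi>] irrep_scale_index[OF \<phi>] algebra_simps\<close>)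
    moreover have "frag_eval (\<lambda>(a, l). l * \<phi> a $$ (p, q)) d = 0"
      using arg_cong[OF 0, of "\<lambda>A. A $$ (p, q)"] pq by (simp add: extend_scalars_def)
    ultimately show ?thesis by (simp add: frag_eval_diff frag_eval_of_sum)
  qed
  have "ev k d = 0" if k: "k < m" for k
  proof -
    \<comment> \<open>The tensor whose sandwich is the coordinate function \<open>co k\<close>; it
      sends e_j to 1 if j = k and to 0 otherwise.\<close>
    obtain g where g: "\<And>x. sandwich_frag g x = s (co k x) 1"
      using sandwich_surj[of "\<lambda>x. s (co k x) 1"] by (auto simp: e scale_left_distrib)
    note n0 = irrep_pos[OF \<phi>]
    have "ev k d = (\<Sum>j<m. if j = k then ev j d else 0)" using k by simp
    also have "\<dots> = (\<Sum>j<m. ev j d * \<phi> (sandwich_frag g (e j)) $$ (0, 0))"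
      unfolding g using n0 k
      by (intro sum.cong) (auto simp: irrep_scale_index[OF \<phi>] irrep_one_index[OF \<phi>] e(4))
    also have "\<dots> = (\<Sum>j<m. ev j d * frag_eval (\<lambda>(a, b). \<Sum>q<n. \<Sum>r<n. \<phi> a $$ (0, q) * \<phi> (e j) $$ (q, r) * \<phi> b $$ (r, 0)) g)"
    proof (rule sum.cong[OF refl])
      fix j
      have "\<phi> (sandwich_frag g (e j)) $$ (0, 0) =
          frag_eval (\<lambda>(a, b). \<Sum>q<n. \<Sum>r<n. \<phi> a $$ (0, q) * \<phi> (e j) $$ (q, r) * \<phi> b $$ (r, 0)) g"
        unfolding irrep_frag_eval_index[OF \<phi> n0 n0]
        by (rule frag_eval_cong)
          (use n0 in \<open>auto simp: mult.assoc irrep_mult_index[OF \<phi>] sum_distrib_left sum_distrib_right\<close>)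
      then show "ev j d * \<phi> (sandwich_frag g (e j)) $$ (0, 0) =
          ev j d * frag_eval (\<lambda>(a, b). \<Sum>q<n. \<Sum>r<n. \<phi> a $$ (0, q) * \<phi> (e j) $$ (q, r) * \<phi> b $$ (r, 0)) g"
        by simp
    qed
    also have "\<dots> = frag_eval (\<lambda>(a, b). \<Sum>j<m. \<Sum>q<n. \<Sum>r<n. \<phi> a $$ (0, q) * \<phi> b $$ (r, 0) * (ev j d * \<phi> (e j) $$ (q, r))) g"
      unfolding frag_eval_mult_left[symmetric] frag_eval_sum[symmetric]
      by (rule frag_eval_cong) (auto simp: sum_distrib_left mult_ac)
    also have "\<dots> = frag_eval (\<lambda>(a, b). 0) g"
    proof (rule frag_eval_cong, clarify)
      fix a b
      have "(\<Sum>j<m. \<Sum>q<n. \<Sum>r<n. \<phi> a $$ (0, q) * \<phi> b $$ (r, 0) * (ev j d * \<phi> (e j) $$ (q, r))) =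
          (\<Sum>q<n. \<Sum>r<n. \<Sum>j<m. \<phi> a $$ (0, q) * \<phi> b $$ (r, 0) * (ev j d * \<phi> (e j) $$ (q, r)))"
        by (subst sum.swap, rule sum.cong[OF refl], rule sum.swap)
      also have "\<dots> = 0"
        by (simp add: sum_distrib_left[symmetric] lin)
      finally show "(\<Sum>j<m. \<Sum>q<n. \<Sum>r<n. \<phi> a $$ (0, q) * \<phi> b $$ (r, 0) * (ev j d * \<phi> (e j) $$ (q, r))) = 0" .
    qed
    finally show ?thesis by (simp add: frag_eval_def case_prod_unfold)
  qed
  then have "(\<Sum>j<m. frag_of (e j, ev j d)) \<in> vtensor_ker s ac_scale"
    by (intro vtensor_ker_sum) (simp add: vtensor_ker_zero2)
  from vtensor_ker_add[OF normal[of d] this] show ?thesis by simp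
qed

text \<open>By surjectivity of the scalar extension, a matrix commuting with the image of \<phi>
  commutes with all matrices and so is scalar. Injectivity excludes n = 0, because 1 \<otimes> 1 is
  nonzero.\<close>

lemma splitting_imp_irrep:
  assumes "splitting s n \<phi>"
  shows "irrep s n \<phi>"
proof -
  have \<phi>: "\<And>x. \<phi> x \<in> carrier_mat n n" "\<phi> 1 = 1\<^sub>m n" "\<And>x y. \<phi> (x * y) = \<phi> x * \<phi> y"
    "\<And>x y. \<phi> (x + y) = \<phi> x + \<phi> y" "\<And>k x. \<phi> (s k x) = to_ac k \<cdot>\<^sub>m \<phi> x"
    and bij: "bij_betw (\<lambda>z. mat n n (\<lambda>(i, j). tensor_lift (\<lambda>(a, l). l * \<phi> a $$ (i, j)) z))
      (vtensor s ac_scale) (carrier_mat n n)"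
    using assms by (auto simp: splitting_def)
  note coset = extend_scalars_coset[of \<phi> n s, OF \<phi>(1,4,5)]
  have surj: "\<exists>f. extend_scalars n \<phi> f = Y" if "Y \<in> carrier_mat n n" for Y
  proof -
    have "Y \<in> (\<lambda>z. mat n n (\<lambda>(i, j). tensor_lift (\<lambda>(a, l). l * \<phi> a $$ (i, j)) z)) ` vtensor s ac_scale"
      using bij that by (simp add: bij_betw_def)
    then show ?thesis unfolding vtensor_eq_range using coset(2) by auto
  qed
  have inj: "f \<in> vtensor_ker s ac_scale" if "extend_scalars n \<phi> f = 0\<^sub>m n n" for f
  proof -
    have "extend_scalars n \<phi> f = extend_scalars n \<phi> 0"
      unfolding that by (rule eq_matI) (auto simp: extend_scalars_def)
    then have "mat n n (\<lambda>(i, j). tensor_lift (\<lambda>(a, l). l * \<phi> a $$ (i, j)) (f +o vtensor_ker s ac_scale)) =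
        mat n n (\<lambda>(i, j). tensor_lift (\<lambda>(a, l). l * \<phi> a $$ (i, j)) (0 +o vtensor_ker s ac_scale))"
      unfolding coset(2) .
    then have "f +o vtensor_ker s ac_scale = 0 +o vtensor_ker s ac_scale"
      by (rule inj_onD[OF bij_betw_imp_inj_on[OF bij]]) (unfold vtensor_eq_range, blast+)
    then show ?thesis using vtensor_coset_eq_iff[of f s ac_scale 0] by simp
  qed
  have n0: "n > 0"
  proof (rule ccontr)
    assume "\<not> n > 0"
    then have "extend_scalars n \<phi> (frag_of (1, 1)) = 0\<^sub>m n n"
      by (intro eq_matI) (auto simp: extend_scalars_def)
    then have 1: "frag_of (1, 1) \<in> vtensor_ker s ac_scale" by (rule inj)
    obtain \<theta> :: "'a \<Rightarrow> 'k" where \<theta>: "\<And>x y. \<theta> (x + y) = \<theta> x + \<theta> y"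
      "\<And>k x. \<theta> (s k x) = k * \<theta> x" "\<theta> 1 = 1"
      by (rule functional_exists[of 1]) auto
    have "frag_eval (\<lambda>(a, l). to_ac (\<theta> a) * l) (frag_of (1, 1)) = 0"
      using 1 unfolding vtensor_ker_def
      by (rule tensor_ker_vanish) (auto simp: \<theta> algebra_simps)
    then show False by (simp add: \<theta>)
  qed
  have "\<exists>t. C = t \<cdot>\<^sub>m 1\<^sub>m n" if C: "C \<in> carrier_mat n n" and comm: "\<forall>x. C * \<phi> x = \<phi> x * C" for C
  proof -
    have comm': "C * Y = Y * C" if Y: "Y \<in> carrier_mat n n" for Y
    proof (rule eq_matI)
      fix i j assume "i < dim_row (Y * C)" "j < dim_col (Y * C)"
      then have ij: "i < n" "j < n" using Y C by auto
      obtain f where f: "Y = extend_scalars n \<phi> f" using surj[OF Y] by blast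
      have Y_index: "Y $$ (p, q) = frag_eval (\<lambda>(a, l). l * \<phi> a $$ (p, q)) f" if "p < n" "q < n" for p q
        using that by (simp add: f extend_scalars_def)
      have "(C * Y) $$ (i, j) = (\<Sum>k<n. C $$ (i, k) * frag_eval (\<lambda>(a, l). l * \<phi> a $$ (k, j)) f)"
        unfolding mult_mat_index[OF C Y ij] using ij by (simp add: Y_index)
      also have "\<dots> = frag_eval (\<lambda>(a, l). l * (C * \<phi> a) $$ (i, j)) f"
        unfolding frag_eval_mult_left[symmetric] frag_eval_sum[symmetric]
        by (rule frag_eval_cong) (auto simp: mult_mat_index[OF C \<phi>(1) ij] sum_distrib_left mult_ac)
      also have "\<dots> = (\<Sum>k<n. frag_eval (\<lambda>(a, l). l * \<phi> a $$ (i, k)) f * C $$ (k, j))"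
        unfolding comm[rule_format] frag_eval_mult_right[symmetric] frag_eval_sum[symmetric]
        by (rule frag_eval_cong) (auto simp: mult_mat_index[OF \<phi>(1) C ij] sum_distrib_left mult_ac)
      also have "\<dots> = (Y * C) $$ (i, j)"
        unfolding mult_mat_index[OF Y C ij] using ij by (simp add: Y_index)
      finally show "(C * Y) $$ (i, j) = (Y * C) $$ (i, j)" .
    qed (use Y C in auto)
    have "C = C $$ (0, 0) \<cdot>\<^sub>m 1\<^sub>m n"
    proof (rule eq_matI)
      fix i j assume "i < dim_row (C $$ (0, 0) \<cdot>\<^sub>m 1\<^sub>m n)" "j < dim_col (C $$ (0, 0) \<cdot>\<^sub>m 1\<^sub>m n)"
      then have ij: "i < n" "j < n" by auto
      \<comment> \<open>The matrix unit at (j, 0). Comparing the entries at (i, 0) of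
        \<open>C * ?E\<close> and \<open>?E * C\<close> gives C_ij on one side, and C_00 if i = j
        and 0 otherwise on the other.\<close>
      let ?E = "mat n n (\<lambda>(p, q). if p = j \<and> q = 0 then 1 else 0)"
      have E: "?E \<in> carrier_mat n n" by simp
      have "(C * ?E) $$ (i, 0) = (\<Sum>k<n. if k = j then C $$ (i, k) else 0)"
        unfolding mult_mat_index[OF C E ij(1) n0] by (rule sum.cong) (use n0 in auto)
      moreover have "(?E * C) $$ (i, 0) = (\<Sum>k<n. if k = 0 then (if i = j then C $$ (0, 0) else 0) else 0)"
        unfolding mult_mat_index[OF E C ij(1) n0] by (rule sum.cong) (use n0 ij in auto)
      ultimately show "C $$ (i, j) = (C $$ (0, 0) \<cdot>\<^sub>m 1\<^sub>m n) $$ (i, j)"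
        using comm'[OF E] ij n0 by (auto split: if_splits)
    qed (use C in auto)
    then show ?thesis by blast
  qed
  then show ?thesis unfolding irrep_def using \<phi> n0 by blast
qed

end

text \<open>Only surjectivity remains after \<open>extend_scalars_inj\<close>. It follows from the
  shape of \<open>g\<close>: contracting its first factor against suitable coefficients leaves any
  prescribed matrix in the second.\<close>

lemma (in azumaya_trace) irrep_imp_splitting:
  assumes \<phi>: "irrep s n \<phi>"
  shows "splitting s n \<phi>"
proof -
  note coset = extend_scalars_coset[of \<phi> n s, OF irrep_carrier[OF \<phi>] irrep_add[OF \<phi>] irrep_scale[OF \<phi>]]
  obtain t where t: "\<And>p q r u. p < n \<Longrightarrow> q < n \<Longrightarrow> r < n \<Longrightarrow> u < n \<Longrightarrow>
      coeff_tensor g \<phi> \<phi> p q r u = (if p = u \<and> q = r then t else 0)" "t \<noteq> 0"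
    by (rule coeff_tensor_self[OF \<phi>]) blast
  let ?\<Phi> = "\<lambda>z. mat n n (\<lambda>(i, j). tensor_lift (\<lambda>(a, l). l * \<phi> a $$ (i, j)) z)"
  have "bij_betw ?\<Phi> (vtensor s ac_scale) (carrier_mat n n)"
    unfolding bij_betw_def
  proof
    show "inj_on ?\<Phi> (vtensor s ac_scale)"
    proof (rule inj_onI)
      fix y z assume "y \<in> vtensor s ac_scale" "z \<in> vtensor s ac_scale" and eq: "?\<Phi> y = ?\<Phi> z"
      then obtain f f' where yz: "y = f +o vtensor_ker s ac_scale" "z = f' +o vtensor_ker s ac_scale"
        unfolding vtensor_eq_range by auto
      have eq': "extend_scalars n \<phi> f = extend_scalars n \<phi> f'" using eq unfolding yz coset(2) .
      have "extend_scalars n \<phi> (f - f') = 0\<^sub>m n n"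
      proof (rule eq_matI)
        fix i j assume "i < dim_row (0\<^sub>m n n :: 'k alg_closure mat)" "j < dim_col (0\<^sub>m n n :: 'k alg_closure mat)"
        then show "extend_scalars n \<phi> (f - f') $$ (i, j) = 0\<^sub>m n n $$ (i, j)"
          using arg_cong[OF eq', of "\<lambda>A. A $$ (i, j)"] by (simp add: extend_scalars_def frag_eval_diff)
      qed (auto simp: extend_scalars_def)
      then have "f - f' \<in> vtensor_ker s ac_scale" by (rule extend_scalars_inj[OF \<phi>])
      then show "y = z" by (simp add: yz vtensor_coset_eq_iff)
    qed
    show "?\<Phi> ` vtensor s ac_scale = carrier_mat n n"
    proof
      show "carrier_mat n n \<subseteq> ?\<Phi> ` vtensor s ac_scale"
      proof
        fix Y :: "'k alg_closure mat" assume Y: "Y \<in> carrier_mat n n"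
        \<comment> \<open>With \<open>g\<close> acting as t times the sum of E_pq \<otimes> E_qp,
          the weight Y_qp / t at the entry (p, q) of the first factor produces Y_qp E_qp in the
          second. The transposed indices come from the interchange.\<close>
        define f where "f = (\<Sum>p<n. \<Sum>q<n. frag_extend (\<lambda>(a, b). frag_of (b, Y $$ (q, p) / t * \<phi> a $$ (p, q))) g)"
        have "extend_scalars n \<phi> f = Y"
        proof (rule eq_matI)
          fix i j assume "i < dim_row Y" "j < dim_col Y"
          then have ij: "i < n" "j < n" using Y by auto
          have "extend_scalars n \<phi> f $$ (i, j) = (\<Sum>p<n. \<Sum>q<n. Y $$ (q, p) / t * coeff_tensor g \<phi> \<phi> p q i j)"
            using ij
            by (simp add: extend_scalars_def f_def frag_eval_of_sum frag_eval_extend case_prod_unfold coeff_tensor_def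
                frag_eval_mult_left[symmetric] mult.assoc)
          also have "\<dots> = (\<Sum>p<n. \<Sum>q<n. if q = i then (if p = j then Y $$ (q, p) else 0) else 0)"
            using ij t(2) by (intro sum.cong) (auto simp: t(1))
          also have "\<dots> = Y $$ (i, j)" using ij by simp
          finally show "extend_scalars n \<phi> f $$ (i, j) = Y $$ (i, j)" .
        qed (use Y in \<open>auto simp: extend_scalars_def\<close>)
        then have "Y = ?\<Phi> (f +o vtensor_ker s ac_scale)" unfolding coset(2) ..
        then show "Y \<in> ?\<Phi> ` vtensor s ac_scale" unfolding vtensor_eq_range by blast
      qed
    qed auto
  qed
  then show ?thesis
    unfolding splitting_def
    using irrep_carrier[OF \<phi>] irrep_one[OF \<phi>] irrep_mult[OF \<phi>] irrep_add[OF \<phi>] irrep_scale[OF \<phi>]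
    by blast
qed


section \<open>Involutions and their adjoint bilinear forms\<close>

context azumaya
begin

lemma azumaya_trace_exists: "\<exists>\<tau> g. azumaya_trace s \<tau> g"
proof -
  obtain \<tau> :: "'a \<Rightarrow> 'k" and z where \<tau>: "\<And>x y. \<tau> (x + y) = \<tau> x + \<tau> y"
    "\<And>k x. \<tau> (s k x) = k * \<tau> x" "\<And>x y. \<tau> (x * y) = \<tau> (y * x)" "\<tau> z \<noteq> 0"
    by (rule trace_functional_exists) blast
  obtain g where g: "\<And>x. sandwich_frag g x = s (\<tau> x) 1"
    using sandwich_surj[of "\<lambda>x. s (\<tau> x) 1"] by (auto simp: \<tau> scale_left_distrib)
  have "azumaya_trace s \<tau> g"
    by unfold_locales (use \<tau> g in blast)+
  then show ?thesis by blast
qed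

text \<open>Faithfulness: some sandwich takes the nonzero element x - y to 1. If \<phi> killed x -
  y, it would kill that sandwich, but \<phi>(1) is the identity matrix of positive size.\<close>

lemma irrep_eqI:
  assumes \<phi>: "irrep s n \<phi>" and eq: "\<And>i j. i < n \<Longrightarrow> j < n \<Longrightarrow> \<phi> x $$ (i, j) = \<phi> y $$ (i, j)"
  shows "x = y"
proof (rule ccontr)
  assume "x \<noteq> y"
  then have "x - y \<noteq> 0" by simp
  then obtain \<theta> :: "'a \<Rightarrow> 'k" where \<theta>: "\<And>x y. \<theta> (x + y) = \<theta> x + \<theta> y"
    "\<And>k x. \<theta> (s k x) = k * \<theta> x" "\<theta> (x - y) = 1"
    by (rule functional_exists) blast
  obtain g where g: "\<And>x. sandwich_frag g x = s (\<theta> x) 1"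
    using sandwich_surj[of "\<lambda>x. s (\<theta> x) 1"] by (auto simp: \<theta> scale_left_distrib)
  have 0: "\<phi> (x - y) $$ (i, j) = 0" if "i < n" "j < n" for i j
    using irrep_add_index[OF \<phi> that, of "x - y" y] eq[OF that] by simp
  note n0 = irrep_pos[OF \<phi>]
  have "(1 :: 'k alg_closure) = \<phi> (sandwich_frag g (x - y)) $$ (0, 0)"
    unfolding g by (simp add: \<theta> irrep_one_index[OF \<phi> n0 n0])
  also have "\<dots> = frag_eval (\<lambda>p. 0) g"
    unfolding irrep_frag_eval_index[OF \<phi> n0 n0]
    by (rule frag_eval_cong) (use n0 in \<open>auto simp: irrep_mult_index[OF \<phi>] 0\<close>)
  finally show False by (simp add: frag_eval_def)
qed

end

locale azumaya_involution = azumaya s for s :: "'k::field \<Rightarrow> 'a::ring_1 \<Rightarrow> 'a" +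
  fixes \<sigma> :: "'a \<Rightarrow> 'a"
  assumes involution: "involution_first_kind s \<sigma>"
begin

lemma \<sigma>_add: "\<sigma> (x + y) = \<sigma> x + \<sigma> y"
  and \<sigma>_scale: "\<sigma> (s k x) = s k (\<sigma> x)"
  and \<sigma>_mult: "\<sigma> (x * y) = \<sigma> y * \<sigma> x"
  and \<sigma>_\<sigma> [simp]: "\<sigma> (\<sigma> x) = x"
proof -
  have "Vector_Spaces.linear s s \<sigma>" using involution by (simp add: involution_first_kind_def)
  then interpret l: Vector_Spaces.linear s s \<sigma> .
  show "\<sigma> (x + y) = \<sigma> x + \<sigma> y" "\<sigma> (s k x) = s k (\<sigma> x)"
    by (rule l.add l.scale)+
  show "\<sigma> (x * y) = \<sigma> y * \<sigma> x" "\<sigma> (\<sigma> x) = x"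
    using involution by (simp_all add: involution_first_kind_def)
qed

lemma \<sigma>_one [simp]: "\<sigma> 1 = 1"
  by (metis \<sigma>_\<sigma> \<sigma>_mult mult.left_neutral mult.right_neutral)

lemma \<sigma>_zero [simp]: "\<sigma> 0 = 0"
  using \<sigma>_add[of 0 0] by simp

lemma \<sigma>_minus: "\<sigma> (- x) = - \<sigma> x"
  using \<sigma>_add[of x "- x"] by (simp add: eq_neg_iff_add_eq_0 add.commute)

lemma \<sigma>_diff: "\<sigma> (x - y) = \<sigma> x - \<sigma> y"
  using \<sigma>_add[of x "- y"] by (simp add: \<sigma>_minus)

text \<open>Both \<sigma> and transposition reverse products, so their combination preserves them,
  and transposition identifies the commutants. Comparing this representation with \<phi> yields the
  adjoint form; comparing traces yields the invariance of \<open>Trd\<close> under \<sigma>.\<close>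

lemma irrep_transpose:
  assumes \<phi>: "irrep s n \<phi>"
  shows "irrep s n (\<lambda>x. transpose_mat (\<phi> (\<sigma> x)))"
proof -
  note car = irrep_carrier[OF \<phi>]
  have "\<exists>t. C = t \<cdot>\<^sub>m 1\<^sub>m n"
    if C: "C \<in> carrier_mat n n" and comm: "\<And>x. C * transpose_mat (\<phi> (\<sigma> x)) = transpose_mat (\<phi> (\<sigma> x)) * C" for C
  proof -
    have "\<exists>t. transpose_mat C = t \<cdot>\<^sub>m 1\<^sub>m n"
    proof (rule irrep_schur[OF \<phi>])
      fix x
      have "transpose_mat (C * transpose_mat (\<phi> x)) = transpose_mat (transpose_mat (\<phi> x) * C)"
        using comm[of "\<sigma> x"] by simp
      moreover have "transpose_mat (C * transpose_mat (\<phi> x)) = \<phi> x * transpose_mat C"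
        using transpose_mult[OF C, of "transpose_mat (\<phi> x)" n] car[of x] by simp
      moreover have "transpose_mat (transpose_mat (\<phi> x) * C) = transpose_mat C * \<phi> x"
        using transpose_mult[of "transpose_mat (\<phi> x)" n n C n] C car[of x] by simp
      ultimately show "transpose_mat C * \<phi> x = \<phi> x * transpose_mat C" by simp
    qed (use C in simp)
    then obtain t where t: "transpose_mat C = t \<cdot>\<^sub>m 1\<^sub>m n" by blast
    have "C = transpose_mat (t \<cdot>\<^sub>m 1\<^sub>m n)" unfolding t[symmetric] by simp
    also have "\<dots> = t \<cdot>\<^sub>m 1\<^sub>m n" by (rule eq_matI) auto
    finally show ?thesis by blast
  qed
  moreover have "transpose_mat (\<phi> (\<sigma> (x * y))) = transpose_mat (\<phi> (\<sigma> x)) * transpose_mat (\<phi> (\<sigma> y))" for x y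
    by (simp add: \<sigma>_mult irrep_mult[OF \<phi>] transpose_mult[OF car car])
  moreover have "transpose_mat (\<phi> (\<sigma> (x + y))) = transpose_mat (\<phi> (\<sigma> x)) + transpose_mat (\<phi> (\<sigma> y))" for x y
    by (rule eq_matI) (auto simp: \<sigma>_add irrep_add[OF \<phi>] irrep_dim[OF \<phi>])
  moreover have "transpose_mat (\<phi> (\<sigma> (s k x))) = to_ac k \<cdot>\<^sub>m transpose_mat (\<phi> (\<sigma> x))" for k x
    by (rule eq_matI) (auto simp: \<sigma>_scale irrep_scale[OF \<phi>] irrep_dim[OF \<phi>])
  moreover have "transpose_mat (\<phi> (\<sigma> 1)) = 1\<^sub>m n"
    by (simp add: irrep_one[OF \<phi>])
  moreover have "transpose_mat (\<phi> (\<sigma> x)) \<in> carrier_mat n n" for x using car[of "\<sigma> x"] by simp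
  ultimately show ?thesis unfolding irrep_def using irrep_pos[OF \<phi>] by blast
qed

lemma balanced_twisted: "balanced s (\<lambda>(a, b). a * x * \<sigma> b)"
  by (simp add: balanced_def algebra_simps scale_mult \<sigma>_add \<sigma>_scale)

end

locale trace_involution = azumaya_trace s \<tau> g + azumaya_involution s \<sigma>
  for s :: "'k::field \<Rightarrow> 'a::ring_1 \<Rightarrow> 'a" and \<tau> g \<sigma>
begin

text \<open>Writing F(x) for the action of \<open>g\<close> on x, the outer and inner relations
  become y F(x) = F(x \<sigma>(y)) and F(y x) = F(x) \<sigma>(y). Hence F(1) is central, thus a
  scalar c, and F(x) = F(1) \<sigma>(x).\<close>

lemma twisted_action_multiple:
  "\<exists>c. \<forall>x. frag_eval (\<lambda>(a, b). a * x * \<sigma> b) g = s c (\<sigma> x)"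
proof -
  define F where "F = (\<lambda>x. frag_eval (\<lambda>(a, b). a * x * \<sigma> b) g)"
  have left: "y * F x = F (x * \<sigma> y)" for x y
  proof -
    have "y * F x = frag_eval (\<lambda>(a, b). (y * a) * x * \<sigma> b) g"
      unfolding F_def frag_eval_mult_left[symmetric] by (rule frag_eval_cong) (auto simp: mult.assoc)
    also have "\<dots> = frag_eval (\<lambda>(a, b). a * x * \<sigma> (b * y)) g"
      using intertwine_outer[OF balanced_twisted, of x y] by simp
    also have "\<dots> = F (x * \<sigma> y)" by (simp add: F_def \<sigma>_mult mult.assoc)
    finally show ?thesis .
  qed
  have right: "F (y * x) = F x * \<sigma> y" for x y
  proof -
    have "F (y * x) = frag_eval (\<lambda>(a, b). (a * y) * x * \<sigma> b) g" by (simp add: F_def mult.assoc)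
    also have "\<dots> = frag_eval (\<lambda>(a, b). a * x * \<sigma> (y * b)) g"
      using intertwine_inner[OF balanced_twisted, of x y] by simp
    also have "\<dots> = F x * \<sigma> y"
      unfolding F_def frag_eval_mult_right[symmetric]
      by (rule frag_eval_cong) (auto simp: \<sigma>_mult mult.assoc)
    finally show ?thesis .
  qed
  have "F 1 * x = x * F 1" for x
    using left[of x 1] right[of "\<sigma> x" 1] by simp
  then obtain c where "F 1 = s c 1" by (rule central_imp_scalar)
  then have "F x = s c (\<sigma> x)" for x
    using right[of x 1] by (simp add: scale_mult)
  then show ?thesis unfolding F_def by blast
qed

text \<open>The form is the Skolem--Noether intertwiner \<open>P\<close> between \<phi> and x
  \<mapsto> \<phi>(\<sigma>(x)) transposed; replacing x by \<sigma>(x) turns intertwining into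
  adjunction.\<close>

lemma adjoint_exists:
  assumes \<phi>: "irrep s n \<phi>"
  shows "\<exists>G. adjoint_to s \<sigma> n \<phi> G"
proof -
  obtain P Q c where PQ: "P \<in> carrier_mat n n" "Q \<in> carrier_mat n n" "c \<noteq> 0"
    "\<And>x. transpose_mat (\<phi> (\<sigma> x)) * P = P * \<phi> x" "P * Q = c \<cdot>\<^sub>m 1\<^sub>m n" "Q * P = c \<cdot>\<^sub>m 1\<^sub>m n"
    by (rule skolem_noether[OF \<phi> irrep_transpose[OF \<phi>]]) blast
  let ?R = "inverse c \<cdot>\<^sub>m Q"
  have c1: "inverse c \<cdot>\<^sub>m (c \<cdot>\<^sub>m 1\<^sub>m n) = 1\<^sub>m n" using PQ(3) by (intro eq_matI) auto
  have "P * ?R = 1\<^sub>m n" "?R * P = 1\<^sub>m n"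
    unfolding mult_smult_distrib[OF PQ(1,2)] mult_smult_assoc_mat[OF PQ(2,1)] PQ(5,6) by (rule c1)+
  then have "invertible_mat P"
    using PQ(1,2) unfolding invertible_mat_def inverts_mat_def by auto
  moreover have "transpose_mat (\<phi> x) * P = P * \<phi> (\<sigma> x)" for x
    using PQ(4)[of "\<sigma> x"] by simp
  ultimately show ?thesis
    unfolding adjoint_to_def using irrep_imp_splitting[OF \<phi>] PQ(1) by blast
qed

text \<open>Adjunction gives \<phi>(\<sigma>(b)) = H \<phi>(b)^T G with H the inverse of G.
  Substituting this in the action of \<open>g\<close> on 1, and t times the interchange for
  \<open>g\<close>, yields t H^T G = c; multiplication by G^T gives the first claim. Using that
  claim twice on a nonzero entry of G gives t^2 = c^2.\<close>

lemma adjoint_sign: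
  assumes "adjoint_to s \<sigma> n \<phi> G"
    and c: "\<And>x. frag_eval (\<lambda>(a, b). a * x * \<sigma> b) g = s c (\<sigma> x)"
    and t: "\<And>x. to_ac (\<tau> x) = t * mtrace (\<phi> x)"
  shows "t \<cdot>\<^sub>m G = to_ac c \<cdot>\<^sub>m transpose_mat G" "t = to_ac c \<or> t = - to_ac c"
    "\<exists>i<n. \<exists>j<n. G $$ (i, j) \<noteq> 0"
proof -
  have spl: "splitting s n \<phi>" and G: "G \<in> carrier_mat n n" and inv: "invertible_mat G"
    and adj: "\<And>x. transpose_mat (\<phi> x) * G = G * \<phi> (\<sigma> x)"
    using assms(1) by (auto simp: adjoint_to_def)
  have \<phi>: "irrep s n \<phi>" by (rule splitting_imp_irrep[OF spl])
  note car = irrep_carrier[OF \<phi>] and n0 = irrep_pos[OF \<phi>]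
  obtain t' where t': "\<And>p q r u. p < n \<Longrightarrow> q < n \<Longrightarrow> r < n \<Longrightarrow> u < n \<Longrightarrow>
      coeff_tensor g \<phi> \<phi> p q r u = (if p = u \<and> q = r then t' else 0)"
    "\<And>x. to_ac (\<tau> x) = t' * mtrace (\<phi> x)" "t' \<noteq> 0"
    by (rule coeff_tensor_self[OF \<phi>]) blast
  obtain z where z: "\<tau> z \<noteq> 0" using trace_nonzero by blast
  \<comment> \<open>The given constant is only known to satisfy \<tau> = t tr. It is the constant of
    the coefficient formula because tr \<phi>(z) is nonzero for some z.\<close>
  have "t = t'"
  proof -
    have "mtrace (\<phi> z) \<noteq> 0" using z t'(2)[of z] by auto
    moreover have "t * mtrace (\<phi> z) = t' * mtrace (\<phi> z)"
      unfolding t[symmetric] t'(2)[symmetric] ..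
    ultimately show ?thesis by simp
  qed
  obtain H where H: "G * H = 1\<^sub>m n" "H * G = 1\<^sub>m (dim_row H)"
    using inv G unfolding invertible_mat_def inverts_mat_def by auto
  have dimH: "H \<in> carrier_mat n n"
  proof -
    have "dim_col H = n" using arg_cong[OF H(1), of dim_col] by simp
    moreover have "dim_row H = n" using arg_cong[OF H(2), of dim_col] G by simp
    ultimately show ?thesis by auto
  qed
  then have HG: "H * G = 1\<^sub>m n" using H by simp
  have \<phi>\<sigma>: "\<phi> (\<sigma> x) = H * (transpose_mat (\<phi> x) * G)" for x
    using assoc_mult_mat[OF dimH G car, of "\<sigma> x"] car[of "\<sigma> x"] by (simp add: adj HG)
  have HtG: "t \<cdot>\<^sub>m (transpose_mat H * G) = to_ac c \<cdot>\<^sub>m 1\<^sub>m n"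
  proof (rule eq_matI)
    fix p u assume "p < dim_row (to_ac c \<cdot>\<^sub>m 1\<^sub>m n)" "u < dim_col (to_ac c \<cdot>\<^sub>m 1\<^sub>m n)"
    then have pu: "p < n" "u < n" by auto
    have Ht: "transpose_mat H \<in> carrier_mat n n" using dimH by simp
    have "(to_ac c \<cdot>\<^sub>m 1\<^sub>m n) $$ (p, u) = \<phi> (frag_eval (\<lambda>(a, b). a * 1 * \<sigma> b) g) $$ (p, u)"
      unfolding c using pu by (simp add: irrep_scale_index[OF \<phi>] irrep_one_index[OF \<phi>])
    also have "\<dots> = frag_eval (\<lambda>(a, b). \<Sum>q<n. \<Sum>r<n. \<Sum>m<n. \<phi> a $$ (p, q) * \<phi> b $$ (m, r) * (H $$ (q, r) * G $$ (m, u))) g"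
      unfolding irrep_frag_eval_index[OF \<phi> pu]
    proof (rule frag_eval_cong, clarify)
      fix a b
      have tc: "transpose_mat (\<phi> b) \<in> carrier_mat n n" using car[of b] by simp
      have tG: "transpose_mat (\<phi> b) * G \<in> carrier_mat n n" using tc G by simp
      have "\<phi> (a * 1 * \<sigma> b) $$ (p, u) = (\<Sum>q<n. \<phi> a $$ (p, q) * \<phi> (\<sigma> b) $$ (q, u))"
        using pu by (simp add: irrep_mult_index[OF \<phi>])
      also have "\<dots> = (\<Sum>q<n. \<phi> a $$ (p, q) * (\<Sum>r<n. H $$ (q, r) * (\<Sum>m<n. \<phi> b $$ (m, r) * G $$ (m, u))))"
      proof (rule sum.cong[OF refl])
        fix q assume "q \<in> {..<n}"
        then have q: "q < n" by simp
        have "\<phi> (\<sigma> b) $$ (q, u) = (\<Sum>r<n. H $$ (q, r) * (transpose_mat (\<phi> b) * G) $$ (r, u))"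
          unfolding \<phi>\<sigma> by (rule mult_mat_index[OF dimH tG q pu(2)])
        also have "\<dots> = (\<Sum>r<n. H $$ (q, r) * (\<Sum>m<n. \<phi> b $$ (m, r) * G $$ (m, u)))"
          by (rule sum.cong[OF refl]) (use pu in \<open>simp add: mult_mat_index[OF tc G] irrep_dim[OF \<phi>] del: index_mult_mat\<close>)
        finally show "\<phi> a $$ (p, q) * \<phi> (\<sigma> b) $$ (q, u) =
            \<phi> a $$ (p, q) * (\<Sum>r<n. H $$ (q, r) * (\<Sum>m<n. \<phi> b $$ (m, r) * G $$ (m, u)))" by simp
      qed
      also have "\<dots> = (\<Sum>q<n. \<Sum>r<n. \<Sum>m<n. \<phi> a $$ (p, q) * \<phi> b $$ (m, r) * (H $$ (q, r) * G $$ (m, u)))"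
        by (simp add: sum_distrib_left mult_ac)
      finally show "\<phi> (a * 1 * \<sigma> b) $$ (p, u) =
        (\<Sum>q<n. \<Sum>r<n. \<Sum>m<n. \<phi> a $$ (p, q) * \<phi> b $$ (m, r) * (H $$ (q, r) * G $$ (m, u)))" .
    qed
    also have "\<dots> = (\<Sum>q<n. \<Sum>r<n. \<Sum>m<n. coeff_tensor g \<phi> \<phi> p q m r * (H $$ (q, r) * G $$ (m, u)))"
      by (simp add: coeff_tensor_def frag_eval_mult_right[symmetric] frag_eval_sum[symmetric] case_prod_unfold)
    also have "\<dots> = (\<Sum>q<n. \<Sum>r<n. \<Sum>m<n. if m = q then (if r = p then t * (H $$ (q, r) * G $$ (q, u)) else 0) else 0)"
      using pu by (intro sum.cong) (auto simp: t'(1) \<open>t = t'\<close>)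
    also have "\<dots> = (\<Sum>q<n. t * (H $$ (q, p) * G $$ (q, u)))"
      using pu by simp
    also have "\<dots> = t * (transpose_mat H * G) $$ (p, u)"
      unfolding mult_mat_index[OF Ht G pu] sum_distrib_left using pu dimH by (intro sum.cong) auto
    finally show "(t \<cdot>\<^sub>m (transpose_mat H * G)) $$ (p, u) = (to_ac c \<cdot>\<^sub>m 1\<^sub>m n) $$ (p, u)"
      using pu G dimH by simp
  qed (use G dimH in auto)
  have Gt: "transpose_mat G \<in> carrier_mat n n" and Ht: "transpose_mat H \<in> carrier_mat n n"
    using G dimH by auto
  have "transpose_mat G * transpose_mat H = 1\<^sub>m n"
    using transpose_mult[OF dimH G] by (simp add: HG)
  then have "t \<cdot>\<^sub>m G = transpose_mat G * (t \<cdot>\<^sub>m (transpose_mat H * G))"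
    using G Gt Ht assoc_mult_mat[OF Gt Ht G] mult_smult_distrib[OF Gt, of "transpose_mat H * G" n t] by simp
  also have "\<dots> = to_ac c \<cdot>\<^sub>m transpose_mat G"
    unfolding HtG mult_smult_distrib[OF Gt one_carrier_mat] right_mult_one_mat[OF Gt] ..
  finally show tG: "t \<cdot>\<^sub>m G = to_ac c \<cdot>\<^sub>m transpose_mat G" .
  show nz: "\<exists>i<n. \<exists>j<n. G $$ (i, j) \<noteq> 0"
  proof (rule ccontr)
    assume "\<not> ?thesis"
    then have "(H * G) $$ (0, 0) = 0" unfolding mult_mat_index[OF dimH G n0 n0] using n0 by simp
    then show False using n0 by (simp add: HG)
  qed
  then obtain i j where ij: "i < n" "j < n" "G $$ (i, j) \<noteq> 0" by blast
  have ind: "t * G $$ (i, j) = to_ac c * G $$ (j, i)" if "i < n" "j < n" for i j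
    using arg_cong[OF tG, of "\<lambda>A. A $$ (i, j)"] that G by simp
  have "t * t * G $$ (i, j) = to_ac c * to_ac c * G $$ (i, j)"
    using ind[OF ij(1,2)] ind[OF ij(2,1)] by (metis mult.assoc mult.left_commute)
  then have "t * t = to_ac c * to_ac c" using ij(3) by simp
  then show "t = to_ac c \<or> t = - to_ac c" by (simp add: square_eq_iff)
qed

end


section \<open>The reduced trace\<close>

context azumaya_involution
begin

text \<open>Since t is c or -c with c in \<open>K\<close>, the trace of \<phi>(x) is \<tau>(x) / t
  and lies in \<open>K\<close>. All splittings give this value, because they are irreducible
  representations and these have equal traces; so the definite description is met.\<close>

lemma to_ac_Trd:
  assumes "irrep s n \<phi>"
  shows "to_ac (Trd s x) = mtrace (\<phi> x)"
proof -
  obtain \<tau> g where "azumaya_trace s \<tau> g" using azumaya_trace_exists by blast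
  then interpret azumaya_trace s \<tau> g .
  interpret trace_involution s \<tau> g \<sigma> ..
  obtain t where t: "\<And>x. to_ac (\<tau> x) = t * mtrace (\<phi> x)" "t \<noteq> 0"
    by (rule coeff_tensor_self[OF assms]) blast
  obtain c where c: "\<And>x. frag_eval (\<lambda>(a, b). a * x * \<sigma> b) g = s c (\<sigma> x)"
    using twisted_action_multiple by blast
  obtain G where "adjoint_to s \<sigma> n \<phi> G" using adjoint_exists[OF assms] by blast
  from adjoint_sign(2)[OF this c t(1)] obtain c' where c': "t = to_ac c'"
    by (metis to_ac_minus)
  have val: "mtrace (\<phi> x) = to_ac (\<tau> x / c')"
    using t by (simp add: c')
  have "Trd s x = \<tau> x / c'"
    unfolding Trd_def
  proof (rule the_equality)
    have "mtrace (\<phi> x) = (\<Sum>i<n. \<phi> x $$ (i, i))"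
      by (simp add: mtrace_def irrep_dim[OF assms])
    then show "\<exists>n \<phi>. splitting s n \<phi> \<and> to_ac (\<tau> x / c') = (\<Sum>i<n. \<phi> x $$ (i, i))"
      using irrep_imp_splitting[OF assms] val by metis
    fix k assume "\<exists>n \<phi>. splitting s n \<phi> \<and> to_ac k = (\<Sum>i<n. \<phi> x $$ (i, i))"
    then obtain m \<psi> where \<psi>: "splitting s m \<psi>" and k: "to_ac k = (\<Sum>i<m. \<psi> x $$ (i, i))" by blast
    have ir: "irrep s m \<psi>" by (rule splitting_imp_irrep[OF \<psi>])
    have "to_ac k = mtrace (\<psi> x)" using k by (simp add: mtrace_def irrep_dim[OF ir])
    also have "\<dots> = to_ac (\<tau> x / c')" using mtrace_irrep_unique[OF assms ir, of x] val by simp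
    finally show "k = \<tau> x / c'" by (simp del: to_ac_divide)
  qed
  then show ?thesis using val by simp
qed

lemma Trd_add: "Trd s (x + y) = Trd s x + Trd s y"
  and Trd_scale: "Trd s (s k x) = k * Trd s x"
  and Trd_cyclic: "Trd s (x * y) = Trd s (y * x)"
  and Trd_nonzero: "\<exists>z. Trd s z \<noteq> 0"
  and Trd_\<sigma>: "Trd s (\<sigma> x) = Trd s x"
proof -
  obtain n \<phi> where \<phi>: "irrep s n \<phi>" using irrep_exists by blast
  note trd = to_ac_Trd[OF \<phi>]
  have "to_ac (Trd s (x + y)) = to_ac (Trd s x + Trd s y)"
    by (simp add: trd mtrace_def irrep_add[OF \<phi>] irrep_dim[OF \<phi>] sum.distrib)
  then show "Trd s (x + y) = Trd s x + Trd s y" by (simp del: to_ac_add)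
  have "to_ac (Trd s (s k x)) = to_ac (k * Trd s x)"
    by (simp add: trd mtrace_def irrep_scale[OF \<phi>] irrep_dim[OF \<phi>] sum_distrib_left)
  then show "Trd s (s k x) = k * Trd s x" by (simp del: to_ac_mult)
  have "to_ac (Trd s (x * y)) = to_ac (Trd s (y * x))"
    unfolding trd irrep_mult[OF \<phi>] by (rule mtrace_mult_comm[OF irrep_carrier[OF \<phi>] irrep_carrier[OF \<phi>]])
  then show "Trd s (x * y) = Trd s (y * x)" by simp
  \<comment> \<open>A matrix and its transpose have the same trace, and x \<mapsto>
    \<phi>(\<sigma>(x)) transposed is itself a representation that computes
    \<open>Trd\<close>.\<close>
  have "to_ac (Trd s (\<sigma> x)) = mtrace (transpose_mat (\<phi> (\<sigma> x)))"
    by (simp add: trd mtrace_def irrep_dim[OF \<phi>])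
  also have "\<dots> = to_ac (Trd s x)" by (rule to_ac_Trd[OF irrep_transpose[OF \<phi>], symmetric])
  finally show "Trd s (\<sigma> x) = Trd s x" by simp
  obtain \<tau> g where "azumaya_trace s \<tau> g" using azumaya_trace_exists by blast
  then interpret azumaya_trace s \<tau> g .
  obtain t where t: "\<And>x. to_ac (\<tau> x) = t * mtrace (\<phi> x)"
    by (rule coeff_tensor_self[OF \<phi>]) blast
  obtain z where "\<tau> z \<noteq> 0" using trace_nonzero by blast
  then have "Trd s z \<noteq> 0" using t[of z] trd[of z] by auto
  then show "\<exists>z. Trd s z \<noteq> 0" by blast
qed

end

section \<open>The Goldman element and the sign of the involution\<close>

locale goldman_involution = azumaya_involution s \<sigma>
  for s :: "'k::field \<Rightarrow> 'a::ring_1 \<Rightarrow> 'a" and \<sigma> +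
  fixes g
  assumes sandwich_Trd: "\<And>x. sandwich_frag g x = s (Trd s x) 1"
    and char_ne_2: "CHAR('k) \<noteq> 2"
begin

text \<open>\<open>Trd\<close> is now known to be a nonzero cyclic form, so everything proved for
  \<tau> applies to it, with the constant t equal to 1.\<close>

sublocale trace_involution s "Trd s" g \<sigma>
  by unfold_locales (rule Trd_cyclic Trd_nonzero sandwich_Trd)+

lemma two_nonzero: "(2 :: 'k) \<noteq> 0"
proof
  assume "(2 :: 'k) = 0"
  then have "of_nat 2 = (0 :: 'k)" by simp
  then have dvd: "CHAR('k) dvd 2" by (simp only: of_nat_eq_0_iff_char_dvd)
  then have "CHAR('k) \<le> 2" by (rule dvd_imp_le) simp
  moreover have "CHAR('k) \<noteq> 0" using dvd by (intro notI) simp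
  moreover have "CHAR('k) \<noteq> 1" using CHAR_not_1' by simp
  ultimately show False using char_ne_2 by simp
qed

lemma coeff_tensor_goldman:
  assumes \<phi>: "irrep s n \<phi>" and "p < n" "q < n" "r < n" "u < n"
  shows "coeff_tensor g \<phi> \<phi> p q r u = (if p = u \<and> q = r then 1 else 0)"
proof -
  obtain t where t: "\<And>p q r u. p < n \<Longrightarrow> q < n \<Longrightarrow> r < n \<Longrightarrow> u < n \<Longrightarrow>
      coeff_tensor g \<phi> \<phi> p q r u = (if p = u \<and> q = r then t else 0)"
    "\<And>x. to_ac (Trd s x) = t * mtrace (\<phi> x)"
    by (rule coeff_tensor_self[OF \<phi>]) blast
  obtain z where "Trd s z \<noteq> 0" using Trd_nonzero by blast
  then have "t = 1" using t(2)[of z] to_ac_Trd[OF \<phi>, of z] by auto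
  with t(1) show ?thesis using assms by simp
qed

text \<open>In matrices this is the sum of tr(E_qp x) E_pq, which is x. The tensor \<open>g\<close>
  is thus dual to the pairing Trd(x y); both g^2 = 1 and the nondegeneracy of the trace form rest on
  it.\<close>

lemma goldman_dual: "frag_eval (\<lambda>(a, b). s (Trd s (b * x)) a) g = x"
proof -
  obtain n \<phi> where \<phi>: "irrep s n \<phi>" using irrep_exists by blast
  show ?thesis
  proof (rule irrep_eqI[OF \<phi>])
    fix p q assume pq: "p < n" "q < n"
    have "\<phi> (frag_eval (\<lambda>(a, b). s (Trd s (b * x)) a) g) $$ (p, q) =
        frag_eval (\<lambda>(a, b). \<Sum>r<n. \<Sum>u<n. \<phi> a $$ (p, q) * \<phi> b $$ (r, u) * \<phi> x $$ (u, r)) g"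
      unfolding irrep_frag_eval_index[OF \<phi> pq]
      by (rule frag_eval_cong)
        (use pq in \<open>auto simp: irrep_scale_index[OF \<phi>] to_ac_Trd[OF \<phi>] mtrace_def irrep_dim[OF \<phi>]
          irrep_mult_index[OF \<phi>] sum_distrib_left sum_distrib_right mult_ac\<close>)
    also have "\<dots> = (\<Sum>r<n. \<Sum>u<n. coeff_tensor g \<phi> \<phi> p q r u * \<phi> x $$ (u, r))"
      by (simp add: coeff_tensor_def frag_eval_mult_right[symmetric] frag_eval_sum[symmetric] case_prod_unfold)
    also have "\<dots> = (\<Sum>r<n. \<Sum>u<n. if u = p then (if r = q then \<phi> x $$ (u, r) else 0) else 0)"
      using pq by (intro sum.cong) (auto simp: coeff_tensor_goldman[OF \<phi>])
    also have "\<dots> = \<phi> x $$ (p, q)" using pq by simp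
    finally show "\<phi> (frag_eval (\<lambda>(a, b). s (Trd s (b * x)) a) g) $$ (p, q) = \<phi> x $$ (p, q)" .
  qed
qed

text \<open>The sum of E_pq \<otimes> E_qp is invariant under exchanging the factors. This is what
  makes \<open>g\<close> invariant under \<sigma> \<otimes> \<sigma>, as \<sigma> reverses
  sandwiches.\<close>

lemma goldman_flip: "frag_eval (\<lambda>(a, b). b * x * a) g = s (Trd s x) 1"
proof -
  obtain n \<phi> where \<phi>: "irrep s n \<phi>" using irrep_exists by blast
  show ?thesis
  proof (rule irrep_eqI[OF \<phi>])
    fix p u assume pu: "p < n" "u < n"
    have "\<phi> (frag_eval (\<lambda>(a, b). b * x * a) g) $$ (p, u) =
        frag_eval (\<lambda>(a, b). \<Sum>k<n. \<Sum>m<n. \<phi> a $$ (m, u) * \<phi> b $$ (p, k) * \<phi> x $$ (k, m)) g"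
      unfolding irrep_frag_eval_index[OF \<phi> pu]
      by (rule frag_eval_cong)
        (use pu in \<open>auto simp: mult.assoc irrep_mult_index[OF \<phi>] sum_distrib_left sum_distrib_right mult_ac\<close>)
    also have "\<dots> = (\<Sum>k<n. \<Sum>m<n. coeff_tensor g \<phi> \<phi> m u p k * \<phi> x $$ (k, m))"
      by (simp add: coeff_tensor_def frag_eval_mult_right[symmetric] frag_eval_sum[symmetric] case_prod_unfold)
    also have "\<dots> = (\<Sum>k<n. \<Sum>m<n. if m = k then (if p = u then \<phi> x $$ (k, k) else 0) else 0)"
      using pu by (intro sum.cong) (auto simp: coeff_tensor_goldman[OF \<phi>])
    also have "\<dots> = \<phi> (s (Trd s x) 1) $$ (p, u)"
      using pu by (simp add: irrep_scale_index[OF \<phi>] irrep_one_index[OF \<phi>] to_ac_Trd[OF \<phi>]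
          mtrace_def irrep_dim[OF \<phi>])
    finally show "\<phi> (frag_eval (\<lambda>(a, b). b * x * a) g) $$ (p, u) = \<phi> (s (Trd s x) 1) $$ (p, u)" .
  qed
qed

abbreviation "\<epsilon> \<equiv> involution_sign s \<sigma>"

text \<open>With t = 1 every adjoint form, in every splitting, satisfies G = c G^T, and c is 1 or
  -1. So c alone decides between symmetric and skew forms, and c is the sign. Since 1 and -1 differ
  in \<open>K\<close>, exactly one type occurs.\<close>

lemma involution_sign_twisted:
  shows involution_sign_cases: "\<epsilon> = 1 \<or> \<epsilon> = - 1"
    and twisted_goldman: "frag_eval (\<lambda>(a, b). a * x * \<sigma> b) g = of_int \<epsilon> * \<sigma> x"
proof -
  obtain c where c: "\<And>x. frag_eval (\<lambda>(a, b). a * x * \<sigma> b) g = s c (\<sigma> x)"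
    using twisted_action_multiple by blast
  have one_smult: "1 \<cdot>\<^sub>m M = M" for M :: "'k alg_closure mat" by (rule eq_matI) auto
  have adj: "G = to_ac c \<cdot>\<^sub>m transpose_mat G \<and> (c = 1 \<or> c = - 1) \<and> (\<exists>i<n. \<exists>j<n. G $$ (i, j) \<noteq> 0) \<and>
      G \<in> carrier_mat n n" if G: "adjoint_to s \<sigma> n \<phi> G" for n \<phi> G
  proof -
    have "irrep s n \<phi>" using G splitting_imp_irrep by (simp add: adjoint_to_def)
    note * = adjoint_sign[OF G c, of 1, simplified, OF to_ac_Trd[OF this]]
    have "c = 1 \<or> c = - 1"
    proof -
      have "to_ac 1 = to_ac c \<or> to_ac 1 = to_ac (- c)" using *(2) by simp
      then have "1 = c \<or> 1 = - c" by (simp only: to_ac_eq_iff)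
      then show ?thesis by (metis minus_minus)
    qed
    then show ?thesis using * G by (auto simp: adjoint_to_def one_smult)
  qed
  obtain n \<phi> where \<phi>: "irrep s n \<phi>" using irrep_exists by blast
  obtain G where G: "adjoint_to s \<sigma> n \<phi> G" using adjoint_exists[OF \<phi>] by blast
  have two: "(2 :: 'k alg_closure) \<noteq> 0" using two_nonzero by (metis to_ac_eq_0_iff to_ac_numeral)
  have ne: "(1 :: 'k) \<noteq> - 1"
    using two_nonzero by (metis add.right_inverse one_add_one)
  have orth: "orthogonal_involution s \<sigma> \<longleftrightarrow> c = 1"
  proof
    assume "c = 1"
    then have "G = transpose_mat G" using adj[OF G] by (simp add: one_smult)
    then show "orthogonal_involution s \<sigma>" using G unfolding orthogonal_involution_def by metis
  next
    assume "orthogonal_involution s \<sigma>"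
    then obtain n \<phi> G where G: "adjoint_to s \<sigma> n \<phi> G" and sym: "transpose_mat G = G"
      unfolding orthogonal_involution_def by blast
    obtain i j where ij: "i < n" "j < n" "G $$ (i, j) \<noteq> 0" using adj[OF G] by blast
    have "G = to_ac c \<cdot>\<^sub>m G" using adj[OF G] sym by simp
    then have "G $$ (i, j) = to_ac c * G $$ (i, j)" using ij adj[OF G]
      by (metis carrier_matD index_smult_mat(1))
    then show "c = 1" using ij(3) by simp
  qed
  have symp: "symplectic_involution s \<sigma> \<longleftrightarrow> c = - 1"
  proof
    assume c1: "c = - 1"
    then have *: "G = - 1 \<cdot>\<^sub>m transpose_mat G" "G \<in> carrier_mat n n" using adj[OF G] by auto
    have ind: "G $$ (i, j) = - G $$ (j, i)" if "i < n" "j < n" for i j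
      using arg_cong[OF *(1), of "\<lambda>A. A $$ (i, j)"] that *(2) by simp
    have "transpose_mat G = - G"
    proof (rule eq_matI)
      fix i j assume "i < dim_row (- G)" "j < dim_col (- G)"
      then show "transpose_mat G $$ (i, j) = (- G) $$ (i, j)" using ind[of j i] *(2) by simp
    qed (use *(2) in auto)
    \<comment> \<open>A skew form is alternating here because 2 is invertible.\<close>
    moreover have "G $$ (i, i) = 0" if "i < n" for i
    proof -
      have "2 * G $$ (i, i) = 0" using ind[OF that that] by (metis add.right_inverse mult_2)
      then show ?thesis using two by simp
    qed
    ultimately show "symplectic_involution s \<sigma>" using G unfolding symplectic_involution_def by blast
  next
    assume "symplectic_involution s \<sigma>"
    then obtain n \<phi> G where G: "adjoint_to s \<sigma> n \<phi> G" and skew: "transpose_mat G = - G"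
      unfolding symplectic_involution_def by blast
    obtain i j where ij: "i < n" "j < n" "G $$ (i, j) \<noteq> 0" using adj[OF G] by blast
    have "G = to_ac c \<cdot>\<^sub>m (- G)" using adj[OF G] skew by simp
    then have "G $$ (i, j) = (to_ac c \<cdot>\<^sub>m (- G)) $$ (i, j)" by simp
    also have "\<dots> = to_ac c * - G $$ (i, j)"
      using ij conjunct2[OF conjunct2[OF conjunct2[OF adj[OF G]]]] by simp
    finally have "c \<noteq> 1" using ij(3) two
      by (metis add_eq_0_iff mult_2 mult_eq_0_iff mult_minus_right mult.left_neutral to_ac_1)
    then show "c = - 1" using adj[OF G] by blast
  qed
  have sgn: "\<epsilon> = (if c = 1 then 1 else - 1)" "c = 1 \<or> c = - 1"
    using adj[OF G] ne unfolding involution_sign_def orth symp by auto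
  then show "\<epsilon> = 1 \<or> \<epsilon> = - 1" by auto
  show "frag_eval (\<lambda>(a, b). a * x * \<sigma> b) g = of_int \<epsilon> * \<sigma> x"
    unfolding c using sgn ne by (auto simp: sgn(1))
qed

lemma goldman_coset: "goldman s = g +o vtensor_ker s s"
  unfolding goldman_def
proof (rule the_equality)
  show "g +o vtensor_ker s s \<in> vtensor s s \<and> (\<forall>x. sandwich (g +o vtensor_ker s s) x = s (Trd s x) 1)"
    unfolding vtensor_eq_range sandwich_coset sandwich_Trd by blast
  fix z assume z: "z \<in> vtensor s s \<and> (\<forall>x. sandwich z x = s (Trd s x) 1)"
  then obtain f where f: "z = f +o vtensor_ker s s" unfolding vtensor_eq_range by blast
  have "\<forall>x. sandwich_frag (f - g) x = 0"
    using z unfolding f sandwich_coset frag_eval_diff sandwich_Trd by simp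
  then show "z = g +o vtensor_ker s s"
    unfolding f vtensor_coset_eq_iff vtensor_ker_iff .
qed

end


section \<open>The algebra \<open>A \<otimes> A\<close>\<close>

definition frag_mult ::
  "('a::ring_1 \<times> 'a \<Rightarrow>\<^sub>0 int) \<Rightarrow> ('a \<times> 'a \<Rightarrow>\<^sub>0 int) \<Rightarrow> ('a \<times> 'a \<Rightarrow>\<^sub>0 int)" where
  "frag_mult x y = frag_extend (\<lambda>(a, b). frag_extend (\<lambda>(c, d). frag_of (a * c, b * d)) y) x"

lemma frag_eval_mult:
  "frag_eval h (frag_mult x y) = frag_eval (\<lambda>(a, b). frag_eval (\<lambda>(c, d). h (a * c, b * d)) y) x"
  by (simp add: frag_mult_def frag_eval_extend case_prod_unfold)

lemma frag_mult_add_left: "frag_mult (x + y) z = frag_mult x z + frag_mult y z"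
  by (simp add: frag_mult_def frag_extend_add)

lemma frag_mult_add_right: "frag_mult z (x + y) = frag_mult z x + frag_mult z y"
proof -
  have "frag_extend (\<lambda>p. k p + l p) z = frag_extend k z + frag_extend l z" for k l :: "_ \<Rightarrow> 'a \<times> 'a \<Rightarrow>\<^sub>0 int"
    by (simp add: frag_extend_def frag_cmul_distrib2 sum.distrib)
  then show ?thesis
    by (simp add: frag_mult_def frag_extend_add case_prod_unfold)
qed

lemma vtensor_ker_group_closure: "\<exists>S. vtensor_ker s s' = group_closure S"
  unfolding vtensor_ker_def tensor_ker_def by blast

context azumaya_involution
begin

definition frag_inv :: "('a \<times> 'a \<Rightarrow>\<^sub>0 int) \<Rightarrow> ('a \<times> 'a \<Rightarrow>\<^sub>0 int)" where
  "frag_inv x = frag_extend (\<lambda>(a, b). frag_of (\<sigma> a, \<sigma> b)) x"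

lemma frag_eval_inv: "frag_eval h (frag_inv x) = frag_eval (\<lambda>(a, b). h (\<sigma> a, \<sigma> b)) x"
  by (simp add: frag_inv_def frag_eval_extend case_prod_unfold)

abbreviation tclass :: "('a \<times> 'a \<Rightarrow>\<^sub>0 int) \<Rightarrow> ('a \<times> 'a \<Rightarrow>\<^sub>0 int) set" where
  "tclass f \<equiv> f +o vtensor_ker s s"

abbreviation "TT \<equiv> vtensor s s"

lemma tclass_in [simp]: "tclass f \<in> TT"
  unfolding vtensor_eq_range by blast

lemma tclass_E: "U \<in> TT \<Longrightarrow> (\<And>f. U = tclass f \<Longrightarrow> P) \<Longrightarrow> P"
  unfolding vtensor_eq_range by blast

lemma tclass_eqI: "(\<And>u. sandwich_frag x u = sandwich_frag y u) \<Longrightarrow> tclass x = tclass y"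
  by (simp add: vtensor_coset_eq_iff vtensor_ker_iff frag_eval_diff)

lemma tclass_plus: "tclass x + tclass y = tclass (x + y)"
  unfolding vtensor_ker_def by (rule tensor_coset_plus)

text \<open>The second factor is multiplied without reversal, so sandwiching does not turn this
  product into composition. Still, a c u b d can be grouped so that the argument lying in the kernel
  is sandwiched around c u, respectively around u b.\<close>

lemma frag_mult_ker:
  shows "x \<in> vtensor_ker s s \<Longrightarrow> frag_mult x y \<in> vtensor_ker s s"
    and "y \<in> vtensor_ker s s \<Longrightarrow> frag_mult x y \<in> vtensor_ker s s"
proof -
  assume x: "x \<in> vtensor_ker s s"
  have "sandwich_frag (frag_mult x y) u = 0" for u
  proof -
    have "sandwich_frag (frag_mult x y) u =
        frag_eval (\<lambda>p. frag_eval (\<lambda>q. fst p * (fst q * u) * snd p * snd q) y) x"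
      by (simp add: frag_eval_mult case_prod_unfold mult.assoc)
    also have "\<dots> = frag_eval (\<lambda>q. sandwich_frag x (fst q * u) * snd q) y"
      unfolding frag_eval_mult_right[symmetric]
      by (subst frag_eval_swap) (simp add: case_prod_unfold mult.assoc)
    also have "\<dots> = 0" using x by (simp add: vtensor_ker_iff frag_eval_def)
    finally show ?thesis .
  qed
  then show "frag_mult x y \<in> vtensor_ker s s" by (simp add: vtensor_ker_iff)
next
  assume y: "y \<in> vtensor_ker s s"
  have "sandwich_frag (frag_mult x y) u = 0" for u
  proof -
    have "sandwich_frag (frag_mult x y) u = frag_eval (\<lambda>p. fst p * sandwich_frag y (u * snd p)) x"
      by (simp add: frag_eval_mult case_prod_unfold mult.assoc frag_eval_mult_left[symmetric])
    also have "\<dots> = 0" using y by (simp add: vtensor_ker_iff frag_eval_def)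
    finally show ?thesis .
  qed
  then show "frag_mult x y \<in> vtensor_ker s s" by (simp add: vtensor_ker_iff)
qed

lemma frag_inv_ker: "x \<in> vtensor_ker s s \<Longrightarrow> frag_inv x \<in> vtensor_ker s s"
proof -
  assume x: "x \<in> vtensor_ker s s"
  have "balanced s (\<lambda>(a, b). \<sigma> a * u * \<sigma> b)" for u
    by (simp add: balanced_def algebra_simps scale_mult \<sigma>_add \<sigma>_scale)
  from balanced_vanish[OF this x] show ?thesis
    by (simp add: vtensor_ker_iff frag_eval_inv)
qed

lemma aa_mult_tclass: "aa_mult s (tclass x) (tclass y) = tclass (frag_mult x y)"
proof -
  obtain S where S: "vtensor_ker s s = group_closure S" using vtensor_ker_group_closure by blast
  show ?thesis
    unfolding aa_mult_def frag_mult_def[symmetric] S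
    by (rule UN_coset2)
      (auto simp: frag_mult_add_left frag_mult_add_right intro: frag_mult_ker[unfolded S])
qed

lemma aa_inv_tclass: "aa_inv s \<sigma> (tclass x) = tclass (frag_inv x)"
proof -
  obtain S where S: "vtensor_ker s s = group_closure S" using vtensor_ker_group_closure by blast
  show ?thesis
    unfolding aa_inv_def frag_inv_def[symmetric] S
    by (rule UN_coset) (auto simp: frag_inv_def frag_extend_add intro: frag_inv_ker[unfolded S frag_inv_def])
qed

lemma action_tclass: "twisted_action \<sigma> (tclass x) v = frag_eval (\<lambda>(a, b). a * v * \<sigma> b) x"
  unfolding twisted_action_def by (rule tensor_lift_vtensor[OF balanced_twisted])

abbreviation tmult (infixl "\<odot>\<^sub>T" 70) where "U \<odot>\<^sub>T V \<equiv> aa_mult s U V"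
abbreviation act where "act U v \<equiv> twisted_action \<sigma> U v"

lemma TT_closed [simp]:
  shows "U \<in> TT \<Longrightarrow> V \<in> TT \<Longrightarrow> U \<odot>\<^sub>T V \<in> TT"
    and "U \<in> TT \<Longrightarrow> V \<in> TT \<Longrightarrow> U + V \<in> TT"
    and "U \<in> TT \<Longrightarrow> aa_inv s \<sigma> U \<in> TT"
    and "aa_one s \<in> TT"
    and "vtensor_ker s s \<in> TT"
  using tclass_in[of 0]
  by (auto elim!: tclass_E simp: aa_mult_tclass aa_inv_tclass tclass_plus aa_one_def)

lemma tmult_assoc:
  assumes "U \<in> TT" "V \<in> TT" "W \<in> TT"
  shows "U \<odot>\<^sub>T V \<odot>\<^sub>T W = U \<odot>\<^sub>T (V \<odot>\<^sub>T W)"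
proof -
  obtain x y z where "U = tclass x" "V = tclass y" "W = tclass z" using assms by (auto elim!: tclass_E)
  then show ?thesis
    unfolding aa_mult_tclass
    by (simp only: aa_mult_tclass) (rule tclass_eqI, simp add: frag_eval_mult case_prod_unfold mult.assoc)
qed

lemma tmult_distrib:
  assumes "U \<in> TT" "V \<in> TT" "W \<in> TT"
  shows "U \<odot>\<^sub>T (V + W) = U \<odot>\<^sub>T V + U \<odot>\<^sub>T W" "(V + W) \<odot>\<^sub>T U = V \<odot>\<^sub>T U + W \<odot>\<^sub>T U"
  using assms
  by (auto elim!: tclass_E simp: aa_mult_tclass tclass_plus frag_mult_add_left frag_mult_add_right)

lemma tmult_one [simp]: "U \<in> TT \<Longrightarrow> U \<odot>\<^sub>T aa_one s = U"
  by (elim tclass_E, simp only: aa_one_def aa_mult_tclass, rule tclass_eqI)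
    (simp add: frag_eval_mult case_prod_unfold)

lemma aa_inv_mult:
  assumes "U \<in> TT" "V \<in> TT"
  shows "aa_inv s \<sigma> (U \<odot>\<^sub>T V) = aa_inv s \<sigma> V \<odot>\<^sub>T aa_inv s \<sigma> U"
proof -
  obtain x y where xy: "U = tclass x" "V = tclass y" using assms by (auto elim!: tclass_E)
  show ?thesis
    unfolding xy aa_mult_tclass aa_inv_tclass
  proof (rule tclass_eqI)
    fix u
    show "sandwich_frag (frag_inv (frag_mult x y)) u = sandwich_frag (frag_mult (frag_inv y) (frag_inv x)) u"
      by (simp add: frag_eval_inv frag_eval_mult case_prod_unfold \<sigma>_mult) (rule frag_eval_swap)
  qed
qed

lemma act_add_left: "U \<in> TT \<Longrightarrow> V \<in> TT \<Longrightarrow> act (U + V) v = act U v + act V v"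
  by (auto elim!: tclass_E simp: tclass_plus action_tclass frag_eval_add)

lemma act_add_right: "U \<in> TT \<Longrightarrow> act U (v + w) = act U v + act U w"
  by (auto elim!: tclass_E simp: action_tclass frag_eval_distrib[symmetric] case_prod_unfold algebra_simps)

lemma act_mult: "U \<in> TT \<Longrightarrow> V \<in> TT \<Longrightarrow> act (U \<odot>\<^sub>T V) v = act U (act V v)"
  by (auto elim!: tclass_E simp: action_tclass aa_mult_tclass frag_eval_mult case_prod_unfold \<sigma>_mult
      frag_eval_mult_left[symmetric] frag_eval_mult_right[symmetric] mult.assoc)

lemma act_one [simp]: "act (aa_one s) v = v"
  unfolding aa_one_def action_tclass by simp

lemma act_scale: "U \<in> TT \<Longrightarrow> act U (s k v) = s k (act U v)"
  by (auto elim!: tclass_E simp: action_tclass frag_eval_additive[of "s k"] scale_right_distrib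
      scale_mult case_prod_unfold)

lemma Trd_frag_eval: "Trd s (frag_eval h f) = frag_eval (\<lambda>p. Trd s (h p)) f"
  by (rule frag_eval_additive) (rule Trd_add)

text \<open>The involution \<sigma> \<otimes> \<sigma> is adjoint to the action for the trace form:
  cyclicity brings b to the front of \<sigma>(v) \<sigma>(a) w b, and b \<sigma>(v) \<sigma>(a) is
  \<sigma>(a v \<sigma>(b)).\<close>

lemma trace_form_act:
  assumes "U \<in> TT"
  shows "trace_form s \<sigma> v (act (aa_inv s \<sigma> U) w) = trace_form s \<sigma> (act U v) w"
proof -
  obtain x where x: "U = tclass x" using assms by (auto elim!: tclass_E)
  have "trace_form s \<sigma> v (act (aa_inv s \<sigma> U) w) = frag_eval (\<lambda>(a, b). Trd s (\<sigma> v * (\<sigma> a * w * b))) x"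
    by (simp add: trace_form_def x aa_inv_tclass action_tclass frag_eval_inv
        frag_eval_mult_left[symmetric] Trd_frag_eval case_prod_unfold)
  also have "\<dots> = frag_eval (\<lambda>(a, b). Trd s (\<sigma> (a * v * \<sigma> b) * w)) x"
  proof (rule frag_eval_cong, clarify)
    fix a b
    show "Trd s (\<sigma> v * (\<sigma> a * w * b)) = Trd s (\<sigma> (a * v * \<sigma> b) * w)"
      using Trd_cyclic[of "\<sigma> v * \<sigma> a * w" b] by (simp add: \<sigma>_mult mult.assoc)
  qed
  also have "\<dots> = trace_form s \<sigma> (act U v) w"
    by (simp add: trace_form_def x action_tclass frag_eval_additive[of \<sigma>] \<sigma>_add
        frag_eval_mult_right[symmetric] Trd_frag_eval case_prod_unfold)
  finally show ?thesis .
qed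

end

section \<open>The element \<open>s2\<close> and the hermitian form on \<open>Alt2\<close>\<close>

context goldman_involution
begin

lemma s2_tclass: "s2 s = tclass (frag_of (1, 1) - g)"
  unfolding s2_def aa_one_def goldman_coset vtensor_ker_def tensor_coset_uminus tensor_coset_plus
  by simp

lemma s2_in [simp]: "s2 s \<in> TT" "goldman s \<in> TT"
  by (simp_all add: s2_tclass goldman_coset)

lemma act_goldman: "act (goldman s) v = of_int \<epsilon> * \<sigma> v"
  by (simp add: goldman_coset action_tclass twisted_goldman)

lemma act_s2: "act (s2 s) v = v - of_int \<epsilon> * \<sigma> v"
  by (simp add: s2_tclass action_tclass frag_eval_diff twisted_goldman)

text \<open>Applying \<sigma> to the factors of \<open>g\<close> gives a sandwich which is \<sigma>
  of the flipped sandwich at \<sigma>(u). By \<open>goldman_flip\<close> and the invariance of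
  \<open>Trd\<close>, this is again Trd(u) 1.\<close>

lemma aa_inv_s2: "aa_inv s \<sigma> (s2 s) = s2 s"
  unfolding s2_tclass aa_inv_tclass
proof (rule tclass_eqI)
  fix u
  have "frag_eval (\<lambda>(a, b). \<sigma> a * u * \<sigma> b) g = \<sigma> (frag_eval (\<lambda>(a, b). b * \<sigma> u * a) g)"
    by (simp add: frag_eval_additive[of \<sigma>] \<sigma>_add \<sigma>_mult case_prod_unfold mult.assoc)
  also have "\<dots> = s (Trd s u) 1" by (simp add: goldman_flip \<sigma>_scale Trd_\<sigma>)
  finally show "sandwich_frag (frag_inv (frag_of (1, 1) - g)) u = sandwich_frag (frag_of (1, 1) - g) u"
    by (simp add: frag_eval_inv frag_eval_diff sandwich_Trd)
qed

text \<open>The product is 1 - g^2. In the sandwich of g^2 at u, the inner sum is Trd(u b), and the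
  outer sum of Trd(b u) a is u by \<open>goldman_dual\<close>. The coset
  \<open>vtensor_ker s s\<close> is the zero of A \<otimes> A.\<close>

lemma s2_mult_sym: "s2 s \<odot>\<^sub>T (aa_one s + goldman s) = vtensor_ker s s"
proof -
  have gg: "frag_eval (\<lambda>(a, b). frag_eval (\<lambda>(c, d). a * c * u * (b * d)) g) g = u" for u
  proof -
    have "frag_eval (\<lambda>(a, b). frag_eval (\<lambda>(c, d). a * c * u * (b * d)) g) g =
        frag_eval (\<lambda>p. fst p * sandwich_frag g (u * snd p)) g"
      by (simp add: case_prod_unfold mult.assoc frag_eval_mult_left[symmetric])
    also have "\<dots> = frag_eval (\<lambda>(a, b). s (Trd s (b * u)) a) g"
      unfolding sandwich_Trd by (rule frag_eval_cong) (auto simp: scale_mult Trd_cyclic[of u])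
    finally show ?thesis by (simp add: goldman_dual)
  qed
  have "tclass (frag_mult (frag_of (1, 1) - g) (frag_of (1, 1) + g)) = tclass 0"
  proof (rule tclass_eqI)
    fix u
    have "frag_eval (\<lambda>(a, b). a * u * b + frag_eval (\<lambda>(c, d). a * c * u * (b * d)) g) g =
        sandwich_frag g u + u"
      using frag_eval_distrib[of "\<lambda>(a, b). a * u * b" "\<lambda>(a, b). frag_eval (\<lambda>(c, d). a * c * u * (b * d)) g" g]
      by (simp add: case_prod_unfold gg[unfolded case_prod_unfold])
    then show "sandwich_frag (frag_mult (frag_of (1, 1) - g) (frag_of (1, 1) + g)) u = sandwich_frag 0 u"
      by (simp add: frag_eval_mult frag_eval_diff frag_eval_add)
  qed
  then show ?thesis
    by (simp add: s2_tclass aa_one_def goldman_coset tclass_plus aa_mult_tclass)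
qed

lemma Alt2_eq: "Alt2 s = (\<lambda>y. s2 s \<odot>\<^sub>T y) ` TT"
  by (simp add: Alt2_def)

lemma Alt2_subset: "U \<in> Alt2 s \<Longrightarrow> U \<in> TT"
  by (auto simp: Alt2_eq)

lemma Alt2_closed:
  shows "U \<in> Alt2 s \<Longrightarrow> V \<in> Alt2 s \<Longrightarrow> U + V \<in> Alt2 s"
    and "U \<in> Alt2 s \<Longrightarrow> V \<in> TT \<Longrightarrow> U \<odot>\<^sub>T V \<in> Alt2 s"
    and "s2 s \<in> Alt2 s"
    and "vtensor_ker s s \<in> Alt2 s"
proof -
  show "U \<in> Alt2 s \<Longrightarrow> V \<in> Alt2 s \<Longrightarrow> U + V \<in> Alt2 s"
    by (auto simp: Alt2_eq tmult_distrib(1)[symmetric])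
  show "U \<in> Alt2 s \<Longrightarrow> V \<in> TT \<Longrightarrow> U \<odot>\<^sub>T V \<in> Alt2 s"
    by (auto simp: Alt2_eq tmult_assoc)
  show "s2 s \<in> Alt2 s"
    unfolding Alt2_eq by (rule image_eqI[of _ _ "aa_one s"]) auto
  show "vtensor_ker s s \<in> Alt2 s"
    unfolding Alt2_eq by (rule image_eqI[of _ _ "aa_one s + goldman s"]) (simp_all add: s2_mult_sym)
qed

text \<open>As \<open>s2\<close> is fixed by \<sigma> \<otimes> \<sigma>, it moves from the first
  argument to the second: the value depends on y only through \<open>s2\<close> y. This is the
  well-definedness of the hermitian form.\<close>

lemma Alt2_form_eq:
  assumes "x \<in> TT" "U \<in> Alt2 s"
  shows "Alt2_form s \<sigma> (s2 s \<odot>\<^sub>T x) U = aa_inv s \<sigma> x \<odot>\<^sub>T U"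
proof -
  have *: "aa_inv s \<sigma> (s2 s \<odot>\<^sub>T x) \<odot>\<^sub>T y = aa_inv s \<sigma> x \<odot>\<^sub>T (s2 s \<odot>\<^sub>T y)" if "y \<in> TT" for y
    using assms(1) that by (simp add: aa_inv_mult aa_inv_s2 tmult_assoc)
  show ?thesis
    unfolding Alt2_form_def
  proof (rule the_equality)
    obtain y where y: "y \<in> TT" "U = s2 s \<odot>\<^sub>T y" using assms(2) by (auto simp: Alt2_eq)
    then show "\<exists>y\<in>TT. U = s2 s \<odot>\<^sub>T y \<and> aa_inv s \<sigma> x \<odot>\<^sub>T U = aa_inv s \<sigma> (s2 s \<odot>\<^sub>T x) \<odot>\<^sub>T y"
      using * by auto
  qed (auto simp: *)
qed

lemma Alt2_form_s2:
  assumes "U \<in> Alt2 s"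
  shows "Alt2_form s \<sigma> U (s2 s) = aa_inv s \<sigma> U"
proof -
  obtain x where x: "x \<in> TT" "U = s2 s \<odot>\<^sub>T x" using assms by (auto simp: Alt2_eq)
  then show ?thesis
    using Alt2_form_eq[OF x(1) Alt2_closed(3)] by (simp add: aa_inv_mult aa_inv_s2)
qed

end


section \<open>The exterior square\<close>

text \<open>
  Both spaces of the theorem are images of \<open>A\<close> under linear maps \<open>q\<close> with the same kernel; it
  suffices to compare the forms \<open>b\<close> pulled back to \<open>A\<close>.
\<close>

definition presents ::
  "('k::field \<Rightarrow> 'a::ab_group_add \<Rightarrow> 'a) \<Rightarrow> ('a \<Rightarrow> 'a \<Rightarrow> 'k) \<Rightarrow> ('a \<Rightarrow> 'v) \<Rightarrow> ('k, 'v) bilinear_space \<Rightarrow> bool" where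
  "presents s b q V \<longleftrightarrow> carrier V = range q \<and> (\<forall>v w. q v \<oplus>\<^bsub>V\<^esub> q w = q (v + w)) \<and> \<zero>\<^bsub>V\<^esub> = q 0 \<and>
    (\<forall>k v. k \<odot>\<^bsub>V\<^esub> q v = q (s k v)) \<and> (\<forall>v w. form V (q v) (q w) = b v w)"

context azumaya
begin

text \<open>Each requirement is pulled back to \<open>A\<close> along \<open>q\<close>. The preimage
  of a submodule is a subspace, so the images of a finite spanning set of \<open>A\<close> generate;
  the radical is zero because \<open>b_nondeg\<close> puts the radical of \<open>b\<close> into the
  kernel of \<open>q\<close>.\<close>

lemma presents_nondeg:
  assumes "presents s b q V"
    and b_add: "\<And>u v w. b (u + v) w = b u w + b v w" and b_scale: "\<And>k v w. b (s k v) w = k * b v w"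
    and b_sym: "\<And>v w. b v w = b w v" and b_nondeg: "\<And>v. (\<And>w. b v w = 0) \<Longrightarrow> q v = q 0"
  shows "nondeg_symmetric_space V"
proof -
  have car: "carrier V = range q" and add: "\<And>v w. q v \<oplus>\<^bsub>V\<^esub> q w = q (v + w)" and zero: "\<zero>\<^bsub>V\<^esub> = q 0"
    and smult: "\<And>k v. k \<odot>\<^bsub>V\<^esub> q v = q (s k v)" and form: "\<And>v w. form V (q v) (q w) = b v w"
    using assms(1) by (auto simp: presents_def)
  have "abelian_group V"
  proof (rule abelian_groupI)
    fix x assume "x \<in> carrier V"
    then obtain v where x: "x = q v" by (auto simp: car)
    have "q (- v) \<oplus>\<^bsub>V\<^esub> x = \<zero>\<^bsub>V\<^esub>" by (simp add: x add zero)
    then show "\<exists>y\<in>carrier V. y \<oplus>\<^bsub>V\<^esub> x = \<zero>\<^bsub>V\<^esub>" by (auto simp: car)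
  qed (auto simp: car add zero add_ac)
  then have "Module.module (ring_of_type_algebra :: 'k ring) V"
    by (intro Module.moduleI cring_from_type_algebra)
      (auto simp: ring_of_type_algebra_def car smult add scale_left_distrib scale_right_distrib)
  moreover have "\<exists>B. finite B \<and> B \<subseteq> carrier V \<and>
      (\<forall>H. submodule H (ring_of_type_algebra :: 'k ring) V \<and> B \<subseteq> H \<longrightarrow> H = carrier V)"
  proof -
    obtain D where D: "finite D" "span D = UNIV"
      using azumaya by (auto simp: azumaya_algebra_def)
    have "H = carrier V" if H: "submodule H (ring_of_type_algebra :: 'k ring) V" and "q ` D \<subseteq> H" for H
    proof -
      interpret H: submodule H "ring_of_type_algebra :: 'k ring" V by (rule H)
      have "subspace {v. q v \<in> H}"
      proof (rule subspaceI)
        show "0 \<in> {v. q v \<in> H}" using H.one_closed by (simp add: zero)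
        show "u + v \<in> {v. q v \<in> H}" if "u \<in> {v. q v \<in> H}" "v \<in> {v. q v \<in> H}" for u v
          using H.m_closed[of "q u" "q v"] that by (simp add: add)
        show "s k v \<in> {v. q v \<in> H}" if "v \<in> {v. q v \<in> H}" for k v
          using H.smult_closed[of k "q v"] that by (simp add: smult ring_of_type_algebra_def)
      qed
      moreover have "D \<subseteq> {v. q v \<in> H}" using that(2) by auto
      ultimately have "span D \<subseteq> {v. q v \<in> H}" by (intro span_minimal)
      then have "carrier V \<subseteq> H" using D(2) by (auto simp: car)
      moreover have "H \<subseteq> carrier V" using H.subset by simp
      ultimately show ?thesis by blast
    qed
    then show ?thesis using D(1) by (intro exI[of _ "q ` D"]) (auto simp: car)
  qed
  moreover have "\<forall>x\<in>carrier V. (\<forall>y\<in>carrier V. form V x y = 0) \<longrightarrow> x = \<zero>\<^bsub>V\<^esub>"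
    using b_nondeg by (auto simp: car form zero)
  moreover have "\<forall>x\<in>carrier V. \<forall>y\<in>carrier V. form V x y = form V y x"
    by (auto simp: car form intro: b_sym)
  moreover have "\<forall>x\<in>carrier V. \<forall>y\<in>carrier V. \<forall>z\<in>carrier V.
      form V (x \<oplus>\<^bsub>V\<^esub> y) z = form V x z + form V y z"
    by (auto simp: car form add b_add)
  moreover have "\<forall>k. \<forall>x\<in>carrier V. \<forall>y\<in>carrier V. form V (k \<odot>\<^bsub>V\<^esub> x) y = k * form V x y"
    by (auto simp: car form smult b_scale)
  ultimately show ?thesis
    unfolding nondeg_symmetric_space_def by (intro conjI)
qed

lemma presents_isometric:
  assumes V: "presents s b q V" and W: "presents s b q' W" and eq: "\<And>v w. q v = q w \<longleftrightarrow> q' v = q' w"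
  shows "isometric V W"
proof -
  define f where "f = (\<lambda>x. q' (SOME v. q v = x))"
  have f: "f (q v) = q' v" for v
  proof -
    have "q (SOME w. q w = q v) = q v" by (rule someI[of _ v]) simp
    then show ?thesis unfolding f_def using eq by blast
  qed
  have "bij_betw f (carrier V) (carrier W)"
    using V W eq by (auto simp: presents_def bij_betw_def inj_on_def f image_image)
  then show ?thesis
    unfolding isometric_def using V W by (intro exI[of _ f]) (auto simp: presents_def f)
qed

end

lemma tensor_ker_group_closure: "\<exists>S. tensor_ker M R ract N lact = group_closure S"
  unfolding tensor_ker_def by blast

context goldman_involution
begin

section \<open>The trace form and its restriction to an eigenspace of the involution\<close>

abbreviation "alt v \<equiv> v - of_int \<epsilon> * \<sigma> v"
abbreviation "T \<equiv> trace_form s \<sigma>"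

lemma mult_of_int_left_commute: "x * (of_int k * y) = of_int k * (x * y :: 'b::ring_1)"
  by (metis mult.assoc mult_of_int_commute)

lemma of_int_sign_simps [simp]:
  "of_int \<epsilon> * (of_int \<epsilon> * x) = x" "\<sigma> (of_int \<epsilon> * x) = of_int \<epsilon> * \<sigma> x"
  "of_int \<epsilon> * s k x = s k (of_int \<epsilon> * x)" "of_int \<epsilon> * of_int \<epsilon> = (1 :: 'k)"
  "Trd s (of_int \<epsilon> * x) = of_int \<epsilon> * Trd s x"
proof -
  have neg: "Trd s (- x) = - Trd s x"
    using Trd_scale[of "- 1" x] by simp
  show "of_int \<epsilon> * (of_int \<epsilon> * x) = x" "\<sigma> (of_int \<epsilon> * x) = of_int \<epsilon> * \<sigma> x"
    "of_int \<epsilon> * s k x = s k (of_int \<epsilon> * x)" "of_int \<epsilon> * of_int \<epsilon> = (1 :: 'k)"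
    "Trd s (of_int \<epsilon> * x) = of_int \<epsilon> * Trd s x"
    using involution_sign_cases by (auto simp: \<sigma>_minus neg)
qed

lemma T_add: "T (u + v) w = T u w + T v w" "T w (u + v) = T w u + T w v"
  by (simp_all add: trace_form_def \<sigma>_add algebra_simps Trd_add)

lemma T_scale: "T (s k v) w = k * T v w" "T v (s k w) = k * T v w"
  by (simp_all add: trace_form_def \<sigma>_scale scale_mult Trd_scale)

lemma T_sym: "T v w = T w v"
  unfolding trace_form_def using Trd_\<sigma>[of "\<sigma> v * w"] by (simp add: \<sigma>_mult)

lemma T_\<sigma>: "T (\<sigma> v) (\<sigma> w) = T v w"
  unfolding trace_form_def using Trd_\<sigma>[of "w * \<sigma> v"] Trd_cyclic[of w "\<sigma> v"] by (simp add: \<sigma>_mult)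

lemma T_sign: "T (of_int \<epsilon> * v) w = of_int \<epsilon> * T v w" "T v (of_int \<epsilon> * w) = of_int \<epsilon> * T v w"
  by (simp_all add: trace_form_def mult.assoc mult_of_int_left_commute)

lemma T_diff: "T (u - v) w = T u w - T v w" "T w (u - v) = T w u - T w v"
  using T_add(1)[of "u - v" v w] T_add(2)[of w "u - v" v] by simp_all

text \<open>By \<open>goldman_dual\<close>, \<sigma>(v) is a combination of elements a with
  coefficients Trd(b \<sigma>(v)) = T(v, b), all of which vanish.\<close>

lemma T_nondeg:
  assumes "\<And>w. T v w = 0"
  shows "v = 0"
proof -
  have "\<sigma> v = frag_eval (\<lambda>(a, b). s (Trd s (b * \<sigma> v)) a) g" by (rule goldman_dual[symmetric])
  also have "\<dots> = frag_eval (\<lambda>p. 0) g"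
    by (rule frag_eval_cong) (use assms in \<open>auto simp: Trd_cyclic[of _ "\<sigma> v"] trace_form_def\<close>)
  finally have "\<sigma> v = 0" by (simp add: frag_eval_def)
  then show ?thesis using \<sigma>_\<sigma>[of v] by simp
qed

lemma \<sigma>_alt: "\<sigma> (alt v) = - (of_int \<epsilon> * alt v)"
  by (simp add: \<sigma>_diff right_diff_distrib)

lemma alt_linear: "alt (v + w) = alt v + alt w" "alt (s k v) = s k (alt v)"
  by (simp_all add: \<sigma>_add \<sigma>_scale algebra_simps scale_right_diff_distrib)

lemma alt_form_sym: "T (alt v) w = T (alt w) v"
proof -
  have "T (\<sigma> v) w = T (\<sigma> w) v"
    using T_\<sigma>[of "\<sigma> v" w] T_sym[of v "\<sigma> w"] by simp
  then show ?thesis by (simp add: T_diff T_sign T_sym[of v w])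
qed

text \<open>Since \<sigma> is an isometry and multiplies alt v by -\<epsilon>, the summand
  -\<epsilon> \<sigma>(w) of alt w contributes a second copy of T(alt v, w).\<close>

lemma alt_form_double: "T (alt v) (alt w) = 2 * T (alt v) w"
proof -
  have "T (alt v) (\<sigma> w) = T (\<sigma> (alt v)) w" using T_\<sigma>[of "alt v" "\<sigma> w"] by simp
  also have "\<dots> = - (of_int \<epsilon> * T (alt v) w)"
    unfolding \<sigma>_alt using T_scale(1)[of "- 1" "of_int \<epsilon> * alt v" w] by (simp add: T_sign)
  finally show ?thesis
    by (simp only: T_diff(2)[of "alt v"] T_sign) (simp add: mult.assoc[symmetric])
qed

lemma alt_fixed: "\<sigma> x = - (of_int \<epsilon> * x) \<Longrightarrow> alt x = s 2 x"
proof -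
  assume x: "\<sigma> x = - (of_int \<epsilon> * x)"
  have "s 2 x = s (1 + 1) x" by simp
  also have "\<dots> = x + x" unfolding scale_left_distrib by simp
  finally show ?thesis by (simp add: x)
qed

text \<open>Half of alt is the projection onto the eigenspace for -\<epsilon>. The scaling by 2, the
  two factors 1/2 and the 2 of \<open>alt_form_double\<close> cancel, leaving T(alt v, w).\<close>

lemma trace_form_part_presented:
  "presents s (\<lambda>v w. T (alt v) w) (\<lambda>v. s (1 / 2) (alt v)) (scale_form 2 (trace_form_part s \<sigma> (- \<epsilon>)))"
proof -
  have "{x. \<sigma> x = of_int (- \<epsilon>) * x} = range (\<lambda>v. s (1 / 2) (alt v))"
  proof
    show "range (\<lambda>v. s (1 / 2) (alt v)) \<subseteq> {x. \<sigma> x = of_int (- \<epsilon>) * x}"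
      by (auto simp: \<sigma>_scale \<sigma>_alt)
    show "{x. \<sigma> x = of_int (- \<epsilon>) * x} \<subseteq> range (\<lambda>v. s (1 / 2) (alt v))"
    proof
      fix x assume "x \<in> {x. \<sigma> x = of_int (- \<epsilon>) * x}"
      then have "alt x = s 2 x" by (intro alt_fixed) simp
      then have "x = s (1 / 2) (alt x)" using two_nonzero by simp
      then show "x \<in> range (\<lambda>v. s (1 / 2) (alt v))" by blast
    qed
  qed
  moreover have "2 * T (s (1 / 2) (alt v)) (s (1 / 2) (alt w)) = T (alt v) w" for v w
    using two_nonzero by (simp only: T_scale alt_form_double) simp
  ultimately show ?thesis
    by (simp add: presents_def scale_form_def trace_form_part_def alt_linear
        scale_right_distrib[symmetric] scale_left_commute)
qed

section \<open>The tensor product of \<open>Alt2\<close> with the twisted module\<close>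

abbreviation "ker2 \<equiv> lambda2_ker s \<sigma>"
abbreviation "quot v \<equiv> frag_of (s2 s, v) +o ker2"

lemma ker2_rules:
  shows "U \<in> Alt2 s \<Longrightarrow> U' \<in> Alt2 s \<Longrightarrow> frag_of (U + U', v) - frag_of (U, v) - frag_of (U', v) \<in> ker2"
    and "U \<in> Alt2 s \<Longrightarrow> frag_of (U, v + v') - frag_of (U, v) - frag_of (U, v') \<in> ker2"
    and "U \<in> Alt2 s \<Longrightarrow> V \<in> TT \<Longrightarrow> frag_of (U \<odot>\<^sub>T V, v) - frag_of (U, act V v) \<in> ker2"
    and "0 \<in> ker2"
    and "f \<in> ker2 \<Longrightarrow> f' \<in> ker2 \<Longrightarrow> f + f' \<in> ker2"
    and "f \<in> ker2 \<Longrightarrow> f' \<in> ker2 \<Longrightarrow> f - f' \<in> ker2"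
  unfolding lambda2_ker_def
  by (rule tensor_ker_rules tensor_ker_0 tensor_ker_add tensor_ker_diff; simp)+

lemma ker2_vanish:
  assumes "f \<in> ker2"
    and "\<And>U U' v. U \<in> Alt2 s \<Longrightarrow> U' \<in> Alt2 s \<Longrightarrow> h (U + U', v) = h (U, v) + h (U', v)"
    and "\<And>U v v'. U \<in> Alt2 s \<Longrightarrow> h (U, v + v') = h (U, v) + h (U, v')"
    and "\<And>U V v. U \<in> Alt2 s \<Longrightarrow> V \<in> TT \<Longrightarrow> h (U \<odot>\<^sub>T V, v) = h (U, act V v)"
  shows "frag_eval h f = 0"
  using assms(1) unfolding lambda2_ker_def by (rule tensor_ker_vanish) (auto intro: assms)

lemma quot_eq: "quot v + quot w = quot (v + w)"
proof -
  have "quot v + quot w = (frag_of (s2 s, v) + frag_of (s2 s, w)) +o ker2"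
    unfolding lambda2_ker_def by (rule tensor_coset_plus)
  also have "\<dots> = quot (v + w)"
    unfolding lambda2_ker_def tensor_coset_eq_iff
    using ker2_rules(6)[OF ker2_rules(4) ker2_rules(2)[OF Alt2_closed(3), of v w]]
    by (simp add: lambda2_ker_def algebra_simps)
  finally show ?thesis .
qed

lemma coset2_eq_iff: "f +o ker2 = f' +o ker2 \<longleftrightarrow> f - f' \<in> ker2"
  unfolding lambda2_ker_def by (rule tensor_coset_eq_iff)

text \<open>Since \<open>s\<^sub>2 y \<otimes> v = s\<^sub>2 \<otimes> y v\<close>, every element is of the form \<open>s\<^sub>2 \<otimes> v\<close>.\<close>

lemma reduce_to_quot:
  assumes "Poly_Mapping.keys f \<subseteq> Alt2 s \<times> UNIV"
  shows "\<exists>v. f - frag_of (s2 s, v) \<in> ker2"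
  using assms
proof (induction f rule: frag_induction)
  case zero
  have "0 - frag_of (s2 s, 0) \<in> ker2"
    using ker2_rules(2)[OF Alt2_closed(3), of 0 0] by simp
  then show ?case by blast
next
  case (one p)
  then obtain y v where "p = (s2 s \<odot>\<^sub>T y, v)" "y \<in> TT" by (auto simp: Alt2_eq)
  then show ?case using ker2_rules(3)[OF Alt2_closed(3), of y v] by blast
next
  case (diff a b)
  then obtain v w where v: "a - frag_of (s2 s, v) \<in> ker2" and w: "b - frag_of (s2 s, w) \<in> ker2" by blast
  have "(a - frag_of (s2 s, v)) - (b - frag_of (s2 s, w)) +
      (frag_of (s2 s, (v - w) + w) - frag_of (s2 s, v - w) - frag_of (s2 s, w)) \<in> ker2"
    by (intro ker2_rules Alt2_closed v w)
  then have "a - b - frag_of (s2 s, v - w) \<in> ker2" by (simp add: algebra_simps)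
  then show ?case by blast
qed

lemma quot_zero:
  assumes "alt v = 0"
  shows "frag_of (s2 s, v) \<in> ker2"
proof -
  let ?r = "aa_one s + goldman s" and ?y = "s (1 / 2) v"
  have 2: "v + v = s 2 v" using scale_left_distrib[of 1 1 v] by simp
  \<comment> \<open>The hypothesis says that \<epsilon> \<sigma>(v) = v, so 1 + g doubles v and
    hence returns v from its half.\<close>
  have "act ?r ?y = s (1 / 2) (v + of_int \<epsilon> * \<sigma> v)"
    by (simp add: act_add_left act_goldman \<sigma>_scale scale_right_distrib)
  also have "v + of_int \<epsilon> * \<sigma> v = s 2 v" using assms 2 by simp
  also have "s (1 / 2) (s 2 v) = v" using two_nonzero by simp
  finally have y: "act ?r ?y = v" .
  have 1: "frag_of (s2 s \<odot>\<^sub>T ?r, ?y) - frag_of (s2 s, act ?r ?y) \<in> ker2"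
    by (intro ker2_rules Alt2_closed) simp
  have 2: "frag_of (s2 s \<odot>\<^sub>T ?r, ?y) \<in> ker2"
    using ker2_rules(6)[OF ker2_rules(4) ker2_rules(1)[OF Alt2_closed(4) Alt2_closed(4), of ?y]]
      tclass_plus[of 0 0]
    by (simp add: s2_mult_sym)
  show ?thesis using ker2_rules(6)[OF 2 1] by (simp add: y)
qed

text \<open>The action map sending U \<otimes> v to U v is well defined on the tensor product and
  takes \<open>s2\<close> \<otimes> v to alt v, so equal classes have equal images. The converse is
  \<open>quot_zero\<close> applied to the difference.\<close>

lemma quot_eq_iff: "quot v = quot w \<longleftrightarrow> alt v = alt w"
proof
  assume "quot v = quot w"
  then have "frag_of (s2 s, v) - frag_of (s2 s, w) \<in> ker2" by (simp add: coset2_eq_iff)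
  then have "frag_eval (\<lambda>(U, v). act U v) (frag_of (s2 s, v) - frag_of (s2 s, w)) = 0"
    by (rule ker2_vanish) (auto simp: act_add_left act_add_right act_mult Alt2_subset)
  then show "alt v = alt w" by (simp add: frag_eval_diff act_s2)
next
  assume "alt v = alt w"
  moreover have "alt (v - w) = alt v - alt w" by (simp add: \<sigma>_diff right_diff_distrib)
  ultimately have "alt (v - w) = 0" by (simp only: diff_self)
  then have "frag_of (s2 s, (v - w) + w) - frag_of (s2 s, v - w) - frag_of (s2 s, w) +
      frag_of (s2 s, v - w) \<in> ker2"
    by (intro ker2_rules Alt2_closed quot_zero)
  then show "quot v = quot w" by (simp add: coset2_eq_iff)
qed

lemma lambda2_carrier: "carrier (lambda2 s \<sigma>) = range (\<lambda>v. quot v)"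
proof -
  have "{f +o ker2 |f. Poly_Mapping.keys f \<subseteq> Alt2 s \<times> UNIV} = range (\<lambda>v. quot v)"
  proof
    show "{f +o ker2 |f. Poly_Mapping.keys f \<subseteq> Alt2 s \<times> UNIV} \<subseteq> range (\<lambda>v. quot v)"
    proof clarify
      fix f :: "('a \<times> 'a \<Rightarrow>\<^sub>0 int) set \<times> 'a \<Rightarrow>\<^sub>0 int"
      assume "Poly_Mapping.keys f \<subseteq> Alt2 s \<times> UNIV"
      then obtain v where "f +o ker2 = quot v"
        using reduce_to_quot unfolding coset2_eq_iff[symmetric] by metis
      then show "f +o ker2 \<in> range (\<lambda>v. quot v)" by (rule image_eqI) simp
    qed
    show "range (\<lambda>v. quot v) \<subseteq> {f +o ker2 |f. Poly_Mapping.keys f \<subseteq> Alt2 s \<times> UNIV}"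
    proof clarify
      fix v :: 'a
      have "Poly_Mapping.keys (frag_of (s2 s, v)) \<subseteq> Alt2 s \<times> UNIV"
        using Alt2_closed(3) by simp
      then show "\<exists>f. quot v = f +o ker2 \<and> Poly_Mapping.keys f \<subseteq> Alt2 s \<times> UNIV"
        by (intro exI[of _ "frag_of (s2 s, v)"] conjI refl)
    qed
  qed
  then show ?thesis by (simp add: lambda2_def tensor_carrier_def lambda2_ker_def)
qed

lemma lambda2_smult: "k \<odot>\<^bsub>lambda2 s \<sigma>\<^esub> quot v = quot (s k v)"
proof -
  define K where "K = (\<lambda>x. frag_extend (\<lambda>(U :: ('a \<times> 'a \<Rightarrow>\<^sub>0 int) set, v). frag_of (U, s k v)) x)"
  obtain S where S: "ker2 = group_closure S"
    unfolding lambda2_ker_def using tensor_ker_group_closure by blast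
  have "K x \<in> ker2" if "x \<in> ker2" for x
    using that unfolding lambda2_ker_def tensor_ker_def
  proof (rule group_closure_map)
    fix x
    assume "x \<in> {frag_of (x + x', y) - frag_of (x, y) - frag_of (x', y) |x x' y.
          x \<in> Alt2 s \<and> x' \<in> Alt2 s \<and> y \<in> UNIV} \<union>
         {frag_of (x, y + y') - frag_of (x, y) - frag_of (x, y') |x y y'.
          x \<in> Alt2 s \<and> y \<in> UNIV \<and> y' \<in> UNIV} \<union>
         {frag_of (x \<odot>\<^sub>T r, y) - frag_of (x, act r y) |x r y.
          x \<in> Alt2 s \<and> r \<in> TT \<and> y \<in> UNIV}" (is "_ \<in> ?G")
    then consider U U' v where "U \<in> Alt2 s" "U' \<in> Alt2 s" "x = frag_of (U + U', v) - frag_of (U, v) - frag_of (U', v)"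
      | U v v' where "U \<in> Alt2 s" "x = frag_of (U, v + v') - frag_of (U, v) - frag_of (U, v')"
      | U r v where "U \<in> Alt2 s" "r \<in> TT" "x = frag_of (U \<odot>\<^sub>T r, v) - frag_of (U, act r v)"
      by blast
    \<comment> \<open>Scaling the second factor takes each relation to a relation of the same kind;
      for the balancing relation this is the \<open>K\<close>-linearity of the action.\<close>
    then have "K x \<in> ker2"
      by cases (simp_all add: K_def frag_extend_diff scale_right_distrib act_scale[symmetric] ker2_rules)
    then show "K x \<in> group_closure ?G" by (simp only: lambda2_ker_def tensor_ker_def)
  qed (simp add: K_def frag_extend_diff)
  then have "(\<Union>x\<in>quot v. K x +o ker2) = K (frag_of (s2 s, v)) +o ker2"
    unfolding S by (intro UN_coset) (simp_all add: K_def frag_extend_add)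
  then show ?thesis by (simp add: lambda2_def K_def)
qed

text \<open>By adjointness the form at U \<otimes> v and U' \<otimes> v' depends only on the
  elements of \<open>A\<close> obtained by action. This makes the inner lift, and then the outer
  one, respect the relations, so both can be evaluated on the representatives with first factor
  \<open>s2\<close>.\<close>

lemma lambda2_form: "form (lambda2 s \<sigma>) (quot v) (quot w) = T (alt v) w"
proof -
  have inner: "tensor_lift (\<lambda>(U', v'). T v (act (Alt2_form s \<sigma> U U') v')) (quot w) = T (act U v) w"
    if U: "U \<in> Alt2 s" for U v
  proof -
    obtain x where x: "x \<in> TT" "U = s2 s \<odot>\<^sub>T x" using U by (auto simp: Alt2_eq)
    \<comment> \<open>With U = \<open>s2\<close> x, the hermitian form is the adjoint of x times U',
      and adjointness moves x over to v. The right-hand side is visibly biadditive and balanced in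
      U' and v'.\<close>
    have form: "T v (act (Alt2_form s \<sigma> U U') v') = T (act x v) (act U' v')" if "U' \<in> Alt2 s" for U' v'
      using x that Alt2_subset[OF that] by (simp add: Alt2_form_eq act_mult trace_form_act)
    have "tensor_lift (\<lambda>(U', v'). T v (act (Alt2_form s \<sigma> U U') v')) (quot w) =
        frag_eval (\<lambda>(U', v'). T v (act (Alt2_form s \<sigma> U U') v')) (frag_of (s2 s, w))"
      unfolding lambda2_ker_def
    proof (rule tensor_lift_tensor_coset)
      fix f assume "f \<in> tensor_ker (Alt2 s) TT (aa_mult s) UNIV (twisted_action \<sigma>)"
      then have "f \<in> ker2" by (simp add: lambda2_ker_def)
      then show "frag_eval (\<lambda>(U', v'). T v (act (Alt2_form s \<sigma> U U') v')) f = 0"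
        by (rule ker2_vanish)
          (auto simp: form Alt2_closed act_add_left act_add_right act_mult Alt2_subset T_add)
    qed
    also have "\<dots> = T v (act (aa_inv s \<sigma> U) w)" by (simp add: Alt2_form_s2[OF U])
    also have "\<dots> = T (act U v) w" by (rule trace_form_act[OF Alt2_subset[OF U]])
    finally show ?thesis .
  qed
  let ?h = "\<lambda>(U, v). tensor_lift (\<lambda>(U', v'). T v (act (Alt2_form s \<sigma> U U') v')) (quot w)"
  have "tensor_lift ?h (quot v) = frag_eval ?h (frag_of (s2 s, v))"
    unfolding lambda2_ker_def[of s \<sigma>]
  proof (rule tensor_lift_tensor_coset, fold lambda2_ker_def)
    fix f assume "f \<in> ker2"
    then show "frag_eval ?h f = 0"
      by (rule ker2_vanish)
        (auto simp: inner Alt2_closed act_add_left act_add_right act_mult Alt2_subset T_add)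
  qed
  also have "\<dots> = T (alt v) w" by (simp add: inner Alt2_closed act_s2)
  finally show ?thesis by (simp add: lambda2_def)
qed

lemma lambda2_presented: "presents s (\<lambda>v w. T (alt v) w) (\<lambda>v. quot v) (lambda2 s \<sigma>)"
proof -
  have "\<zero>\<^bsub>lambda2 s \<sigma>\<^esub> = quot 0"
  proof -
    have "frag_of (s2 s, 0) \<in> ker2" by (rule quot_zero) simp
    then have "quot 0 = 0 +o ker2" unfolding coset2_eq_iff by simp
    then show ?thesis by (simp add: lambda2_def)
  qed
  moreover have "quot v \<oplus>\<^bsub>lambda2 s \<sigma>\<^esub> quot w = quot (v + w)" for v w
    using quot_eq[of v w] by (simp add: lambda2_def)
  ultimately show ?thesis
    unfolding presents_def using lambda2_carrier lambda2_smult lambda2_form by blast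
qed

text \<open>Both spaces are presented by the same form T(alt v, w) on \<open>A\<close>, with maps
  whose fibres are those of alt. The radical of this form is the kernel of alt, by nondegeneracy of
  T.\<close>

lemma lambda2_SW_eq: "SW_eq (lambda2 s \<sigma>) (scale_form 2 (trace_form_part s \<sigma> (- \<epsilon>)))"
proof -
  have half_eq_iff: "s (1 / 2) (alt v) = s (1 / 2) (alt w) \<longleftrightarrow> alt v = alt w" for v w
    using two_nonzero by simp
  have bil: "T (alt (u + v)) w = T (alt u) w + T (alt v) w" "T (alt (s k v)) w = k * T (alt v) w" for u v w k
    unfolding alt_linear by (rule T_add T_scale)+
  have nd: "alt v = alt 0" if "\<And>w. T (alt v) w = 0" for v
    using T_nondeg[of "alt v"] that by simp
  have "nondeg_symmetric_space (lambda2 s \<sigma>)"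
    by (rule presents_nondeg[OF lambda2_presented bil alt_form_sym]) (unfold quot_eq_iff, rule nd)
  moreover have "nondeg_symmetric_space (scale_form 2 (trace_form_part s \<sigma> (- \<epsilon>)))"
    by (rule presents_nondeg[OF trace_form_part_presented bil alt_form_sym]) (unfold half_eq_iff, rule nd)
  moreover have "isometric (lambda2 s \<sigma>) (scale_form 2 (trace_form_part s \<sigma> (- \<epsilon>)))"
    by (rule presents_isometric[OF lambda2_presented trace_form_part_presented])
      (simp only: quot_eq_iff half_eq_iff)
  ultimately show ?thesis by (simp add: SW_eq_def)
qed

end

theorem corollary4p15:
  fixes scale :: "'k::field \<Rightarrow> 'a::ring_1 \<Rightarrow> 'a" and \<sigma> :: "'a \<Rightarrow> 'a"
  assumes "CHAR('k) \<noteq> 2"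
    and "azumaya_algebra scale"
    and "involution_first_kind scale \<sigma>"
  shows "SW_eq (lambda2 scale \<sigma>)
    (scale_form 2 (trace_form_part scale \<sigma> (- involution_sign scale \<sigma>)))"
proof -
  interpret azumaya_involution scale \<sigma>
    by unfold_locales (fact assms(2), fact assms(3))
  \<comment> \<open>Surjectivity of the sandwich map, applied to x \<mapsto> Trd(x) 1, supplies a
    representative of the Goldman element.\<close>
  obtain g where "\<And>x. sandwich_frag g x = scale (Trd scale x) 1"
    using sandwich_surj[of "\<lambda>x. scale (Trd scale x) 1"]
    by (auto simp: Trd_add Trd_scale scale_left_distrib)
  then interpret goldman_involution scale \<sigma> g
    by unfold_locales (use assms(1) in auto)
  show ?thesis by (rule lambda2_SW_eq)
qed

end
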